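(* Let $\beta\in(0,1)$ and let $(\mathcal{T}_n)_{n\ge 1}$ be the recursive trees with limited memory in the mesoscopic regime with parameter $\beta$, i.e. with $j(n)=n-\lfloor n^\beta\rfloor$. Then $\mathcal{T}_n$ converges in probability in the extended fringe sense, as $n\to\infty$, to the unique infinite sin-tree with fringe distribution $\varpi_{\mathrm{Poisson},1}$, the law of the Galton--Watson tree with Poisson offspring distribution of mean $1$. In particular, if $N_k(n)$ denotes the number of vertices of degree $k$ in $\mathcal{T}_n$, then for every $k\ge1$, $$\frac{N_k(n)}{n}\longrightarrow\frac{e^{-1}}{(k-1)!}\quad\text{in probability, as } n\to\infty.$$
   Context: **Model.** Let $j:\mathbb{N}\to\mathbb{Z}_{\ge 0}$ be non-decreasing with $j(n)\le n$. $\mathcal{T}_1$ is the tree with the single vertex $1$ (the root of all the trees) and no edges. Given $\mathcal{T}_n$ (vertex set $\{1,\dots,n\}$), $\mathcal{T}_{n+1}$ is obtained by adding vertex $n+1$ and an edge between $n+1$ and a vertex chosen uniformly at random, independently of the past, from $\{v\in\{1,\dots,n\}: j(n)\le v\le n\}$. Mesoscopic regime: $j(n)=n-\lfloor n^\beta\rfloor$. **Fringe convergence.** $\mathbb{T}$ is the set of finite rooted trees (including the empty tree $\emptyset$), considered up to root-preserving isomorphism, with metric $d_{\mathbb{T}}(\mathbf{s},\mathbf{t})=1/(1+R^* )$, $R^*=\sup\{r: B(\mathbf{t},r)\simeq B(\mathbf{s},r)\}$, where $B(\mathbf{t},r)$ is the ball of radius $r$ about the root. Sequences of trees carry the metric $\sum_i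 2^{-i}d_{\mathbb{T}}(\mathbf{t}_i,\mathbf{s}_i)$. For $\mathbf{t}\in\mathbb{T}$ with root $\rho$ and a vertex $v$ at distance $h$ from $\rho$, let $(v_0=v,v_1,\dots,v_h=\rho)$ be the path from $v$ to $\rho$. Let $f_0(v,\mathbf{t})$ be the subtree rooted at $v$ of all vertices whose path from the root passes through $v$; for $1\le i\le h$ let $f_i(v,\mathbf{t})$ be the subtree rooted at $v_i$ of all vertices whose path from the root passes through $v_i$ but not through $v_{i-1}$; and let $f_i(v,\mathbf{t})=\emptyset$ for $i>h$. Put $F_k(v,\mathbf{t})=(f_0(v,\mathbf{t}),\dots,f_k(v,\mathbf{t}))$. A sin-tree is a sequence $(\mathbf{t}_0,\mathbf{t}_1,\dots)$ of non-empty finite rooted trees, thought of as the infinite tree obtained by attaching $\mathbf{t}_i$ by its root at vertex $i$ of the path $0,1,2,\dots$; put $F_k(0,(\mathbf{t}_i)_i)=(\mathbf{t}_0,\dots,\mathbf{t}_k)$. Its monotone representation is $(\bar{\mathbf{t}}_0,\bar{\mathbf{t}}_1,\dots)$, where $\bar{\mathbf{t}}_i$ is the finite tree rooted at $i$ formed by $\mathbf{t}_0,\dots,\mathbf{t}_i$ and the path edges between $0,\dots,i$. For $\mathbf{s},\mathbf{t}\in\mathbb{T}$ let $Q(\mathbf{s},\mathbf{t})$ be the number of children of the root of $\mathbf{s}$ whose descendant subtree is root-isomorphic to $\mathbf{t}$. A probability measure $\varpi$ on $\mathbb{T}$ is a fringe distribution if $\sum_{\mathbf{s}}\varpi(\mathbf{s})Q(\mathbf{s},\mathbf{t})=\varpi(\mathbf{t})$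 for all $\mathbf{t}$. The unique sin-tree with fringe distribution $\varpi$ is the random sin-tree whose monotone representation satisfies, for all $i\ge0$ and all $\bar{\mathbf{t}}_0,\dots,\bar{\mathbf{t}}_i$, $$\mathbb{P}\big((\bar{\mathbf{t}}_0(\mathcal{T}),\dots,\bar{\mathbf{t}}_i(\mathcal{T}))=(\bar{\mathbf{t}}_0,\dots,\bar{\mathbf{t}}_i)\big)=\varpi(\bar{\mathbf{t}}_i)\prod_{m=1}^i Q(\bar{\mathbf{t}}_m,\bar{\mathbf{t}}_{m-1}).$$ $\mathcal{T}_n$ converges in probability in the extended fringe sense to a random sin-tree $\mathcal{T}_\infty$ if for every $k\ge0$ the random empirical measure $\frac1n\sum_{v\in\mathcal{T}_n}\delta_{F_k(v,\mathcal{T}_n)}$ converges in probability, in the topology of weak convergence of probability measures, to the law of $F_k(0,\mathcal{T}_\infty)$. *)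

theory Defs
  imports "HOL-Probability.Probability" "HOL-Library.Multiset"
begin

section \<open>Finite rooted trees up to root-preserving isomorphism\<close>

text \<open>
  A root-isomorphism class of non-empty finite rooted trees is determined by the multiset of the
  classes of the subtrees hanging off the children of the root, so the classes are the elements of
  the following datatype, and two finite rooted trees are root-isomorphic iff they have equal
  classes.  The space of finite rooted trees including the empty tree is \<open>rtree option\<close>, where
  \<open>None\<close> is the empty tree.
\<close>

datatype rtree = Node (children: "rtree multiset")

primrec trunc :: "nat \<Rightarrow> rtree \<Rightarrow> rtree" where
  "trunc 0 t = Node {#}"
| "trunc (Suc r) t = Node (image_mset (trunc r) (children t))"

definition tball :: "rtree option \<Rightarrow> nat \<Rightarrow> rtree option" where
  "tball t r = map_option (trunc r) t"

definition agree_radius :: "rtree option \<Rightarrow> rtree option \<Rightarrow> enat" where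
  "agree_radius s t = Sup {enat r | r. tball t r = tball s r}"

text \<open>\<open>1 / (1 + R)\<close>, with \<open>1 / \<infinity> = 0\<close>.  For the empty against a non-empty tree, no radius
  agrees, the supremum is \<open>0\<close> and the distance is \<open>1\<close>.\<close>

definition tree_dist :: "rtree option \<Rightarrow> rtree option \<Rightarrow> real" where
  "tree_dist s t = (case agree_radius s t of enat R \<Rightarrow> 1 / (1 + real R) | \<infinity> \<Rightarrow> 0)"

text \<open>The tuples \<open>(t\<^sub>0, \<dots>, t\<^sub>k)\<close> are the lists of length \<open>k + 1\<close>.\<close>

definition tuples :: "nat \<Rightarrow> rtree option list set" where
  "tuples k = {xs. length xs = Suc k}"

definition tuple_dist :: "nat \<Rightarrow> rtree option list \<Rightarrow> rtree option list \<Rightarrow> real" where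
  "tuple_dist k xs ys = (\<Sum>i\<le>k. (1/2) ^ i * tree_dist (xs ! i) (ys ! i))"

definition tuple_topology :: "nat \<Rightarrow> rtree option list topology" where
  "tuple_topology k = Metric_space.mtopology (tuples k) (tuple_dist k)"

lemma trunc_mono:
  assumes "trunc r s = trunc r t" "q \<le> r"
  shows "trunc q s = trunc q t"
proof -
  have "trunc q (trunc r u) = trunc q u" if "q \<le> r" for u r q
    using that
  proof (induction q arbitrary: r u)
    case (Suc q)
    then obtain r' where r: "r = Suc r'" "q \<le> r'" by (cases r) auto
    with Suc.IH show ?case by (simp add: multiset.map_comp comp_def)
  qed auto
  then show ?thesis using assms by metis
qed

lemma trunc_large: "\<exists>n. \<forall>r\<ge>n. trunc r t = t"
proof (induction t)
  case (Node ts)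
  then obtain N where N: "\<And>t. t \<in># ts \<Longrightarrow> \<forall>r\<ge>N t. trunc r t = t" by metis
  define n where "n = (\<Sum>t\<in>set_mset ts. N t)"
  have n: "N t \<le> n" if "t \<in># ts" for t
    unfolding n_def using that by (intro member_le_sum) auto
  have "trunc r (Node ts) = Node ts" if Suc_n: "r \<ge> Suc n" for r
  proof -
    obtain r' where r: "r = Suc r'" "n \<le> r'" using Suc_n by (cases r) auto
    have "image_mset (trunc r') ts = image_mset (\<lambda>t. t) ts"
    proof (rule image_mset_cong)
      fix t assume t: "t \<in># ts"
      then have "N t \<le> r'" using n r(2) order_trans by blast
      then show "trunc r' t = t" using N t by blast
    qed
    then show ?thesis using r by simp
  qed
  then show ?case by blast
qed

lemma tball_mono: "tball s r = tball t r \<Longrightarrow> q \<le> r \<Longrightarrow> tball s q = tball t q"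
  by (cases s; cases t) (auto simp: tball_def intro: trunc_mono)

lemma tball_large: "\<exists>n. \<forall>r\<ge>n. tball t r = t"
  using trunc_large by (cases t) (fastforce simp: tball_def)+

lemma tree_dist_le_iff:
  "tree_dist s t \<le> 1 / (1 + real r) \<longleftrightarrow> r = 0 \<or> tball s r = tball t r"
proof -
  let ?A = "{enat r | r. tball t r = tball s r}"
  have "r = 0 \<or> tball s r = tball t r" if "enat r \<le> Sup ?A"
  proof (rule ccontr)
    assume c: "\<not> ?thesis"
    have "x \<le> enat (r - 1)" if x: "x \<in> ?A" for x
    proof -
      obtain q where q: "x = enat q" "tball t q = tball s q" using x by blast
      then have "\<not> r \<le> q" using c tball_mono by metis
      then show ?thesis using q by simp
    qed
    then have "Sup ?A \<le> enat (r - 1)" by (rule Sup_least)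
    then have "enat r \<le> enat (r - 1)" using that by (rule order_trans[rotated])
    then show False using c by (cases r) auto
  qed
  moreover have "enat r \<le> Sup ?A" if "r = 0 \<or> tball s r = tball t r"
    using that
  proof
    assume "tball s r = tball t r"
    then show ?thesis by (intro Sup_upper) auto
  qed (simp flip: zero_enat_def)
  ultimately have "enat r \<le> agree_radius s t \<longleftrightarrow> r = 0 \<or> tball s r = tball t r"
    unfolding agree_radius_def by blast
  moreover have "tree_dist s t \<le> 1 / (1 + real r) \<longleftrightarrow> enat r \<le> agree_radius s t"
    by (auto simp: tree_dist_def field_simps split: enat.splits)
  ultimately show ?thesis by simp
qed

lemma tree_dist_cases:
  obtains "tree_dist s t = 0" | R where "tree_dist s t = 1 / (1 + real R)"
  by (cases "agree_radius s t") (auto simp: tree_dist_def)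

lemma tree_dist_nonneg [simp]: "0 \<le> tree_dist s t"
  by (cases s t rule: tree_dist_cases) auto

lemma tree_dist_commute: "tree_dist s t = tree_dist t s"
proof -
  have "{enat r | r. tball t r = tball s r} = {enat r | r. tball s r = tball t r}" by metis
  then show ?thesis by (simp add: tree_dist_def agree_radius_def)
qed

lemma tree_dist_zero [simp]: "tree_dist s t = 0 \<longleftrightarrow> s = t"
proof
  assume 0: "tree_dist s t = 0"
  obtain m n where "\<forall>r\<ge>m. tball s r = s" "\<forall>r\<ge>n. tball t r = t" using tball_large by metis
  moreover have "tball s (Suc (m + n)) = tball t (Suc (m + n))"
    using tree_dist_le_iff[of s t "Suc (m + n)"] 0 by simp
  ultimately show "s = t" by simp
next
  assume "s = t"
  show "tree_dist s t = 0"
  proof (rule ccontr)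
    assume "tree_dist s t \<noteq> 0"
    then obtain R where "tree_dist s t = 1 / (1 + real R)" by (metis tree_dist_cases)
    with tree_dist_le_iff[of s t "Suc R"] \<open>s = t\<close>
    have "1 / (1 + real R) \<le> 1 / (1 + real (Suc R))" by simp
    then show False by (simp add: divide_simps)
  qed
qed

lemma tree_dist_ultrametric: "tree_dist s u \<le> max (tree_dist s t) (tree_dist t u)"
proof -
  consider "max (tree_dist s t) (tree_dist t u) = 0"
    | R where "max (tree_dist s t) (tree_dist t u) = 1 / (1 + real R)"
    using tree_dist_cases[of s t] tree_dist_cases[of t u] by (metis max_def)
  then show ?thesis
  proof cases
    case 1
    then have "tree_dist s t = 0" "tree_dist t u = 0"
      using tree_dist_nonneg[of s t] tree_dist_nonneg[of t u] by linarith+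
    then show ?thesis by simp
  next
    case 2
    then have "tree_dist s t \<le> 1 / (1 + real R)" "tree_dist t u \<le> 1 / (1 + real R)" by linarith+
    then have "tree_dist s u \<le> 1 / (1 + real R)" unfolding tree_dist_le_iff by metis
    with 2 show ?thesis by simp
  qed
qed

lemma Metric_space_tree_dist: "Metric_space UNIV tree_dist"
proof
  fix s t u
  show "tree_dist s u \<le> tree_dist s t + tree_dist t u"
    using tree_dist_ultrametric[of s u t] tree_dist_nonneg[of s t] tree_dist_nonneg[of t u]
    by linarith
qed (auto simp: tree_dist_commute)

lemma Metric_space_tuple_dist: "Metric_space (tuples k) (tuple_dist k)"
proof
  fix xs ys zs
  show "0 \<le> tuple_dist k xs ys" by (simp add: tuple_dist_def sum_nonneg)
  show "tuple_dist k xs ys = tuple_dist k ys xs"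
    by (simp add: tuple_dist_def tree_dist_commute)
  show "tuple_dist k xs zs \<le> tuple_dist k xs ys + tuple_dist k ys zs"
  proof -
    interpret Metric_space UNIV tree_dist by (rule Metric_space_tree_dist)
    show ?thesis
      unfolding tuple_dist_def sum.distrib[symmetric] distrib_left[symmetric]
      by (intro sum_mono mult_left_mono triangle) auto
  qed
  assume "xs \<in> tuples k" "ys \<in> tuples k"
  then show "tuple_dist k xs ys = 0 \<longleftrightarrow> xs = ys"
    by (auto simp: tuple_dist_def tuples_def sum_nonneg_eq_0_iff list_eq_iff_nth_eq less_Suc_eq_le)
qed

section \<open>Rooted graphs and fringe decompositions\<close>

record 'a rgraph =
  vertices :: "'a set"
  edges :: "'a set set"
  rt :: 'a

definition is_path :: "'a rgraph \<Rightarrow> 'a \<Rightarrow> 'a \<Rightarrow> 'a list \<Rightarrow> bool" where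
  "is_path G a b xs \<longleftrightarrow> xs \<noteq> [] \<and> hd xs = a \<and> last xs = b \<and> distinct xs \<and> set xs \<subseteq> vertices G \<and>
     (\<forall>i. Suc i < length xs \<longrightarrow> {xs ! i, xs ! Suc i} \<in> edges G)"

text \<open>Only used for trees, where there is exactly one path between any two vertices.\<close>

definition the_path :: "'a rgraph \<Rightarrow> 'a \<Rightarrow> 'a \<Rightarrow> 'a list" where
  "the_path G a b = (THE xs. is_path G a b xs)"

definition descendants :: "'a rgraph \<Rightarrow> 'a \<Rightarrow> 'a set" where
  "descendants G v = {w \<in> vertices G. v \<in> set (the_path G (rt G) w)}"

definition subtree :: "'a rgraph \<Rightarrow> 'a set \<Rightarrow> 'a \<Rightarrow> 'a rgraph" where
  "subtree G W v = \<lparr>vertices = W, edges = {e \<in> edges G. e \<subseteq> W}, rt = v\<rparr>"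

inductive has_class :: "'a rgraph \<Rightarrow> rtree \<Rightarrow> bool" where
  "\<lbrakk>rt G \<in> vertices G; C = {c \<in> vertices G. {rt G, c} \<in> edges G}; finite C;
    \<And>c. c \<in> C \<Longrightarrow> has_class (subtree G (descendants G c) c) (f c)\<rbrakk>
   \<Longrightarrow> has_class G (Node (image_mset f (mset_set C)))"

lemma has_class_unique:
  assumes "has_class G s" "has_class G t"
  shows "s = t"
  using assms
proof (induction arbitrary: t)
  case (1 G C f)
  from 1(6) show ?case
  proof cases
    case (1 C' g)
    have "C' = C" using 1 \<open>C = _\<close> by simp
    moreover have "f c = g c" if "c \<in> C" for c
      using 1 \<open>C' = C\<close> "1.IH" that by auto
    ultimately show ?thesis
      using 1 \<open>finite C\<close> by (auto intro!: image_mset_cong)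
  qed
qed

text \<open>
  The empty graph has the class \<open>None\<close> (the empty tree).  An infinite tree has no class in
  \<open>rtree\<close> and is given the junk value \<open>None\<close>; this is only relevant for the null event that the
  critical Galton--Watson tree below is infinite.
\<close>

definition iso_class :: "'a rgraph \<Rightarrow> rtree option" where
  "iso_class G = (if \<exists>t. has_class G t then Some (THE t. has_class G t) else None)"

definition fringe :: "nat \<Rightarrow> 'a \<Rightarrow> 'a rgraph \<Rightarrow> rtree option" where
  "fringe i v G = (let p = the_path G v (rt G) in
     if i = 0 then iso_class (subtree G (descendants G v) v)
     else if i < length p
       then iso_class (subtree G (descendants G (p ! i) - descendants G (p ! (i - 1))) (p ! i))
     else None)"

definition fringe_tuple :: "nat \<Rightarrow> 'a \<Rightarrow> 'a rgraph \<Rightarrow> rtree option list" where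
  "fringe_tuple k v G = map (\<lambda>i. fringe i v G) [0..<Suc k]"

definition degree :: "'a rgraph \<Rightarrow> 'a \<Rightarrow> nat" where
  "degree G v = card {e \<in> edges G. v \<in> e}"

definition num_degree :: "'a rgraph \<Rightarrow> nat \<Rightarrow> nat" where
  "num_degree G k = card {v \<in> vertices G. degree G v = k}"

section \<open>Fringe distributions and random sin-trees\<close>

fun subtree_count :: "rtree option \<Rightarrow> rtree option \<Rightarrow> nat" where
  "subtree_count (Some s) (Some t) = count (children s) t"
| "subtree_count _ _ = 0"

definition fringe_distribution :: "rtree option measure \<Rightarrow> bool" where
  "fringe_distribution \<mu> \<longleftrightarrow> prob_space \<mu> \<and> sets \<mu> = UNIV \<and>
     (\<forall>t. ((\<lambda>s. measure \<mu> {s} * real (subtree_count s t)) has_sum measure \<mu> {t}) UNIV)"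

text \<open>Sin-trees are sequences \<open>t :: nat \<Rightarrow> rtree\<close>; attaching \<open>t i\<close> by its root at vertex \<open>i\<close> of
  the path, the tree rooted at \<open>Suc i\<close> has the children of \<open>t (Suc i)\<close> and the path vertex \<open>i\<close>.\<close>

primrec monotone_rep :: "(nat \<Rightarrow> rtree) \<Rightarrow> nat \<Rightarrow> rtree" where
  "monotone_rep t 0 = t 0"
| "monotone_rep t (Suc i) = Node (add_mset (monotone_rep t i) (children (t (Suc i))))"

definition sin_tree_space :: "(nat \<Rightarrow> rtree) measure" where
  "sin_tree_space = PiM UNIV (\<lambda>_. count_space UNIV)"

text \<open>\<open>L\<close> is the law of the random sin-tree with fringe distribution \<open>\<mu>\<close>.\<close>

definition sin_tree_law :: "rtree option measure \<Rightarrow> (nat \<Rightarrow> rtree) measure \<Rightarrow> bool" where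
  "sin_tree_law \<mu> L \<longleftrightarrow> fringe_distribution \<mu> \<and> prob_space L \<and> sets L = sets sin_tree_space \<and>
     (\<forall>i s. measure L {t \<in> space L. \<forall>m\<le>i. monotone_rep t m = s m} =
        measure \<mu> {Some (s i)} * (\<Prod>m=1..i. real (subtree_count (Some (s m)) (Some (s (m - 1))))))"

section \<open>Galton--Watson trees\<close>

text \<open>In the Ulam--Harris tree, the individual \<open>u\<close> has the children \<open>u @ [i]\<close> for \<open>i < \<xi> u\<close>.\<close>

definition gw_graph :: "(nat list \<Rightarrow> nat) \<Rightarrow> nat list rgraph" where
  "gw_graph \<xi> = (let W = {u. \<forall>k<length u. u ! k < \<xi> (take k u)} in
     \<lparr>vertices = W, edges = {{u, u @ [i]} | u i. u @ [i] \<in> W}, rt = []\<rparr>)"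

definition gw_law :: "nat pmf \<Rightarrow> rtree option measure" where
  "gw_law p = distr (PiM UNIV (\<lambda>_. measure_pmf p)) (count_space UNIV) (\<lambda>\<xi>. iso_class (gw_graph \<xi>))"

section \<open>Convergence in the extended fringe sense\<close>

definition borel_sigma :: "'a topology \<Rightarrow> 'a measure" where
  "borel_sigma X = sigma (topspace X) {U. openin X U}"

definition borel_probs :: "'a topology \<Rightarrow> 'a measure set" where
  "borel_probs X = {\<mu>. prob_space \<mu> \<and> sets \<mu> = sets (borel_sigma X)}"

text \<open>The coarsest topology on the Borel probability measures on \<open>X\<close> for which integration of
  each bounded continuous function is continuous.\<close>

definition weak_topology :: "'a topology \<Rightarrow> 'a measure topology" where
  "weak_topology X = topology_generated_by
     {{\<mu> \<in> borel_probs X. (\<integral>x. f x \<partial>\<mu>) \<in> U} | (f :: 'a \<Rightarrow> real) U.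
        continuous_map X euclideanreal f \<and> bounded (f ` topspace X) \<and> open U}"

definition converges_in_prob ::
  "'w measure \<Rightarrow> 'b topology \<Rightarrow> (nat \<Rightarrow> 'w \<Rightarrow> 'b) \<Rightarrow> 'b \<Rightarrow> bool" where
  "converges_in_prob M X Z c \<longleftrightarrow> c \<in> topspace X \<and>
     (\<forall>U. openin X U \<and> c \<in> U \<longrightarrow> (\<lambda>n. measure M {\<omega> \<in> space M. Z n \<omega> \<in> U}) \<longlonglongrightarrow> 1)"

definition empirical_fringe :: "nat \<Rightarrow> 'a rgraph \<Rightarrow> rtree option list measure" where
  "empirical_fringe k G = distr (uniform_count_measure (vertices G)) (borel_sigma (tuple_topology k))
     (\<lambda>v. fringe_tuple k v G)"

lemma measure_empirical_fringe:
  assumes "finite (vertices G)" "A \<in> sets (borel_sigma (tuple_topology k))"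
  shows "measure (empirical_fringe k G) A =
    card {v \<in> vertices G. fringe_tuple k v G \<in> A} / card (vertices G)"
proof -
  interpret Metric_space "tuples k" "tuple_dist k" by (rule Metric_space_tuple_dist)
  have "space (borel_sigma (tuple_topology k)) = tuples k"
    by (simp add: borel_sigma_def tuple_topology_def space_measure_of_conv)
  then have "(\<lambda>v. fringe_tuple k v G)
      \<in> measurable (uniform_count_measure (vertices G)) (borel_sigma (tuple_topology k))"
    by (auto simp: measurable_def space_uniform_count_measure sets_uniform_count_measure
        fringe_tuple_def tuples_def)
  moreover have "(\<lambda>v. fringe_tuple k v G) -` A \<inter> vertices G =
      {v \<in> vertices G. fringe_tuple k v G \<in> A}"
    by auto
  ultimately show ?thesis
    using assms by (simp add: empirical_fringe_def measure_distr space_uniform_count_measure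
        measure_uniform_count_measure)
qed

definition sin_tree_fringe :: "nat \<Rightarrow> (nat \<Rightarrow> rtree) measure \<Rightarrow> rtree option list measure" where
  "sin_tree_fringe k L = distr L (borel_sigma (tuple_topology k))
     (\<lambda>t. map (\<lambda>i. Some (t i)) [0..<Suc k])"

definition extended_fringe_converges ::
  "'w measure \<Rightarrow> (nat \<Rightarrow> 'w \<Rightarrow> 'a rgraph) \<Rightarrow> (nat \<Rightarrow> rtree) measure \<Rightarrow> bool" where
  "extended_fringe_converges M T L \<longleftrightarrow>
     (\<forall>k. converges_in_prob M (weak_topology (tuple_topology k))
        (\<lambda>n \<omega>. empirical_fringe k (T n \<omega>)) (sin_tree_fringe k L))"

section \<open>Recursive trees with limited memory\<close>

definition attach :: "'a rgraph \<Rightarrow> 'a \<Rightarrow> 'a \<Rightarrow> 'a rgraph" where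
  "attach G w v = \<lparr>vertices = insert w (vertices G), edges = insert {w, v} (edges G), rt = rt G\<rparr>"

text \<open>\<open>V n\<close> is the vertex to which \<open>n + 1\<close> is attached.  The trees are indexed from \<open>1\<close>;
  \<open>T 0\<close> is unconstrained.\<close>

definition limited_memory_trees ::
  "'w measure \<Rightarrow> (nat \<Rightarrow> nat) \<Rightarrow> (nat \<Rightarrow> 'w \<Rightarrow> nat rgraph) \<Rightarrow> bool" where
  "limited_memory_trees M j T \<longleftrightarrow> prob_space M \<and>
     (\<exists>V :: nat \<Rightarrow> 'w \<Rightarrow> nat.
        prob_space.indep_vars M (\<lambda>_. count_space UNIV) V {1..} \<and>
        (\<forall>n\<ge>1. distr M (count_space UNIV) (V n) =
                 measure_pmf (pmf_of_set {v \<in> {1..n}. j n \<le> v \<and> v \<le> n})) \<and>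
        (\<forall>\<omega>\<in>space M. T 1 \<omega> = \<lparr>vertices = {1}, edges = {}, rt = 1\<rparr> \<and>
                       (\<forall>n\<ge>1. T (Suc n) \<omega> = attach (T n \<omega>) (Suc n) (V n \<omega>))))"

definition mesoscopic :: "real \<Rightarrow> nat \<Rightarrow> nat" where
  "mesoscopic \<beta> n = n - nat \<lfloor>real n powr \<beta>\<rfloor>"

lemma mesoscopic_le: "mesoscopic \<beta> n \<le> n"
  by (simp add: mesoscopic_def)

lemma mono_mesoscopic:
  assumes "0 < \<beta>" "\<beta> < 1"
  shows "mono (mesoscopic \<beta>)"
proof (rule incseq_SucI)
  fix n :: nat
  have "real (Suc n) powr \<beta> \<le> real n powr \<beta> + 1"
  proof (cases "n = 0")
    case False
    then have "real (Suc n) = real n * (1 + 1 / real n)"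
      by (simp add: field_simps)
    then have "real (Suc n) powr \<beta> = real n powr \<beta> * (1 + 1 / real n) powr \<beta>"
      by (simp add: powr_mult)
    also have "(1 + 1 / real n) powr \<beta> \<le> (1 + 1 / real n) powr 1"
      using assms by (intro powr_mono) auto
    also have "real n powr \<beta> * (1 + 1 / real n) powr 1 = real n powr \<beta> + real n powr \<beta> / real n"
      by (simp add: algebra_simps)
    also have "real n powr \<beta> \<le> real n powr 1"
      using assms False by (intro powr_mono) auto
    then have "real n powr \<beta> / real n \<le> 1"
      using False by simp
    finally show ?thesis by (simp add: mult_left_mono)
  qed auto
  then have "\<lfloor>real (Suc n) powr \<beta>\<rfloor> \<le> \<lfloor>real n powr \<beta>\<rfloor> + 1" by linarith
  then show "mesoscopic \<beta> n \<le> mesoscopic \<beta> (Suc n)"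
    unfolding mesoscopic_def by linarith
qed

end

theory Submission
  imports Defs "HOL-Combinatorics.Multiset_Permutations" "HOL-Real_Asymp.Real_Asymp"
begin

text \<open>
  While a vertex is in the window, for about $w = n^\beta$ steps after its birth, each new vertex
  attaches to it with probability about $1/w$.  So it gets about a Poisson(1) number of children,
  these are born within distance $w$, and their own children are born in the same way; the
  interaction between different vertices is of order $1/w$.  Hence the descendant subtree of a
  typical vertex is close to a Galton--Watson tree with Poisson(1) offspring.  The following ideas
  turn this into a proof.

  \<^emph>\<open>Lower bounds suffice.\<close>  The space of tuples of trees is countable and its topology is discrete
  (\<open>tuple_topology_discrete\<close>).  If the empirical frequency of each single tuple is asymptotically
  at least its limit probability, then, since the limit probabilities have sum \<open>1\<close>, no mass is
  left over and the integrals of all bounded functions converge (\<open>integral_discrete_close\<close>).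

  \<^emph>\<open>Only the descendant subtrees matter.\<close>  In every finite rooted tree, the number of vertices with
  given fringe decomposition \<open>(t\<^sub>0, \<dots>, t\<^sub>k)\<close> is the number of vertices whose descendant subtree is the
  \<open>k\<close>-th tree of the monotone representation, times the product of the multiplicities \<open>Q\<close>
  (\<open>card_fringe_tuple\<close>).  The law of the sin-tree contains the same product.

  \<^emph>\<open>Plane trees.\<close>  Ordering children by label refines a descendant subtree to a plane tree.  A plane
  tree with \<open>N\<close> vertices and child numbers \<open>k\<^sub>1, \<dots>, k\<^sub>N\<close> has Galton--Watson probability
  \<open>e\<^sup>-\<^sup>N / (k\<^sub>1! \<cdots> k\<^sub>N!)\<close>.  In the recursive tree, the event that the subtree at \<open>v\<close> has this shape
  contains the disjoint union, over the possible child sets met in a depth-first exploration, of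
  events that prescribe the choices of the new vertices in a block after \<open>v\<close>.  There are at least
  \<open>\<Prod>\<^sub>i (w - N choose k\<^sub>i)\<close> such families of child sets and each has probability at least about
  \<open>w\<^sup>1\<^sup>-\<^sup>N e\<^sup>-\<^sup>N\<close>, which gives the required lower bound (\<open>prob_tree_event_limit\<close>).

  \<^emph>\<open>Concentration.\<close>  The block has length of order $w = o(n)$, so events at vertices at larger
  distance are exactly independent, and Chebyshev's inequality gives concentration of the number of
  vertices with a given shape (\<open>local_events_lower_bound\<close>).

  \<^emph>\<open>The limit object.\<close>  The total mass \<open>S\<close> of the finite plane trees satisfies
  \<open>e\<^sup>S\<^sup>-\<^sup>1 \<le> S\<close>, which forces \<open>S = 1\<close> (\<open>has_sum_pweight\<close>): the critical tree is almost
  surely finite.  The Poisson distribution enters once more in the identity \<open>pmf_gw_add_mset\<close>: biasing the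
  tree by the multiplicity of a child and removing that child gives an independent Galton--Watson
  tree.  Summed over the trees, this identity is the equation of a fringe distribution, and it shows that the trees along
  the spine of the sin-tree are independent Galton--Watson trees, whence existence of its law.
\<close>

section \<open>Rooted trees given by a parent map\<close>

lemma is_path_Cons:
  "is_path G a b (x # y # zs) \<longleftrightarrow>
     x = a \<and> x \<in> vertices G \<and> x \<notin> set (y # zs) \<and> {x, y} \<in> edges G \<and> is_path G y b (y # zs)"
proof -
  have "(\<forall>i. P i) \<longleftrightarrow> P 0 \<and> (\<forall>i. P (Suc i))" for P :: "nat \<Rightarrow> bool"
    by (metis not0_implies_Suc)
  from this[of "\<lambda>i. Suc i < length (x # y # zs) \<longrightarrow>
      {(x # y # zs) ! i, (x # y # zs) ! Suc i} \<in> edges G"]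
  show ?thesis by (auto simp: is_path_def)
qed

lemma is_path_rev: "is_path G a b xs \<Longrightarrow> is_path G b a (rev xs)"
proof -
  assume p: "is_path G a b xs"
  have "{rev xs ! i, rev xs ! Suc i} \<in> edges G" if i: "Suc i < length xs" for i
  proof -
    define j where "j = length xs - Suc (Suc i)"
    have "rev xs ! i = xs ! Suc j" "rev xs ! Suc i = xs ! j"
      using i by (auto simp: rev_nth j_def Suc_diff_Suc)
    moreover have "{xs ! j, xs ! Suc j} \<in> edges G"
      using p i by (auto simp: is_path_def j_def)
    ultimately show ?thesis by (simp add: insert_commute)
  qed
  then show ?thesis using p by (auto simp: is_path_def hd_rev last_rev)
qed

datatype ptree = PNode "ptree list"

primrec forget :: "ptree \<Rightarrow> rtree" where
  "forget (PNode ts) = Node (mset (map forget ts))"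

text \<open>
  Both random trees come with an ordered list of children for each vertex: by birth order in the
  Ulam--Harris tree, by label in the recursive tree.  The relation is inductive because the tree at
  a vertex of an infinite Galton--Watson tree has no shape.
\<close>
inductive shape :: "('a \<Rightarrow> 'a list) \<Rightarrow> 'a \<Rightarrow> ptree \<Rightarrow> bool" for ch where
  shapeI: "list_all2 (shape ch) (ch u) ts \<Longrightarrow> shape ch u (PNode ts)"

lemma shape_PNode [simp]: "shape ch u (PNode ts) \<longleftrightarrow> list_all2 (shape ch) (ch u) ts"
  by (auto elim: shape.cases intro: shapeI)

lemma shape_unique: "shape ch u \<tau> \<Longrightarrow> shape ch u \<sigma> \<Longrightarrow> \<tau> = \<sigma>"
proof (induction \<tau> arbitrary: u \<sigma>)
  case (PNode ts)
  obtain ss where s: "\<sigma> = PNode ss" by (cases \<sigma>)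
  have "list_all2 (shape ch) (ch u) ts" "list_all2 (shape ch) (ch u) ss" using PNode.prems s by auto
  then have "ts = ss"
    by (auto simp: list_all2_conv_all_nth intro!: nth_equalityI PNode.IH)
  then show ?case using s by simp
qed

definition tree_class :: "('a \<Rightarrow> 'a list) \<Rightarrow> 'a \<Rightarrow> rtree" where
  "tree_class ch u = forget (THE \<tau>. shape ch u \<tau>)"

lemma tree_class_shape: "shape ch u \<tau> \<Longrightarrow> tree_class ch u = forget \<tau>"
  unfolding tree_class_def using shape_unique by (metis the_equality)

text \<open>
  At the root \<open>r\<close>, \<open>par\<close> takes a default value: the root of a subtree keeps its parent in the
  whole tree.
\<close>
definition parent_graph :: "'a set \<Rightarrow> 'a \<Rightarrow> ('a \<Rightarrow> 'a) \<Rightarrow> 'a rgraph" where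
  "parent_graph W r par = \<lparr>vertices = W, edges = {{w, par w} | w. w \<in> W \<and> w \<noteq> r}, rt = r\<rparr>"

definition childset :: "'a set \<Rightarrow> 'a \<Rightarrow> ('a \<Rightarrow> 'a) \<Rightarrow> 'a \<Rightarrow> 'a set" where
  "childset W r par u = {c \<in> W. c \<noteq> r \<and> par c = u}"

text \<open>
  The vertex \<open>v\<close> lies on the way from \<open>w\<close> up to the root \<open>r\<close>.
\<close>
inductive below :: "('a \<Rightarrow> 'a) \<Rightarrow> 'a \<Rightarrow> 'a \<Rightarrow> 'a \<Rightarrow> bool" for par r v where
  below_refl: "below par r v v"
| below_step: "below par r v (par w) \<Longrightarrow> w \<noteq> r \<Longrightarrow> below par r v w"

text \<open>
  The rank, which is the label in the recursive tree and the depth in the Ulam--Harris tree,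
  makes the parent map well-founded also on infinite vertex sets.
\<close>
locale parent_tree =
  fixes W :: "'a set" and r :: 'a and par :: "'a \<Rightarrow> 'a" and rk :: "'a \<Rightarrow> nat"
  assumes root: "r \<in> W"
    and par_in: "w \<in> W \<Longrightarrow> w \<noteq> r \<Longrightarrow> par w \<in> W"
    and rk_par: "w \<in> W \<Longrightarrow> w \<noteq> r \<Longrightarrow> rk (par w) < rk w"
begin

abbreviation "G \<equiv> parent_graph W r par"
abbreviation "kids \<equiv> childset W r par"

lemma G_simps [simp]: "vertices G = W" "rt G = r"
  by (auto simp: parent_graph_def)

lemma edges_G: "edges G = {{w, par w} | w. w \<in> W \<and> w \<noteq> r}"
  by (auto simp: parent_graph_def)

lemma edge_iff: "{a, b} \<in> edges G \<longleftrightarrow>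
   (a \<in> W \<and> a \<noteq> r \<and> b = par a) \<or> (b \<in> W \<and> b \<noteq> r \<and> a = par b)"
  by (auto simp: edges_G doubleton_eq_iff)

lemma par_neq: "w \<in> W \<Longrightarrow> w \<noteq> r \<Longrightarrow> par w \<noteq> w"
  using rk_par[of w] by auto

text \<open>
  A path that ends in the root can never step down: after a step from a parent to a child it could
  only go on to children of children, because it may not return, and it would miss the root.
\<close>
lemma path_up_aux:
  assumes "is_path G w r (w # y # zs)"
  shows "y = par w \<and> w \<noteq> r"
proof -
  have "w \<noteq> r" using assms by (auto simp: is_path_def split: if_splits)
  moreover have False if "is_path G w r (w # y # zs)" "y \<noteq> r" "w = par y" for w y zs
    using that
  proof (induction zs arbitrary: w y)
    case Nil
    then show ?case by (auto simp: is_path_def)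
  next
    case (Cons z zs)
    have p: "is_path G y r (y # z # zs)" and "w \<noteq> z"
      using Cons.prems(1) by (auto simp: is_path_Cons)
    then have "{y, z} \<in> edges G" by (auto simp: is_path_Cons)
    then have "z \<noteq> r \<and> y = par z" using \<open>w \<noteq> z\<close> Cons.prems(2,3) by (auto simp: edge_iff)
    then show ?case using Cons.IH p by blast
  qed
  moreover have "{w, y} \<in> edges G"
    using assms by (auto simp: is_path_Cons)
  moreover have "y \<in> W" using assms by (auto simp: is_path_def)
  ultimately show ?thesis using assms unfolding edge_iff by blast
qed

lemma path_root: "is_path G r r xs \<longleftrightarrow> xs = [r]"
proof
  assume p: "is_path G r r xs"
  then obtain ys where xs: "xs = r # ys" by (cases xs) (auto simp: is_path_def)
  then show "xs = [r]" using p path_up_aux by (cases ys) auto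
qed (auto simp: is_path_def root)

lemma path_step:
  assumes "w \<in> W" "w \<noteq> r"
  shows "is_path G w r xs \<longleftrightarrow> (\<exists>ys. xs = w # ys \<and> is_path G (par w) r ys)"
proof
  assume p: "is_path G w r xs"
  then obtain ys where xs: "xs = w # ys" by (cases xs) (auto simp: is_path_def)
  then obtain y zs where ys: "ys = y # zs"
    using p assms by (cases ys) (auto simp: is_path_def)
  then show "\<exists>ys. xs = w # ys \<and> is_path G (par w) r ys"
    using p path_up_aux[of w y zs] xs by (auto simp: is_path_Cons)
next
  assume "\<exists>ys. xs = w # ys \<and> is_path G (par w) r ys"
  then obtain ys where xs: "xs = w # ys" and p: "is_path G (par w) r ys" by blast
  have mono: "x \<in> set ys \<Longrightarrow> rk x \<le> rk (par w)" for x
  proof -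
    have "is_path G a r ys \<Longrightarrow> x \<in> set ys \<Longrightarrow> rk x \<le> rk a" for a x ys
    proof (induction ys arbitrary: a)
      case Nil
      then show ?case by (auto simp: is_path_def)
    next
      case (Cons b bs)
      have "a = b" using Cons.prems(1) by (auto simp: is_path_def)
      show ?case
      proof (cases bs)
        case Nil
        then show ?thesis using Cons.prems \<open>a = b\<close> by auto
      next
        case (Cons c cs)
        then have c: "c = par a" "a \<noteq> r" "is_path G c r bs" "a \<in> W"
          using Cons.prems(1) path_up_aux[of a c cs] \<open>a = b\<close> by (auto simp: is_path_Cons)
        show ?thesis
        proof (cases "x = b")
          case False
          then have "rk x \<le> rk c" using Cons.IH[OF c(3)] Cons.prems(2) by auto
          then show ?thesis using rk_par[of a] c by auto
        qed (use \<open>a = b\<close> in auto)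
      qed
    qed
    then show "x \<in> set ys \<Longrightarrow> rk x \<le> rk (par w)" using p by blast
  qed
  have "w \<notin> set ys" using mono[of w] rk_par[OF assms] by fastforce
  moreover obtain y zs where ys: "ys = y # zs" "y = par w"
    using p by (cases ys) (auto simp: is_path_def)
  ultimately show "is_path G w r xs"
    using p xs assms by (auto simp: is_path_Cons edge_iff)
qed

lemma ex1_path: "w \<in> W \<Longrightarrow> \<exists>!xs. is_path G w r xs"
proof (induction "rk w" arbitrary: w rule: less_induct)
  case less
  show ?case
  proof (cases "w = r")
    case True
    then show ?thesis by (intro ex1I[of _ "[r]"]) (auto simp: path_root)
  next
    case False
    then have "\<exists>!xs. is_path G (par w) r xs" using less rk_par par_in by blast
    then show ?thesis unfolding path_step[OF less.prems False] by blast
  qed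
qed

lemma is_path_the_path: "w \<in> W \<Longrightarrow> is_path G w r (the_path G w r)"
  unfolding the_path_def by (rule theI') (rule ex1_path)

lemma the_path_eqI: "w \<in> W \<Longrightarrow> is_path G w r xs \<Longrightarrow> the_path G w r = xs"
  using ex1_path is_path_the_path by blast

lemma the_path_root [simp]: "the_path G r r = [r]"
  by (rule the_path_eqI) (auto simp: root path_root)

lemma the_path_step: "w \<in> W \<Longrightarrow> w \<noteq> r \<Longrightarrow> the_path G w r = w # the_path G (par w) r"
  by (rule the_path_eqI) (auto simp: path_step par_in is_path_the_path)

lemma the_path_rev: "w \<in> W \<Longrightarrow> the_path G r w = rev (the_path G w r)"
  unfolding the_path_def[of G r w]
proof (rule the_equality)
  assume w: "w \<in> W"
  show "is_path G r w (rev (the_path G w r))"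
    using is_path_the_path[OF w] by (rule is_path_rev)
  show "is_path G r w xs \<Longrightarrow> xs = rev (the_path G w r)" for xs
    using is_path_rev[of G r w xs] the_path_eqI[OF w] by force
qed

lemma set_the_path: "w \<in> W \<Longrightarrow> set (the_path G w r) = {v. below par r v w}"
proof (induction "rk w" arbitrary: w rule: less_induct)
  case less
  show ?case
  proof (cases "w = r")
    case True
    then show ?thesis by (auto intro: below.intros elim: below.cases)
  next
    case False
    then have "set (the_path G (par w) r) = {v. below par r v (par w)}"
      using less rk_par par_in by blast
    then show ?thesis using False less.prems
      by (auto simp: the_path_step intro: below.intros elim: below.cases)
  qed
qed

lemma descendants_G: "descendants G v = {w \<in> W. below par r v w}"
  by (auto simp: descendants_def the_path_rev set_the_path)

lemma below_rk: "below par r v w \<Longrightarrow> w \<in> W \<Longrightarrow> rk v \<le> rk w \<and> v \<in> W"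
  by (induction rule: below.induct) (use rk_par par_in in fastforce)+

lemma length_the_path_gt:
  assumes "v \<in> W"
  shows "i < length (the_path G v r) \<longleftrightarrow> (\<forall>j<i. (par ^^ j) v \<noteq> r)"
    and "i < length (the_path G v r) \<Longrightarrow> the_path G v r ! i = (par ^^ i) v"
proof -
  have "(i < length (the_path G v r) \<longleftrightarrow> (\<forall>j<i. (par ^^ j) v \<noteq> r)) \<and>
     (i < length (the_path G v r) \<longrightarrow> the_path G v r ! i = (par ^^ i) v)"
    using assms
  proof (induction i arbitrary: v)
    case 0
    then show ?case by (cases "v = r") (auto simp: the_path_step)
  next
    case (Suc i)
    show ?case
    proof (cases "v = r")
      case False
      then show ?thesis using Suc par_in
        by (auto simp: the_path_step All_less_Suc2 funpow_swap1 simp del: funpow.simps(2)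
            simp: funpow_Suc_right)
    qed auto
  qed
  then show "i < length (the_path G v r) \<longleftrightarrow> (\<forall>j<i. (par ^^ j) v \<noteq> r)"
    "i < length (the_path G v r) \<Longrightarrow> the_path G v r ! i = (par ^^ i) v" by auto
qed

lemma par_pow_in: "v \<in> W \<Longrightarrow> (\<forall>j<i. (par ^^ j) v \<noteq> r) \<Longrightarrow> (par ^^ i) v \<in> W"
  by (induction i) (auto simp: par_in)

lemma subtree_parent_graph:
  assumes "E \<subseteq> W" "v \<in> W" "v \<noteq> r \<Longrightarrow> par v \<notin> E"
    and "\<And>w. w \<in> E \<Longrightarrow> w \<noteq> v \<Longrightarrow> w \<noteq> r \<and> par w \<in> E"
  shows "subtree G E v = parent_graph E v par"
  using assms by (auto simp: subtree_def parent_graph_def)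

lemma parent_tree_sub:
  assumes "E \<subseteq> W" "v \<in> E" "\<And>w. w \<in> E \<Longrightarrow> w \<noteq> v \<Longrightarrow> w \<noteq> r \<and> par w \<in> E"
  shows "parent_tree E v par rk"
  using assms rk_par by unfold_locales auto

lemma descendants_closed:
  assumes "w \<in> descendants G v" "w \<noteq> v"
  shows "w \<noteq> r \<and> par w \<in> descendants G v"
  using assms(1) assms(2) unfolding descendants_G by (auto elim: below.cases intro: par_in)

lemma par_not_descendant: "v \<in> W \<Longrightarrow> v \<noteq> r \<Longrightarrow> par v \<notin> descendants G v"
  using below_rk[of v "par v"] rk_par[of v] par_in[of v] by (auto simp: descendants_G)

lemma self_descendant: "v \<in> W \<Longrightarrow> v \<in> descendants G v"
  by (auto simp: descendants_G intro: below.intros)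

lemma descendants_sub: "descendants G v \<subseteq> W"
  by (auto simp: descendants_G)

lemma subtree_descendants:
  assumes "v \<in> W"
  shows "subtree G (descendants G v) v = parent_graph (descendants G v) v par"
    and "parent_tree (descendants G v) v par rk"
  using assms descendants_sub descendants_closed par_not_descendant self_descendant
  by (intro subtree_parent_graph parent_tree_sub; blast)+

lemma kids_eq: "kids u = {c \<in> vertices G. {rt G, c} \<in> edges G}" if "u = r"
  using that par_neq by (auto simp: childset_def edge_iff root)

lemma below_child:
  assumes "w \<in> W" "w \<noteq> v" "below par r v w"
  shows "\<exists>c\<in>kids v. below par r c w"
  using assms(3,1,2)
proof (induction rule: below.induct)
  case (below_step w)
  show ?case
  proof (cases "par w = v")
    case True
    then show ?thesis using below_step by (auto simp: childset_def intro: below.intros)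
  next
    case False
    then show ?thesis using below_step par_in by (auto intro: below.intros)
  qed
qed auto

lemma below_root: "w \<in> W \<Longrightarrow> below par r r w"
  by (induction "rk w" arbitrary: w rule: less_induct) (metis below.intros rk_par par_in)

text \<open>
  Passing to the descendants of \<open>c\<close> keeps the children of all vertices, so one labelling of vertices
  by trees serves all nested subtrees in the definition of \<open>has_class\<close>.
\<close>
lemma children_descendants:
  assumes "w \<in> descendants G c" "c \<in> W"
  shows "childset (descendants G c) c par w = kids w"
proof
  show "childset (descendants G c) c par w \<subseteq> kids w"
    using descendants_closed by (auto simp: childset_def descendants_G)
next
  have "x \<noteq> c" if "x \<in> kids w" for x
    using that assms par_not_descendant by (auto simp: childset_def)
  then show "kids w \<subseteq> childset (descendants G c) c par w"
    using assms by (auto simp: childset_def descendants_G intro: below.intros)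
qed

end

text \<open>
  Any labelling of the vertices by trees that satisfies the local recursion is the
  labelling by root-isomorphism classes.  Stated for a free \<open>f\<close>, the lemma applies both to
  descendant subtrees and to the trees with one branch removed.
\<close>
lemma has_class_parent_graph:
  assumes "parent_tree W r par rk" "finite W"
    and "\<And>w. w \<in> W \<Longrightarrow> f w = Node (image_mset f (mset_set (childset W r par w)))"
  shows "has_class (parent_graph W r par) (f r)"
  using assms
proof (induction "card W" arbitrary: W r rule: less_induct)
  case less
  interpret parent_tree W r par rk by (rule less.prems)
  define C where "C = kids r"
  have "has_class G (Node (image_mset f (mset_set C)))"
  proof (rule has_class.intros)
    show "rt G \<in> vertices G" by (simp add: root)
    show "C = {c \<in> vertices G. {rt G, c} \<in> edges G}" using kids_eq C_def by blast
    show "finite C" using less.prems(2) by (auto simp: C_def childset_def)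
    fix c assume "c \<in> C"
    then have c: "c \<in> W" "c \<noteq> r" "par c = r" by (auto simp: C_def childset_def)
    have "has_class (parent_graph (descendants G c) c par) (f c)"
    proof (rule less.hyps)
      have "r \<notin> descendants G c" using par_not_descendant[of c] c by simp
      then have "descendants G c \<subset> W" using descendants_sub[of c] root by blast
      then show "card (descendants G c) < card W" using less.prems(2) psubset_card_mono by blast
      show "parent_tree (descendants G c) c par rk" using subtree_descendants c by blast
      show "finite (descendants G c)" using less.prems(2) descendants_sub finite_subset by blast
      fix w assume w: "w \<in> descendants G c"
      show "f w = Node (image_mset f (mset_set (childset (descendants G c) c par w)))"
        using less.prems(3)[of w] children_descendants[OF w] c w descendants_sub by auto
    qed
    then show "has_class (subtree G (descendants G c) c) (f c)" using subtree_descendants c by simp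
  qed
  then show ?case using less.prems(3)[OF root] C_def by simp
qed

text \<open>
  This is what excludes that \<open>iso_class\<close> assigns a finite tree to an infinite Galton--Watson tree.
\<close>
lemma has_class_finite:
  assumes "has_class G t" "parent_tree W r par rk" "G = parent_graph W r par"
  shows "finite W"
  using assms
proof (induction arbitrary: W r)
  case (1 G C f)
  interpret parent_tree W r par rk by (rule "1.prems")
  have G: "G = parent_graph W r par" by fact
  have C: "C = kids r" using 1 kids_eq by simp
  have fin: "finite (descendants (parent_graph W r par) c)" if "c \<in> C" for c
  proof -
    have c: "c \<in> W" using that by (auto simp: C childset_def)
    show ?thesis using "1.IH"[OF that] subtree_descendants[OF c] G by metis
  qed
  have "W \<subseteq> insert r (\<Union>c\<in>C. descendants (parent_graph W r par) c)"
  proof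
    fix w assume w: "w \<in> W"
    then show "w \<in> insert r (\<Union>c\<in>C. descendants (parent_graph W r par) c)"
      using below_root[OF w] below_child[OF w, of r] by (auto simp: C descendants_G)
  qed
  moreover have "finite (insert r (\<Union>c\<in>C. descendants (parent_graph W r par) c))"
    using fin \<open>finite C\<close> by simp
  ultimately show ?case by (rule finite_subset)
qed

lemma iso_class_eqI: "has_class G t \<Longrightarrow> iso_class G = Some t"
  unfolding iso_class_def using has_class_unique by (metis the_equality)

locale ordered_tree = parent_tree +
  fixes ch :: "'a \<Rightarrow> 'a list" 
  assumes ch: "u \<in> W \<Longrightarrow> set (ch u) = childset W r par u"
    and dist: "u \<in> W \<Longrightarrow> distinct (ch u)"
begin

lemma shape_finite_below:
  "shape ch u \<tau> \<Longrightarrow> u \<in> W \<Longrightarrow> finite {w \<in> W. below par r u w}"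
proof (induction \<tau> arbitrary: u)
  case (PNode ts)
  have "finite {w \<in> W. below par r c w}" if "c \<in> kids u" for c
  proof -
    have "c \<in> set (ch u)" "c \<in> W" using that ch[OF PNode.prems(2)] by (auto simp: childset_def)
    then obtain t where "t \<in> set ts" "shape ch c t"
      using PNode.prems(1) by (metis in_set_conv_nth list_all2_conv_all_nth shape_PNode)
    then show ?thesis using PNode.IH \<open>c \<in> W\<close> by blast
  qed
  moreover have "finite (kids u)" using ch[OF PNode.prems(2)] by (metis List.finite_set)
  ultimately have "finite (insert u (\<Union>c\<in>kids u. {w \<in> W. below par r c w}))" by blast
  then show ?case by (rule rev_finite_subset) (use below_child in blast)
qed

lemma shape_finite: "shape ch r \<tau> \<Longrightarrow> finite W"
  using shape_finite_below[of r \<tau>] root below_root by (simp cong: conj_cong add: Collect_conj_eq Int_absorb2 subset_iff)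

end

locale finite_ordered_tree = ordered_tree +
  assumes fin: "finite W"
begin

lemma ex_shape: "u \<in> W \<Longrightarrow> \<exists>\<tau>. shape ch u \<tau>"
proof (induction "Max (rk ` W) - rk u" arbitrary: u rule: less_induct)
  case less
  have "\<exists>\<tau>. shape ch c \<tau>" if "c \<in> set (ch u)" for c
  proof (rule less.hyps)
    have c: "c \<in> W" "c \<noteq> r" "par c = u" using that ch less.prems by (auto simp: childset_def)
    then show "c \<in> W" by simp
    have "rk u < rk c" using rk_par c by auto
    moreover have "rk c \<le> Max (rk ` W)" using c fin by auto
    ultimately show "Max (rk ` W) - rk c < Max (rk ` W) - rk u" by linarith
  qed
  then obtain g where "\<And>c. c \<in> set (ch u) \<Longrightarrow> shape ch c (g c)" by metis
  then have "shape ch u (PNode (map g (ch u)))" by (auto simp: list_all2_conv_all_nth)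
  then show ?case by blast
qed

abbreviation "cls \<equiv> tree_class ch"

lemma cls_eq:
  assumes "u \<in> W"
  shows "cls u = Node (image_mset cls (mset_set (kids u)))"
proof -
  obtain \<tau> where t: "shape ch u \<tau>" using ex_shape assms by blast
  obtain ts where ts: "\<tau> = PNode ts" by (cases \<tau>)
  have "map forget ts = map cls (ch u)"
    using t ts by (auto simp: list_all2_conv_all_nth tree_class_shape intro!: nth_equalityI)
  moreover have "mset (ch u) = mset_set (kids u)"
    using ch[OF assms] dist[OF assms] by (metis mset_set_set)
  ultimately show ?thesis using t ts tree_class_shape[OF t] by (metis forget.simps mset_map)
qed

lemma finite_kids [simp]: "finite (kids u)"
  using fin by (auto simp: childset_def)

lemma iso_class_G: "iso_class G = Some (cls r)"
  by (rule iso_class_eqI, rule has_class_parent_graph)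
     (auto simp: fin cls_eq intro: parent_tree_axioms)

lemma fringe_0:
  assumes "v \<in> W"
  shows "fringe 0 v G = Some (cls v)"
proof -
  have "has_class (parent_graph (descendants G v) v par) (cls v)"
  proof (rule has_class_parent_graph)
    show "parent_tree (descendants G v) v par rk" using subtree_descendants assms by blast
    show "finite (descendants G v)" using fin descendants_sub finite_subset by blast
    fix w assume w: "w \<in> descendants G v"
    then have "w \<in> W" using descendants_sub by blast
    then show "cls w = Node (image_mset cls (mset_set (childset (descendants G v) v par w)))"
      using children_descendants[OF w assms] cls_eq by simp
  qed
  then show ?thesis using assms by (auto simp: fringe_def subtree_descendants iso_class_eqI)
qed

text \<open>
  Removing the branch at \<open>c\<close> changes the labelling by classes at the parent of \<open>c\<close> only.
\<close>
lemma class_minus_child: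
  assumes "c \<in> W" "c \<noteq> r"
  shows "iso_class (subtree G (descendants G (par c) - descendants G c) (par c)) =
    Some (Node (children (cls (par c)) - {#cls c#}))"
proof -
  define p where "p = par c"
  define E where "E = descendants G p - descendants G c"
  have p: "p \<in> W" "p \<notin> descendants G c" using assms par_in par_not_descendant by (auto simp: p_def)
  have pE: "p \<in> E" using p self_descendant by (auto simp: E_def)
  have EW: "E \<subseteq> W" using descendants_sub by (auto simp: E_def)
  have closed: "w \<noteq> r \<and> par w \<in> E" if "w \<in> E" "w \<noteq> p" for w
  proof -
    have "w \<noteq> r" "par w \<in> descendants G p" "w \<in> W"
      using that descendants_closed descendants_sub by (auto simp: E_def)
    moreover have "par w \<notin> descendants G c"
      using that \<open>w \<noteq> r\<close> \<open>w \<in> W\<close> by (auto simp: E_def descendants_G intro: below.intros)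
    ultimately show ?thesis by (simp add: E_def)
  qed
  have sub: "subtree G E p = parent_graph E p par"
    using EW p closed par_not_descendant by (intro subtree_parent_graph) (auto simp: E_def)
  have kE: "childset E p par w = (if w = p then kids p - {c} else kids w)" if "w \<in> E" for w
  proof -
    have "childset E p par w \<subseteq> kids w"
      using closed EW by (auto simp: childset_def)
    moreover have "c \<notin> E" using self_descendant assms by (auto simp: E_def)
    moreover have "x \<in> E \<and> x \<noteq> p" if x: "x \<in> kids w" "x \<noteq> c" for x
    proof -
      have xw: "x \<in> W" "x \<noteq> r" "par x = w" using x by (auto simp: childset_def)
      have "x \<in> descendants G p"
        using xw \<open>w \<in> E\<close> by (auto simp: E_def descendants_G intro: below.intros)
      moreover have "x \<notin> descendants G c"
        using xw \<open>w \<in> E\<close> x descendants_closed[of x c] by (auto simp: E_def)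
      moreover have "x \<noteq> p"
        using xw \<open>w \<in> E\<close> par_not_descendant[of p] p by (auto simp: E_def)
      ultimately show ?thesis by (simp add: E_def)
    qed
    moreover have "c \<in> kids w \<longleftrightarrow> w = p" using assms by (auto simp: childset_def p_def)
    ultimately show ?thesis by (auto simp: childset_def)
  qed
  define f where "f = cls(p := Node (image_mset cls (mset_set (kids p - {c}))))"
  have pk: "x \<noteq> p" if "x \<in> kids w" "w \<in> E" for x w
    using that par_not_descendant[of p] p by (auto simp: E_def childset_def)
  have "has_class (parent_graph E p par) (f p)"
  proof (rule has_class_parent_graph)
    show "parent_tree E p par rk" using EW pE closed by (intro parent_tree_sub) auto
    show "finite E" using fin EW finite_subset by blast
    fix w assume w: "w \<in> E"
    have "image_mset f (mset_set (childset E p par w)) =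
        image_mset cls (mset_set (childset E p par w))"
      using pk w kE[OF w] by (intro image_mset_cong) (auto simp: f_def split: if_splits)
    then show "f w = Node (image_mset f (mset_set (childset E p par w)))"
      using kE[OF w] cls_eq[of w] w EW by (auto simp: f_def)
  qed
  moreover have "c \<in> kids p" using assms by (auto simp: childset_def p_def)
  then have "f p = Node (children (cls p) - {#cls c#})"
    using cls_eq[OF p(1)] by (simp add: f_def mset_set_Diff image_mset_Diff)
  ultimately show ?thesis using sub by (auto simp: E_def p_def iso_class_eqI)
qed

lemma fringe_Suc:
  assumes "v \<in> W"
  shows "fringe (Suc i) v G = (if \<forall>j\<le>i. (par ^^ j) v \<noteq> r
     then Some (Node (children (cls ((par ^^ Suc i) v)) - {#cls ((par ^^ i) v)#})) else None)"
proof -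
  have "(\<forall>j\<le>i. (par ^^ j) v \<noteq> r) \<longleftrightarrow> Suc i < length (the_path G v r)"
    using length_the_path_gt[OF assms, of "Suc i"] by (simp add: less_Suc_eq_le)
  moreover have "(par ^^ i) v \<in> W" "(par ^^ i) v \<noteq> r" if "\<forall>j\<le>i. (par ^^ j) v \<noteq> r"
    using par_pow_in[of v i] assms that by auto
  ultimately show ?thesis
    using class_minus_child[of "(par ^^ i) v"] length_the_path_gt(2)[OF assms, of "Suc i"]
      length_the_path_gt(2)[OF assms, of i]
    by (auto simp: fringe_def Let_def)
qed

lemma degree_G:
  assumes "v \<in> W"
  shows "degree G v = size (children (cls v)) + (if v = r then 0 else 1)"
proof -
  have eq: "{e \<in> edges G. v \<in> e} = (\<lambda>c. {c, v}) ` kids v \<union> (if v = r then {} else {{v, par v}})"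
    using assms by (auto simp: edges_G childset_def)
  have "inj_on (\<lambda>c. {c, v}) (kids v)"
    by (auto simp: inj_on_def doubleton_eq_iff)
  then have "card ((\<lambda>c. {c, v}) ` kids v) = card (kids v)" by (rule card_image)
  moreover have "{v, par v} \<notin> (\<lambda>c. {c, v}) ` kids v" if "v \<noteq> r"
  proof
    assume "{v, par v} \<in> (\<lambda>c. {c, v}) ` kids v"
    then have "par v \<in> kids v" using par_neq[OF assms that]
      by (auto simp: doubleton_eq_iff childset_def)
    then show False using rk_par[OF assms that] rk_par[of "par v"] by (auto simp: childset_def)
  qed
  ultimately show ?thesis
    using cls_eq[OF assms] unfolding degree_def eq by (cases "v = r") simp_all
qed

text \<open>
  The vertices from which the \<open>k\<close> steps towards the root exist and meet the classes
  \<open>s 0, \<dots>, s k\<close>.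
\<close>
definition spine :: "nat \<Rightarrow> (nat \<Rightarrow> rtree) \<Rightarrow> 'a set" where
  "spine k s = {v \<in> W. (\<forall>j<k. (par ^^ j) v \<noteq> r) \<and> (\<forall>m\<le>k. cls ((par ^^ m) v) = s m)}"

text \<open>
  A vertex of the set is reached from the vertex \<open>k\<close> levels above it by descending: at a vertex of
  class \<open>s m\<close>, the number of children of class \<open>s (m - 1)\<close> is the multiplicity of this class among the
  children of \<open>s m\<close>, whichever vertex it is.
\<close>
lemma card_spine:
  "card (spine k s) = card {u \<in> W. cls u = s k} * (\<Prod>m=1..k. count (children (s m)) (s (m - 1)))"
proof (induction k arbitrary: s)
  case 0
  then show ?case by (simp add: spine_def)
next
  case (Suc k)
  define B where "B = spine k (\<lambda>m. s (Suc m))"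
  define K where "K u = {v \<in> kids u. cls v = s 0}" for u
  have le: "(\<forall>m\<le>Suc k. P m) \<longleftrightarrow> P 0 \<and> (\<forall>m\<le>k. P (Suc m))" for P
    by (metis Suc_le_mono le0 not0_implies_Suc)
  have "spine (Suc k) s = (\<Union>u\<in>B. K u)"
    by (auto simp: spine_def B_def K_def childset_def All_less_Suc2 le par_in
        funpow_Suc_right simp del: funpow.simps(2))
  moreover have "finite B" using fin by (auto simp: B_def spine_def)
  moreover have "card (\<Union>u\<in>B. K u) = (\<Sum>u\<in>B. card (K u))"
    using \<open>finite B\<close> fin by (intro card_UN_disjoint) (auto simp: K_def childset_def)
  moreover have "card (K u) = count (children (s 1)) (s 0)" if "u \<in> B" for u
  proof -
    have u: "u \<in> W" "cls u = s 1" using that by (auto simp: B_def spine_def)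
    have "count (children (s 1)) (s 0) = card {v \<in> kids u. cls v = s 0}"
      unfolding u(2)[symmetric]
      by (subst cls_eq[OF u(1)])
        (auto simp: count_image_mset vimage_def Int_def conj_commute intro!: arg_cong[where f=card])
    then show ?thesis by (simp add: K_def)
  qed
  ultimately have "card (spine (Suc k) s) = card B * count (children (s 1)) (s 0)" by simp
  also have "card B = card {u \<in> W. cls u = s (Suc k)} *
     (\<Prod>m=1..k. count (children (s (Suc m))) (s (Suc (m - 1))))"
    unfolding B_def by (rule Suc)
  also have "(\<Prod>m=1..k. count (children (s (Suc m))) (s (Suc (m - 1)))) =
      (\<Prod>m=Suc 1..Suc k. count (children (s m)) (s (m - 1)))"
    by (subst prod.shift_bounds_cl_Suc_ivl) (auto intro!: prod.cong)
  also have "card {u \<in> W. cls u = s (Suc k)} * \<dots> * count (children (s 1)) (s 0) =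
     card {u \<in> W. cls u = s (Suc k)} * (\<Prod>m=1..Suc k. count (children (s m)) (s (m - 1)))"
    by (subst (2) prod.atLeast_Suc_atMost) (auto simp: mult_ac)
  finally show ?case .
qed

text \<open>
  The class of the \<open>m\<close>-th ancestor consists of the pieces \<open>0, \<dots>, m\<close> of the decomposition, just as the
  monotone representation of a sin-tree.
\<close>
lemma fringe_tuple_eq_iff:
  assumes "v \<in> W"
  shows "fringe_tuple k v G = map (\<lambda>i. Some (t i)) [0..<Suc k] \<longleftrightarrow> v \<in> spine k (monotone_rep t)"
proof (induction k)
  case 0
  then show ?case using assms by (auto simp: fringe_tuple_def fringe_0 spine_def)
next
  case (Suc k)
  have "fringe_tuple (Suc k) v G = map (\<lambda>i. Some (t i)) [0..<Suc (Suc k)] \<longleftrightarrow>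
     fringe_tuple k v G = map (\<lambda>i. Some (t i)) [0..<Suc k] \<and> fringe (Suc k) v G = Some (t (Suc k))"
    by (simp add: fringe_tuple_def)
  also have "\<dots> \<longleftrightarrow> v \<in> spine k (monotone_rep t) \<and> fringe (Suc k) v G = Some (t (Suc k))"
    using Suc by simp
  also have "\<dots> \<longleftrightarrow> v \<in> spine (Suc k) (monotone_rep t)"
  proof -
    have "cls ((par ^^ Suc k) v) = Node (add_mset (cls ((par ^^ k) v)) (children (t (Suc k))))
      \<longleftrightarrow> Node (children (cls ((par ^^ Suc k) v)) - {#cls ((par ^^ k) v)#}) = t (Suc k)"
      if "\<forall>j\<le>k. (par ^^ j) v \<noteq> r"
    proof -
      define w where "w = (par ^^ k) v"
      have w: "w \<in> W" "w \<noteq> r" using par_pow_in[of v k] assms that by (auto simp: w_def)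
      then have "w \<in> kids (par w)" "par w \<in> W" using par_in by (auto simp: childset_def)
      then have "cls w \<in># children (cls (par w))"
        using cls_eq[of "par w"] by simp
      then have "children (cls (par w)) = add_mset (cls w) (children (cls (par w)) - {#cls w#})"
        by simp
      then show ?thesis
        by (cases "cls (par w)"; cases "t (Suc k)") (auto simp flip: w_def)
    qed
    then show ?thesis
      using assms by (auto simp: spine_def fringe_Suc le_Suc_eq less_Suc_eq_le
          simp del: funpow.simps(2))
  qed
  finally show ?case .
qed

lemma card_fringe_tuple:
  "card {v \<in> W. fringe_tuple k v G = map (\<lambda>i. Some (t i)) [0..<Suc k]} =
   card {u \<in> W. cls u = monotone_rep t k} *
   (\<Prod>m=1..k. count (children (monotone_rep t m)) (monotone_rep t (m - 1)))"
proof -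
  have "{v \<in> W. fringe_tuple k v G = map (\<lambda>i. Some (t i)) [0..<Suc k]} = spine k (monotone_rep t)"
    using fringe_tuple_eq_iff by (auto simp: spine_def)
  then show ?thesis by (simp add: card_spine)
qed

end

section \<open>The Poisson Galton--Watson tree\<close>

text \<open>The Lukasiewicz code: the numbers of children in depth-first order.\<close>
primrec code :: "ptree \<Rightarrow> nat list" where
  "code (PNode ts) = length ts # concat (map code ts)"

text \<open>The probability of a finite plane tree under the Poisson(1) Galton--Watson law.\<close>
definition pweight :: "ptree \<Rightarrow> real" where
  "pweight \<tau> = (\<Prod>k\<leftarrow>code \<tau>. exp (-1) / fact k)"

lemma prod_list_concat: "prod_list (concat xss) = prod_list (map prod_list xss)"
  for xss :: "'a::comm_monoid_mult list list"
  by (induction xss) auto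

lemma pweight_PNode: "pweight (PNode ts) = exp (-1) / fact (length ts) * (\<Prod>\<tau>\<leftarrow>ts. pweight \<tau>)"
  by (simp add: pweight_def map_concat prod_list_concat comp_def)

lemma pweight_pos: "0 < pweight \<tau>"
proof -
  have "0 < (\<Prod>k\<leftarrow>ks. exp (-1) / fact k :: real)" for ks by (induction ks) auto
  then show ?thesis by (simp add: pweight_def)
qed

instance ptree :: countable by countable_datatype

lemma surj_forget: "surj forget"
proof -
  have "\<exists>\<tau>. forget \<tau> = t" for t
  proof (induction t)
    case (Node M)
    then obtain g where g: "\<And>t. t \<in># M \<Longrightarrow> forget (g t) = t" by metis
    obtain l where l: "M = mset l" using ex_mset by metis
    have "map forget (map g l) = l" using g l by (auto intro: map_idI)
    then have "forget (PNode (map g l)) = Node M" using l by (simp only: forget.simps)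
    then show ?case by blast
  qed
  then show ?thesis by (metis surjI)
qed

instance rtree :: countable
proof
  show "\<exists>f :: rtree \<Rightarrow> nat. inj f"
    using surj_forget surj_imp_inj_inv inj_compose[OF inj_to_nat] by blast
qed

primrec nodes :: "ptree \<Rightarrow> nat list set" where
  "nodes (PNode ts) = insert [] (\<Union>i<length ts. (#) i ` (map nodes ts ! i))"

primrec offspring :: "ptree \<Rightarrow> nat list \<Rightarrow> nat" where
  "offspring (PNode ts) = (\<lambda>u. case u of [] \<Rightarrow> length ts | i # v \<Rightarrow> (map offspring ts ! i) v)"

definition matches :: "(nat list \<Rightarrow> nat) \<Rightarrow> ptree \<Rightarrow> bool" where
  "matches \<xi> \<tau> \<longleftrightarrow> (\<forall>u\<in>nodes \<tau>. \<xi> u = offspring \<tau> u)"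

lemma finite_nodes: "finite (nodes \<tau>)"
  by (induction \<tau>) auto

lemma prod_nodes:
  "(\<Prod>u\<in>nodes \<tau>. g (offspring \<tau> u)) = (\<Prod>k\<leftarrow>code \<tau>. g k)" for g :: "nat \<Rightarrow> 'a::comm_monoid_mult"
proof (induction \<tau>)
  case (PNode ts)
  let ?N = "\<lambda>i. (#) i ` (map nodes ts ! i)"
  have "(\<Prod>u\<in>nodes (PNode ts). g (offspring (PNode ts) u)) =
      g (length ts) * (\<Prod>u\<in>(\<Union>i<length ts. ?N i). g (offspring (PNode ts) u))"
    by (subst nodes.simps, subst prod.insert) (auto simp: finite_nodes)
  also have "(\<Prod>u\<in>(\<Union>i<length ts. ?N i). g (offspring (PNode ts) u)) =
      (\<Prod>i<length ts. \<Prod>u\<in>?N i. g (offspring (PNode ts) u))"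
    by (intro prod.UNION_disjoint) (auto simp: finite_nodes)
  also have "\<dots> = (\<Prod>i<length ts. \<Prod>k\<leftarrow>code (ts ! i). g k)"
  proof (rule prod.cong)
    fix i assume i: "i \<in> {..<length ts}"
    have "(\<Prod>u\<in>?N i. g (offspring (PNode ts) u)) = (\<Prod>u\<in>nodes (ts ! i). g (offspring (ts ! i) u))"
      using i by (subst prod.reindex) auto
    also have "\<dots> = (\<Prod>k\<leftarrow>code (ts ! i). g k)" using PNode.IH i by simp
    finally show "(\<Prod>u\<in>?N i. g (offspring (PNode ts) u)) = (\<Prod>k\<leftarrow>code (ts ! i). g k)" .
  qed simp
  also have "\<dots> = prod_list (map (\<lambda>t. \<Prod>k\<leftarrow>code t. g k) ts)"
    by (simp add: prod.list_conv_set_nth atLeast0LessThan)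
  finally show ?case by (simp add: map_concat prod_list_concat comp_def)
qed

abbreviation gw_children :: "(nat list \<Rightarrow> nat) \<Rightarrow> nat list \<Rightarrow> nat list list" where
  "gw_children \<xi> u \<equiv> map (\<lambda>i. u @ [i]) [0..<\<xi> u]"

text \<open>
  In terms of the offspring numbers \<open>\<xi>\<close>, having a given finite shape is a condition on finitely many
  coordinates, so that its probability is a finite product.
\<close>
lemma matches_iff_shape: "matches \<xi> \<tau> \<longleftrightarrow> shape (gw_children \<xi>) [] \<tau>"
proof -
  have "(\<forall>x\<in>nodes \<tau>. \<xi> (u @ x) = offspring \<tau> x) \<longleftrightarrow> shape (gw_children \<xi>) u \<tau>" for u
  proof (induction \<tau> arbitrary: u)
    case (PNode ts)
    have "(\<forall>x\<in>nodes (PNode ts). \<xi> (u @ x) = offspring (PNode ts) x) \<longleftrightarrow>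
       \<xi> u = length ts \<and>
       (\<forall>i<length ts. \<forall>x\<in>nodes (ts ! i). \<xi> ((u @ [i]) @ x) = offspring (ts ! i) x)"
      by auto
    also have "\<dots> \<longleftrightarrow> \<xi> u = length ts \<and> (\<forall>i<length ts. shape (gw_children \<xi>) (u @ [i]) (ts ! i))"
      by (intro conj_cong refl all_cong PNode.IH) auto
    also have "\<dots> \<longleftrightarrow> shape (gw_children \<xi>) u (PNode ts)"
      by (auto simp: list_all2_conv_all_nth)
    finally show ?case .
  qed
  from this[of "[]"] show ?thesis by (simp add: matches_def)
qed

lemma matches_unique: "matches \<xi> \<tau> \<Longrightarrow> matches \<xi> \<sigma> \<Longrightarrow> \<tau> = \<sigma>"
  unfolding matches_iff_shape by (rule shape_unique)

definition gw_vertices :: "(nat list \<Rightarrow> nat) \<Rightarrow> nat list set" where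
  "gw_vertices \<xi> = {u. \<forall>k<length u. u ! k < \<xi> (take k u)}"

lemma gw_vertices_snoc: "u @ [i] \<in> gw_vertices \<xi> \<longleftrightarrow> u \<in> gw_vertices \<xi> \<and> i < \<xi> u"
  by (auto simp: gw_vertices_def nth_append less_Suc_eq)

lemma ordered_tree_gw:
  "ordered_tree (gw_vertices \<xi>) [] butlast length (gw_children \<xi>)"
proof
  show "[] \<in> gw_vertices \<xi>" by (auto simp: gw_vertices_def)
  show "w \<in> gw_vertices \<xi> \<Longrightarrow> w \<noteq> [] \<Longrightarrow> butlast w \<in> gw_vertices \<xi>" for w
    by (metis append_butlast_last_id gw_vertices_snoc)
  show "w \<in> gw_vertices \<xi> \<Longrightarrow> w \<noteq> [] \<Longrightarrow> length (butlast w) < length w" for w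
    by simp
  show "set (gw_children \<xi> u) = childset (gw_vertices \<xi>) [] butlast u" if "u \<in> gw_vertices \<xi>" for u
  proof -
    have "c \<in> set (gw_children \<xi> u)" if "c \<in> gw_vertices \<xi>" "c \<noteq> []" "butlast c = u" for c
    proof -
      have "c = u @ [last c]" using that by (metis append_butlast_last_id)
      moreover from this have "last c < \<xi> u" using that(1) by (metis gw_vertices_snoc)
      ultimately show ?thesis by auto
    qed
    then show ?thesis using that by (auto simp: childset_def gw_vertices_snoc)
  qed
  show "distinct (gw_children \<xi> u)" for u
    by (auto simp: distinct_map inj_on_def)
qed

lemma gw_graph_eq: "gw_graph \<xi> = parent_graph (gw_vertices \<xi>) [] butlast"
proof -
  have "{{u, u @ [i]} | u i. u @ [i] \<in> gw_vertices \<xi>} =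
      {{w, butlast w} | w. w \<in> gw_vertices \<xi> \<and> w \<noteq> []}"
    (is "?L = ?R")
  proof (rule set_eqI)
    fix e
    have "e \<in> ?L \<longleftrightarrow> (\<exists>u i. e = {u @ [i], butlast (u @ [i])} \<and> u @ [i] \<in> gw_vertices \<xi>)"
      by (simp add: insert_commute)
    also have "\<dots> \<longleftrightarrow> e \<in> ?R"
    proof
      assume "e \<in> ?R"
      then obtain w where "e = {w, butlast w}" "w \<in> gw_vertices \<xi>" "w \<noteq> []" by blast
      moreover from this have "w = butlast w @ [last w]" by simp
      ultimately show "\<exists>u i. e = {u @ [i], butlast (u @ [i])} \<and> u @ [i] \<in> gw_vertices \<xi>"
        by metis
    qed blast
    finally show "e \<in> ?L \<longleftrightarrow> e \<in> ?R" .
  qed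
  then show ?thesis
    by (simp add: gw_graph_def parent_graph_def gw_vertices_def Let_def)
qed

lemma iso_class_gw_graph:
  "iso_class (gw_graph \<xi>) = Some t \<longleftrightarrow> (\<exists>\<tau>. matches \<xi> \<tau> \<and> forget \<tau> = t)"
proof -
  interpret ordered_tree "gw_vertices \<xi>" "[]" butlast length "gw_children \<xi>"
    by (rule ordered_tree_gw)
  have *: "\<exists>\<tau>. matches \<xi> \<tau> \<and> iso_class (gw_graph \<xi>) = Some (forget \<tau>)" if "finite (gw_vertices \<xi>)"
  proof -
    interpret finite_ordered_tree "gw_vertices \<xi>" "[]" butlast length "gw_children \<xi>"
      by unfold_locales (rule that)
    obtain \<tau> where "shape (gw_children \<xi>) [] \<tau>" using ex_shape[OF root] by blast
    then show ?thesis using iso_class_G tree_class_shape[of "gw_children \<xi>" "[]" \<tau>]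
      unfolding matches_iff_shape gw_graph_eq by auto
  qed
  show ?thesis
  proof
    assume "iso_class (gw_graph \<xi>) = Some t"
    moreover from this have "\<exists>s. has_class (gw_graph \<xi>) s"
      by (auto simp: iso_class_def split: if_splits)
    then have "finite (gw_vertices \<xi>)"
      using has_class_finite[OF _ parent_tree_axioms gw_graph_eq] by blast
    ultimately show "\<exists>\<tau>. matches \<xi> \<tau> \<and> forget \<tau> = t" using * by auto
  next
    assume "\<exists>\<tau>. matches \<xi> \<tau> \<and> forget \<tau> = t"
    then obtain \<tau> where t: "matches \<xi> \<tau>" "forget \<tau> = t" by blast
    then have "finite (gw_vertices \<xi>)" using shape_finite matches_iff_shape by blast
    then obtain \<sigma> where "matches \<xi> \<sigma>" "iso_class (gw_graph \<xi>) = Some (forget \<sigma>)" using * by blast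
    then show "iso_class (gw_graph \<xi>) = Some t" using t matches_unique by metis
  qed
qed

abbreviation gw_space :: "(nat list \<Rightarrow> nat) measure" where
  "gw_space \<equiv> PiM UNIV (\<lambda>_. measure_pmf (poisson_pmf 1))"

lemma space_gw_space [simp]: "space gw_space = UNIV"
  by (simp add: space_PiM)

lemma matches_in_sets [measurable]: "{\<xi>. matches \<xi> \<tau>} \<in> sets gw_space"
proof -
  have "Measurable.pred gw_space (\<lambda>\<xi>. \<forall>u\<in>nodes \<tau>. \<xi> u = offspring \<tau> u)"
    by (measurable) (auto simp: finite_nodes)
  then show ?thesis by (simp add: matches_def pred_def)
qed

lemma emeasure_matches: "emeasure gw_space {\<xi>. matches \<xi> \<tau>} = ennreal (pweight \<tau>)"
proof -
  interpret product_prob_space "\<lambda>_. measure_pmf (poisson_pmf 1)" "UNIV :: nat list set"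
    by unfold_locales
  have "emeasure gw_space {\<xi> \<in> space gw_space. \<forall>u\<in>nodes \<tau>. \<xi> u \<in> {offspring \<tau> u}} =
      (\<Prod>u\<in>nodes \<tau>. emeasure (measure_pmf (poisson_pmf 1)) {offspring \<tau> u})"
    by (rule emeasure_PiM_Collect) (auto simp: finite_nodes)
  also have "\<dots> = ennreal (\<Prod>u\<in>nodes \<tau>. exp (-1) / fact (offspring \<tau> u))"
    by (simp add: emeasure_pmf_single prod_ennreal)
  also have "(\<Prod>u\<in>nodes \<tau>. exp (-1) / fact (offspring \<tau> u)) = pweight \<tau>"
    unfolding pweight_def by (rule prod_nodes)
  finally show ?thesis by (simp add: matches_def)
qed

lemma emeasure_matches_UN:
  "emeasure gw_space {\<xi>. \<exists>\<tau>\<in>A. matches \<xi> \<tau>} = (\<integral>\<^sup>+\<tau>. pweight \<tau> \<partial>count_space A)"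
proof -
  have "{\<xi>. \<exists>\<tau>\<in>A. matches \<xi> \<tau>} = (\<Union>\<tau>\<in>A. {\<xi>. matches \<xi> \<tau>})" by auto
  also have "emeasure gw_space \<dots> = (\<integral>\<^sup>+\<tau>. emeasure gw_space {\<xi>. matches \<xi> \<tau>} \<partial>count_space A)"
    by (rule emeasure_UN_countable) (auto simp: disjoint_family_on_def dest: matches_unique)
  finally show ?thesis by (simp add: emeasure_matches)
qed

lemma nn_integral_pweight_le: "(\<integral>\<^sup>+\<tau>. pweight \<tau> \<partial>count_space UNIV) \<le> 1"
proof -
  interpret prob_space gw_space by (rule prob_space_PiM) (rule prob_space_measure_pmf)
  show ?thesis unfolding emeasure_matches_UN[symmetric] by (rule emeasure_le_1)
qed

lemma sum_pweight_le_nn: "finite F \<Longrightarrow> ennreal (sum pweight F) \<le> (\<integral>\<^sup>+\<tau>. pweight \<tau> \<partial>count_space UNIV)"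
proof -
  assume F: "finite F"
  have "ennreal (sum pweight F) = (\<integral>\<^sup>+\<tau>. pweight \<tau> \<partial>count_space F)"
    using F pweight_pos by (simp add: nn_integral_count_space_finite sum_ennreal less_imp_le)
  also have "\<dots> \<le> (\<integral>\<^sup>+\<tau>. pweight \<tau> \<partial>count_space UNIV)"
    by (simp add: nn_integral_count_space_indicator)
      (auto intro!: nn_integral_mono split: split_indicator)
  finally show ?thesis .
qed

text \<open>
  It expands a power of the total weight of trees into the weights of the forests at the children of
  the root.
\<close>
lemma sum_power_lists:
  fixes f :: "'a \<Rightarrow> 'b::comm_semiring_1"
  assumes "finite F"
  shows "(\<Sum>x\<in>F. f x) ^ k = (\<Sum>xs\<in>{xs. set xs \<subseteq> F \<and> length xs = k}. \<Prod>x\<leftarrow>xs. f x)"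
proof (induction k)
  case (Suc k)
  let ?L = "{xs. set xs \<subseteq> F \<and> length xs = k}"
  have "(\<Sum>xs\<in>{xs. set xs \<subseteq> F \<and> length xs = Suc k}. \<Prod>x\<leftarrow>xs. f x) =
      (\<Sum>(xs, x)\<in>?L \<times> F. f x * (\<Prod>x\<leftarrow>xs. f x))"
    unfolding lists_length_Suc_eq by (subst sum.reindex) (auto simp: inj_on_def intro!: sum.cong)
  also have "\<dots> = (\<Sum>x\<in>F. f x) * (\<Sum>xs\<in>?L. \<Prod>x\<leftarrow>xs. f x)"
    by (simp add: sum.cartesian_product[symmetric] sum_distrib_left sum_distrib_right)
  finally show ?case using Suc by simp
next
  case 0
  have "{xs. set xs \<subseteq> F \<and> length xs = 0} = {[]}" by auto
  then show ?case by (simp only:) simp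
qed

text \<open>
  The sum \<open>S\<close> is at most \<open>1\<close>, as the trees are disjoint events.  Decomposing a tree at its root into
  \<open>k\<close> subtrees gives \<open>S \<ge> \<Sum>\<^sub>k e\<^sup>-\<^sup>1 S\<^sup>k / k! = e\<^sup>S\<^sup>-\<^sup>1\<close>, and \<open>e\<^sup>x > 1 + x\<close> unless \<open>x = 0\<close>.  The inequality
  is proved for finite sets of trees in place of \<open>S\<close> and passes to the limit.
\<close>
lemma has_sum_pweight: "(pweight has_sum 1) UNIV"
proof -
  define S where "S = infsum pweight UNIV"
  have le1: "sum pweight F \<le> 1" if "finite F" for F
    using order_trans[OF sum_pweight_le_nn[OF that] nn_integral_pweight_le]
    by (simp add: ennreal_le_1)
  have smm: "pweight summable_on UNIV"
    by (rule nonneg_bdd_above_summable_on)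
       (use le1 pweight_pos less_imp_le in \<open>auto intro!: bdd_aboveI2[where M=1]\<close>)
  then have hs: "(pweight has_sum S) UNIV" by (simp add: S_def)
  have leS: "sum pweight F \<le> S" if "finite F" for F
    using finite_sum_le_has_sum[OF hs that] pweight_pos by (simp add: less_imp_le)
  have "S \<le> 1"
    unfolding S_def using smm le1 by (intro infsum_le_finite_sums) auto
  \<comment> \<open>The trees with fewer than \<open>K\<close> children at the root and all subtrees in \<open>F\<close>, in the limit \<open>K \<rightarrow> \<infinity>\<close>.\<close>
  have step: "exp (sum pweight F - 1) \<le> S" if F: "finite F" for F
  proof -
    let ?x = "sum pweight F"
    have "(\<Sum>k<K. ?x ^ k /\<^sub>R fact k) * exp (-1) \<le> S" for K
    proof -
      let ?L = "\<lambda>k. {ts. set ts \<subseteq> F \<and> length ts = k}"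
      have fL: "finite (?L k)" for k using F by (rule finite_lists_length_eq)
      have "(\<Sum>k<K. ?x ^ k /\<^sub>R fact k) * exp (-1) = (\<Sum>k<K. \<Sum>ts\<in>?L k. pweight (PNode ts))"
        by (simp add: sum_power_lists[OF F] pweight_PNode sum_distrib_left sum_distrib_right
            divide_inverse scaleR_sum_right mult_ac)
      also have "\<dots> = (\<Sum>ts\<in>(\<Union>k<K. ?L k). pweight (PNode ts))"
        by (rule sum.UNION_disjoint[symmetric]) (auto simp: fL)
      also have "\<dots> = sum pweight (PNode ` (\<Union>k<K. ?L k))"
        by (subst sum.reindex) (auto simp: inj_on_def)
      also have "\<dots> \<le> S" by (rule leS) (auto simp: fL)
      finally show ?thesis .
    qed
    moreover have "(\<lambda>K. (\<Sum>k<K. ?x ^ k /\<^sub>R fact k) * exp (-1)) \<longlonglongrightarrow> exp ?x * exp (-1)"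
      using exp_converges[of ?x] unfolding sums_def by (intro tendsto_intros)
    ultimately have "exp ?x * exp (-1) \<le> S" by (intro LIMSEQ_le_const2[of _ "exp ?x * exp (-1)"]) blast+
    then show ?thesis by (simp add: exp_diff exp_minus divide_inverse)
  qed
  have "((\<lambda>F. exp (sum pweight F - 1)) \<longlongrightarrow> exp (S - 1)) (finite_subsets_at_top UNIV)"
    using hs unfolding has_sum_def by (intro tendsto_intros)
  then have "exp (S - 1) \<le> S"
    by (rule tendsto_upperbound)
       (auto simp: step intro!: eventually_finite_subsets_at_top_weakI)
  have "S = 1"
  proof (rule ccontr)
    assume "S \<noteq> 1"
    then have "1 - (1 - S) < exp (- (1 - S))" unfolding exp_minus_greater by simp
    then show False using \<open>exp (S - 1) \<le> S\<close> by simp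
  qed
  then show ?thesis using hs by simp
qed

lemma nn_integral_pweight: "(\<integral>\<^sup>+\<tau>. pweight \<tau> \<partial>count_space UNIV) = 1"
proof (rule antisym[OF nn_integral_pweight_le])
  have "((\<lambda>F. ennreal (sum pweight F)) \<longlongrightarrow> ennreal 1) (finite_subsets_at_top UNIV)"
    using has_sum_pweight unfolding has_sum_def by (intro tendsto_intros) 
  then have "ennreal 1 \<le> (\<integral>\<^sup>+\<tau>. pweight \<tau> \<partial>count_space UNIV)"
    by (rule tendsto_upperbound)
       (auto intro!: eventually_finite_subsets_at_top_weakI sum_pweight_le_nn)
  then show "1 \<le> (\<integral>\<^sup>+\<tau>. pweight \<tau> \<partial>count_space UNIV)" by simp
qed

definition plane_gw :: "ptree pmf" where
  "plane_gw = embed_pmf pweight"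

lemma pmf_plane_gw [simp]: "pmf plane_gw \<tau> = pweight \<tau>"
  unfolding plane_gw_def
  by (rule pmf_embed_pmf) (auto simp: nn_integral_pweight pweight_pos less_imp_le)

definition gw_pmf :: "rtree pmf" where
  "gw_pmf = map_pmf forget plane_gw"

text \<open>
  The infinite trees, which \<open>iso_class\<close> sends to \<open>None\<close>, form a null event, because the finite plane
  trees have total probability \<open>1\<close>.
\<close>
lemma gw_law_eq: "gw_law (poisson_pmf 1) = measure_pmf (map_pmf Some gw_pmf)"
proof -
  interpret prob_space gw_space by (rule prob_space_PiM) (rule prob_space_measure_pmf)
  have m: "emeasure gw_space {\<xi>. \<exists>\<tau>\<in>A. matches \<xi> \<tau>} = emeasure plane_gw A" for A
    unfolding emeasure_matches_UN by (simp flip: nn_integral_pmf)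
  have sets: "{\<xi>. \<exists>\<tau>\<in>A. matches \<xi> \<tau>} \<in> sets gw_space" for A
  proof -
    have "{\<xi>. \<exists>\<tau>\<in>A. matches \<xi> \<tau>} = (\<Union>\<tau>\<in>A. {\<xi>. matches \<xi> \<tau>})" by auto
    then show ?thesis by (auto intro!: sets.countable_UN')
  qed
  let ?f = "\<lambda>\<xi>. iso_class (gw_graph \<xi>)"
  have Some: "?f -` {Some t} = {\<xi>. \<exists>\<tau>\<in>{\<tau>. forget \<tau> = t}. matches \<xi> \<tau>}" for t
    by (auto simp: iso_class_gw_graph)
  have None: "?f -` {None} = space gw_space - {\<xi>. \<exists>\<tau>\<in>UNIV. matches \<xi> \<tau>}"
  proof -
    have "?f \<xi> = None \<longleftrightarrow> \<not> (\<exists>t. ?f \<xi> = Some t)" for \<xi> by simp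
    then show ?thesis by (auto simp: iso_class_gw_graph)
  qed
  have pre: "?f -` {x} \<in> sets gw_space" for x
  proof (cases x)
    case N: None
    show ?thesis unfolding N None by (intro sets.Diff[OF sets.top] sets)
  next
    case S: (Some t)
    show ?thesis unfolding S Some by (rule sets)
  qed
  have meas: "?f \<in> gw_space \<rightarrow>\<^sub>M count_space UNIV"
    using pre by (subst measurable_count_space_eq_countable) auto
  show ?thesis
  proof (rule measure_eqI_countable)
    show "countable (UNIV :: rtree option set)" by simp
    fix x :: "rtree option"
    have "emeasure gw_space (?f -` {x}) = emeasure (map_pmf Some gw_pmf) {x}"
    proof (cases x)
      case None
      have "emeasure gw_space (?f -` {None}) = 0"
        unfolding \<open>?f -` {None} = _\<close> using m[of UNIV] sets[of UNIV]
        by (subst emeasure_compl) (auto simp: emeasure_space_1 simp del: space_gw_space)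
      then show ?thesis using None by (simp add: vimage_def)
    next
      case (Some t)
      then show ?thesis
        unfolding Some \<open>?f -` {Some t} = _\<close> m by (simp add: gw_pmf_def vimage_def)
    qed
    then show "emeasure (gw_law (poisson_pmf 1)) {x} = emeasure (map_pmf Some gw_pmf) {x}"
      using meas by (simp add: gw_law_def emeasure_distr)
  qed (auto simp: gw_law_def)
qed

lemma pmf_replicate_pmf: "pmf (replicate_pmf k p) xs = (if length xs = k then \<Prod>x\<leftarrow>xs. pmf p x else 0)"
proof (induction k arbitrary: xs)
  case 0
  then show ?case by (auto simp: indicator_def)
next
  case (Suc k)
  have eq: "replicate_pmf (Suc k) p = map_pmf (\<lambda>(x, xs). x # xs) (pair_pmf p (replicate_pmf k p))"
    by (simp add: pair_pmf_def map_bind_pmf)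
  show ?case
  proof (cases xs)
    case Nil
    have "[] \<notin> set_pmf (replicate_pmf (Suc k) p)" unfolding set_replicate_pmf by simp
    then have "pmf (replicate_pmf (Suc k) p) [] = 0" unfolding set_pmf_iff by blast
    then show ?thesis using Nil by simp
  next
    case (Cons y ys)
    have inj: "inj (\<lambda>(x, xs). x # xs)" by (auto simp: inj_on_def)
    have "pmf (replicate_pmf (Suc k) p) xs = pmf (pair_pmf p (replicate_pmf k p)) (y, ys)"
      using pmf_map_inj'[OF inj, of _ "(y, ys)"] by (simp only: eq Cons split)
    then show ?thesis using Suc Cons by (simp add: pmf_pair)
  qed
qed

lemma plane_gw_unfold:
  "plane_gw = bind_pmf (poisson_pmf 1) (\<lambda>k. map_pmf PNode (replicate_pmf k plane_gw))"
proof (rule pmf_eqI)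
  fix \<tau> :: ptree
  obtain ts where t: "\<tau> = PNode ts" by (cases \<tau>)
  have "inj PNode" by (auto simp: inj_on_def)
  then have "pmf (map_pmf PNode (replicate_pmf k plane_gw)) \<tau> =
      indicator {length ts} k * (\<Prod>t\<leftarrow>ts. pweight t)" for k
    by (simp add: t pmf_map_inj' pmf_replicate_pmf indicator_def)
  then have "pmf (bind_pmf (poisson_pmf 1) (\<lambda>k. map_pmf PNode (replicate_pmf k plane_gw))) \<tau> =
      (\<integral>k. indicator {length ts} k * (\<Prod>t\<leftarrow>ts. pweight t) \<partial>poisson_pmf 1)"
    by (simp add: pmf_bind)
  also have "\<dots> = pmf (poisson_pmf 1) (length ts) * (\<Prod>t\<leftarrow>ts. pweight t)"
    by (simp add: measure_pmf_single)
  finally show "pmf plane_gw \<tau> = pmf (bind_pmf (poisson_pmf 1) (\<lambda>k. map_pmf PNode (replicate_pmf k plane_gw))) \<tau>"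
    by (simp add: t pweight_PNode mult_ac)
qed

lemma map_replicate_pmf: "map_pmf (map f) (replicate_pmf k p) = replicate_pmf k (map_pmf f p)"
proof (induction k)
  case (Suc k)
  then show ?case by (simp add: map_bind_pmf bind_map_pmf flip: Suc)
qed simp

lemma gw_pmf_unfold:
  "gw_pmf = bind_pmf (poisson_pmf 1) (\<lambda>k. map_pmf (\<lambda>ts. Node (mset ts)) (replicate_pmf k gw_pmf))"
proof -
  have "gw_pmf = map_pmf forget (bind_pmf (poisson_pmf 1) (\<lambda>k. map_pmf PNode (replicate_pmf k plane_gw)))"
    unfolding gw_pmf_def by (subst plane_gw_unfold) simp
  also have "\<dots> = bind_pmf (poisson_pmf 1) (\<lambda>k. map_pmf (\<lambda>ts. Node (mset ts)) (map_pmf (map forget) (replicate_pmf k plane_gw)))"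
    by (simp add: map_bind_pmf pmf.map_comp comp_def)
  finally show ?thesis by (simp add: map_replicate_pmf gw_pmf_def)
qed

text \<open>
  The root has \<open>size M\<close> children in some order, and the orders are the permutations of the multiset.
\<close>
lemma pmf_gw_Node:
  "pmf gw_pmf (Node M) = exp (-1) / fact (size M) * card (permutations_of_multiset M) *
     (\<Prod>t\<in>#M. pmf gw_pmf t)"
proof -
  have "pmf (map_pmf (\<lambda>ts. Node (mset ts)) (replicate_pmf k gw_pmf)) (Node M) =
      indicator {size M} k * (real (card (permutations_of_multiset M)) * (\<Prod>t\<in>#M. pmf gw_pmf t))" for k
  proof -
    have "pmf (map_pmf (\<lambda>ts. Node (mset ts)) (replicate_pmf k gw_pmf)) (Node M) =
        measure (replicate_pmf k gw_pmf) (permutations_of_multiset M)"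
      by (simp add: pmf_map vimage_def permutations_of_multiset_def)
    also have "\<dots> = (\<Sum>ts\<in>permutations_of_multiset M. pmf (replicate_pmf k gw_pmf) ts)"
      by (rule measure_measure_pmf_finite) simp
    also have "\<dots> = (\<Sum>ts\<in>permutations_of_multiset M. indicator {size M} k * (\<Prod>t\<in>#M. pmf gw_pmf t))"
      by (intro sum.cong) (auto simp: pmf_replicate_pmf permutations_of_multiset_def indicator_def
          simp flip: prod_mset_prod_list)
    finally show ?thesis by simp
  qed
  then have "pmf gw_pmf (Node M) =
      (\<integral>k. indicator {size M} k * (real (card (permutations_of_multiset M)) * (\<Prod>t\<in>#M. pmf gw_pmf t)) \<partial>measure_pmf (poisson_pmf 1))"
    by (subst gw_pmf_unfold) (simp add: pmf_bind)
  also have "\<dots> = pmf (poisson_pmf 1) (size M) * (real (card (permutations_of_multiset M)) * (\<Prod>t\<in>#M. pmf gw_pmf t))"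
    by (simp add: measure_pmf_single)
  finally show ?thesis by simp
qed

text \<open>
  The size-biased Poisson(1) distribution is Poisson(1) shifted by one.  At the level of
  trees: choosing a child of class \<open>t\<close> of the root and removing it leaves a tree with the original law, independent of \<open>t\<close>.
\<close>
lemma pmf_gw_add_mset:
  "pmf gw_pmf (Node (add_mset t M)) * real (Suc (count M t)) = pmf gw_pmf (Node M) * pmf gw_pmf t"
proof -
  have c: "real (card (permutations_of_multiset (add_mset t M))) * real (Suc (count M t)) =
      real (Suc (size M)) * real (card (permutations_of_multiset M))"
    using card_permutations_of_multiset_insert_aux[of M t]
    by (simp del: of_nat_Suc flip: of_nat_mult)
  have "pmf gw_pmf (Node (add_mset t M)) * real (Suc (count M t)) =
     exp (-1) / fact (Suc (size M)) * (pmf gw_pmf t * (\<Prod>t\<in>#M. pmf gw_pmf t)) *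
       (real (card (permutations_of_multiset (add_mset t M))) * real (Suc (count M t)))"
    by (simp add: pmf_gw_Node mult_ac)
  also have "\<dots> = pmf gw_pmf (Node M) * pmf gw_pmf t"
    unfolding c pmf_gw_Node fact_Suc by (simp add: divide_simps mult_ac del: of_nat_Suc)
  finally show ?thesis .
qed

lemma gw_root_degree:
  "measure gw_pmf {t. size (children t) = k} = exp (-1) / fact k"
proof -
  have "map_pmf (\<lambda>t. size (children t)) gw_pmf = poisson_pmf 1"
  proof -
    have "map_pmf (\<lambda>t. size (children t)) gw_pmf =
       bind_pmf (poisson_pmf 1) (\<lambda>k. map_pmf length (replicate_pmf k gw_pmf))"
      by (subst gw_pmf_unfold) (simp add: map_bind_pmf pmf.map_comp comp_def)
    also have "\<dots> = bind_pmf (poisson_pmf 1) (\<lambda>k. map_pmf (\<lambda>_. k) (replicate_pmf k gw_pmf))"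
      by (intro bind_pmf_cong map_pmf_cong refl) (auto simp: set_replicate_pmf)
    finally show ?thesis by (simp add: map_pmf_const bind_return_pmf')
  qed
  then have "pmf (map_pmf (\<lambda>t. size (children t)) gw_pmf) k = exp (-1) / fact k" by simp
  then show ?thesis by (simp add: pmf_map vimage_def)
qed

section \<open>The sin-tree with Galton--Watson fringe\<close>

lemma has_sum_pmf: "(pmf p has_sum measure p A) A"
proof -
  have a: "Infinite_Set_Sum.abs_summable_on (pmf p) A" by (rule pmf_abs_summable)
  then have "pmf p summable_on A"
    unfolding abs_summable_equivalent[symmetric] by (rule abs_summable_summable)
  moreover have "infsum (pmf p) A = measure p A"
    using infsetsum_infsum[OF a] by (simp add: measure_pmf_conv_infsetsum)
  ultimately show ?thesis by (metis has_sum_infsum)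
qed

text \<open>
  Summing \<open>pmf_gw_add_mset\<close> over \<open>M\<close> gives the defining equation, since \<open>gw_pmf\<close> has mass \<open>1\<close>.
\<close>
lemma fringe_distribution_gw: "fringe_distribution (gw_law (poisson_pmf 1))"
  unfolding fringe_distribution_def gw_law_eq
proof (intro conjI allI)
  let ?\<mu> = "measure_pmf (map_pmf Some gw_pmf)"
  show "prob_space ?\<mu>" by (rule prob_space_measure_pmf)
  show "sets ?\<mu> = UNIV" by simp
  have inj: "inj (Some :: rtree \<Rightarrow> _)" by simp
  have Some: "measure ?\<mu> {Some s} = pmf gw_pmf s" for s
    using pmf_map_inj'[OF inj, of gw_pmf s] by (simp add: measure_pmf_single)
  have None: "measure ?\<mu> {None} = 0"
    by (auto simp: measure_pmf_zero_iff)
  fix t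
  show "((\<lambda>s. measure ?\<mu> {s} * real (subtree_count s t)) has_sum measure ?\<mu> {t}) UNIV"
  proof (cases t)
    case N: None
    have "subtree_count s None = 0" for s by (cases s) auto
    then show ?thesis unfolding N None by (intro has_sum_0) simp
  next
    case S: (Some u)
    let ?h = "\<lambda>M. Some (Node (add_mset u M))"
    have "bij Node" by (metis bijI' rtree.exhaust rtree.inject)
    then have "(pmf gw_pmf has_sum 1) (range Node)"
      using has_sum_pmf[of gw_pmf UNIV] by (simp add: bij_def)
    then have "((\<lambda>M. pmf gw_pmf (Node M)) has_sum 1) UNIV"
      using \<open>bij Node\<close> by (subst (asm) has_sum_reindex) (auto simp: bij_def comp_def)
    then have "((\<lambda>M. pmf gw_pmf (Node M) * pmf gw_pmf u) has_sum 1 * pmf gw_pmf u) UNIV"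
      by (rule has_sum_cmult_left)
    then have "((\<lambda>M. measure ?\<mu> {?h M} * real (subtree_count (?h M) t)) has_sum measure ?\<mu> {t}) UNIV"
      unfolding S Some by (simp add: pmf_gw_add_mset del: of_nat_Suc)
    then have "((\<lambda>s. measure ?\<mu> {s} * real (subtree_count s t)) has_sum measure ?\<mu> {t}) (range ?h)"
      by (subst has_sum_reindex) (auto simp: inj_on_def comp_def)
    also have "?this \<longleftrightarrow> ?thesis"
    proof (rule has_sum_cong_neutral)
      fix s assume s: "s \<in> UNIV - range ?h"
      have "subtree_count s t = 0"
      proof (rule ccontr)
        assume "subtree_count s t \<noteq> 0"
        then obtain v where v: "s = Some v" "u \<in># children v"
          unfolding S by (cases s) auto
        then have "s = ?h (children v - {#u#})" by (cases v) auto
        then show False using s by blast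
      qed
      then show "measure ?\<mu> {s} * real (subtree_count s t) = 0" by simp
    qed auto
    finally show ?thesis .
  qed
qed

definition sin_measure :: "(nat \<Rightarrow> rtree) measure" where
  "sin_measure = PiM UNIV (\<lambda>_. measure_pmf gw_pmf)"

text \<open>
  The inverse of the monotone representation: the tree at \<open>m\<close> without the branch towards \<open>0\<close>.
\<close>
definition off_spine :: "(nat \<Rightarrow> rtree) \<Rightarrow> nat \<Rightarrow> rtree" where
  "off_spine s m = (case m of 0 \<Rightarrow> s 0 | Suc l \<Rightarrow> Node (children (s m) - {#s l#}))"

lemma monotone_rep_iff:
  "(\<forall>m\<le>i. monotone_rep t m = s m) \<longleftrightarrow>
   (\<forall>m\<in>{1..i}. s (m - 1) \<in># children (s m)) \<and> (\<forall>m\<le>i. t m = off_spine s m)"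
proof (induction i)
  case 0
  then show ?case by (auto simp: off_spine_def)
next
  case (Suc i)
  have "monotone_rep t (Suc i) = s (Suc i) \<longleftrightarrow>
      s i \<in># children (s (Suc i)) \<and> t (Suc i) = off_spine s (Suc i)" if "monotone_rep t i = s i"
    using that by (cases "s (Suc i)"; cases "t (Suc i)") (auto simp: off_spine_def)
  moreover have "{1..Suc i} = insert (Suc i) {1..i}" by auto
  ultimately show ?case using Suc by (auto simp: le_Suc_eq)
qed

text \<open>
  Repeated use of \<open>pmf_gw_add_mset\<close> along the spine turns the prescribed law of the monotone
  representation into a product law.  If \<open>s\<close> is not a monotone representation, some multiplicity
  vanishes.
\<close>
lemma prod_off_spine:
  "pmf gw_pmf (s i) * (\<Prod>m=1..i. real (count (children (s m)) (s (m - 1)))) =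
   (if \<forall>m\<in>{1..i}. s (m - 1) \<in># children (s m) then \<Prod>m\<le>i. pmf gw_pmf (off_spine s m) else 0)"
proof (induction i)
  case 0
  then show ?case by (simp add: off_spine_def)
next
  case (Suc i)
  show ?case
  proof (cases "\<forall>m\<in>{1..Suc i}. s (m - 1) \<in># children (s m)")
    case True
    obtain M where M: "s (Suc i) = Node (add_mset (s i) M)"
      using True by (cases "s (Suc i)") (auto dest!: bspec[of _ _ "Suc i"] multi_member_split)
    have e1: "pmf gw_pmf (s (Suc i)) * real (count (children (s (Suc i))) (s i)) =
        pmf gw_pmf (off_spine s (Suc i)) * pmf gw_pmf (s i)"
      using pmf_gw_add_mset[of "s i" M] by (simp add: M off_spine_def)
    have e2: "pmf gw_pmf (s i) * (\<Prod>m=1..i. real (count (children (s m)) (s (m - 1)))) =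
        (\<Prod>m\<le>i. pmf gw_pmf (off_spine s m))"
      using Suc True by auto
    have "pmf gw_pmf (s (Suc i)) * (\<Prod>m=1..Suc i. real (count (children (s m)) (s (m - 1)))) =
        (pmf gw_pmf (s (Suc i)) * real (count (children (s (Suc i))) (s i))) *
        (\<Prod>m=1..i. real (count (children (s m)) (s (m - 1))))"
      by (simp add: mult_ac)
    also have "\<dots> = pmf gw_pmf (off_spine s (Suc i)) * (\<Prod>m\<le>i. pmf gw_pmf (off_spine s m))"
      unfolding e1 e2[symmetric] by (simp add: mult_ac)
    also have "\<dots> = (\<Prod>m\<le>Suc i. pmf gw_pmf (off_spine s m))"
      by (simp add: mult_ac)
    finally show ?thesis using True by simp
  next
    case False
    then obtain m where "m \<in> {1..Suc i}" "count (children (s m)) (s (m - 1)) = 0"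
      by (auto simp: count_eq_zero_iff)
    then have "(\<Prod>m=1..Suc i. real (count (children (s m)) (s (m - 1)))) = 0"
      by (intro prod_zero) auto
    then show ?thesis unfolding if_not_P[OF False] by (simp only: mult_zero_right)
  qed
qed

lemma sets_sin_measure: "sets sin_measure = sets sin_tree_space"
  unfolding sin_measure_def sin_tree_space_def by (rule sets_PiM_cong) auto

lemma measure_gw_Some: "measure (gw_law (poisson_pmf 1)) {Some s} = pmf gw_pmf s"
  unfolding gw_law_eq using pmf_map_inj'[of Some gw_pmf s] by (simp add: measure_pmf_single)

lemma sin_tree_law_sin_measure: "sin_tree_law (gw_law (poisson_pmf 1)) sin_measure"
  unfolding sin_tree_law_def
proof (intro conjI allI)
  show "fringe_distribution (gw_law (poisson_pmf 1))" by (rule fringe_distribution_gw)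
  show "prob_space sin_measure"
    unfolding sin_measure_def by (rule prob_space_PiM) (rule prob_space_measure_pmf)
  show "sets sin_measure = sets sin_tree_space" by (rule sets_sin_measure)
  fix i s
  interpret product_prob_space "\<lambda>_. measure_pmf gw_pmf" "UNIV :: nat set" by unfold_locales
  have sp: "space sin_measure = UNIV" by (simp add: sin_measure_def space_PiM)
  have "emeasure sin_measure {t \<in> space sin_measure. \<forall>m\<in>{..i}. t m \<in> {off_spine s m}} =
      (\<Prod>m\<le>i. emeasure gw_pmf {off_spine s m})"
    unfolding sin_measure_def by (rule emeasure_PiM_Collect) auto
  then have "measure sin_measure {t. \<forall>m\<le>i. t m = off_spine s m} = (\<Prod>m\<le>i. pmf gw_pmf (off_spine s m))"
    by (simp add: sp measure_def emeasure_pmf_single prod_ennreal prod_nonneg Ball_def)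
  then have "measure sin_measure {t \<in> space sin_measure. \<forall>m\<le>i. monotone_rep t m = s m} =
      (if \<forall>m\<in>{1..i}. s (m - 1) \<in># children (s m) then \<Prod>m\<le>i. pmf gw_pmf (off_spine s m) else 0)"
    unfolding monotone_rep_iff sp
    by (cases "\<forall>m\<in>{1..i}. s (m - 1) \<in># children (s m)") (simp, simp only: if_not_P simp_thms, simp)
  then show "measure sin_measure {t \<in> space sin_measure. \<forall>m\<le>i. monotone_rep t m = s m} =
      measure (gw_law (poisson_pmf 1)) {Some (s i)} *
      (\<Prod>m=1..i. real (subtree_count (Some (s m)) (Some (s (m - 1)))))"
    unfolding measure_gw_Some subtree_count.simps prod_off_spine .
qed

lemma space_sin_law: "sin_tree_law \<mu> L \<Longrightarrow> space L = UNIV"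
  by (drule sin_tree_law_def[THEN iffD1]) (auto dest!: sets_eq_imp_space_eq simp: sin_tree_space_def space_PiM)

text \<open>
  The monotone representation up to \<open>i\<close> determines the trees up to \<open>i\<close> and conversely, so the condition on
  the law determines the probability of each finite prefix.
\<close>
lemma sin_law_prefix:
  assumes "sin_tree_law \<mu> L"
  shows "measure L {t. \<forall>m\<le>i. t m = u m} = measure \<mu> {Some (monotone_rep u i)} *
    (\<Prod>m=1..i. real (count (children (monotone_rep u m)) (monotone_rep u (m - 1))))"
proof -
  have "(\<forall>m\<le>i. t m = u m) \<longleftrightarrow> (\<forall>m\<le>i. monotone_rep t m = monotone_rep u m)" for t
    using monotone_rep_iff[of i t "monotone_rep u"] monotone_rep_iff[of i u "monotone_rep u"] by auto
  then have "measure L {t. \<forall>m\<le>i. t m = u m} =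
      measure L {t \<in> space L. \<forall>m\<le>i. monotone_rep t m = monotone_rep u m}"
    using space_sin_law[OF assms] by simp
  then show ?thesis using assms by (simp add: sin_tree_law_def)
qed

lemma map_upt_eq_iff: "map t [0..<n] = xs \<longleftrightarrow> length xs = n \<and> (\<forall>m<n. t m = xs ! m)"
proof -
  have "map t [0..<n] = xs \<longleftrightarrow> length (map t [0..<n]) = length xs \<and>
      (\<forall>m<length (map t [0..<n]). map t [0..<n] ! m = xs ! m)"
    by (rule list_eq_iff_nth_eq)
  also have "\<dots> \<longleftrightarrow> length xs = n \<and> (\<forall>m<n. t m = xs ! m)"
    by (intro conj_cong) auto
  finally show ?thesis .
qed

lemma measurable_prefix:
  assumes "sin_tree_law \<mu> L"
  shows "(\<lambda>t. map t [0..<n]) \<in> L \<rightarrow>\<^sub>M count_space UNIV"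
proof -
  have "(\<lambda>t. map t [0..<n]) \<in> sin_tree_space \<rightarrow>\<^sub>M count_space UNIV"
  proof (subst measurable_count_space_eq_countable, simp, intro conjI ballI)
    fix xs :: "rtree list"
    have "Measurable.pred sin_tree_space (\<lambda>t. \<forall>m\<in>{..<n}. t m = xs ! m)"
      unfolding sin_tree_space_def by measurable
    then have "{t \<in> space sin_tree_space. \<forall>m\<in>{..<n}. t m = xs ! m} \<in> sets sin_tree_space"
      by (simp add: pred_def)
    moreover have "(\<lambda>t. map t [0..<n]) -` {xs} \<inter> space sin_tree_space =
        (if length xs = n then {t \<in> space sin_tree_space. \<forall>m\<in>{..<n}. t m = xs ! m} else {})"
      by (auto simp: map_upt_eq_iff)
    ultimately show "(\<lambda>t. map t [0..<n]) -` {xs} \<inter> space sin_tree_space \<in> sets sin_tree_space"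
      by simp
  qed simp
  moreover have "sets L = sets sin_tree_space" using assms by (simp add: sin_tree_law_def)
  ultimately show ?thesis using measurable_cong_sets[of L sin_tree_space] by blast
qed

text \<open>
  Prefixes range over a countable set, hence their laws are determined by the point masses.
\<close>
lemma sin_tree_law_unique:
  assumes "sin_tree_law \<mu> L" "sin_tree_law \<mu> L'"
  shows "L = L'"
proof (rule measure_eqI_PiM_infinite)
  let ?C = "\<lambda>_::nat. count_space (UNIV :: rtree set)"
  show "sets L = sets (PiM UNIV ?C)" "sets L' = sets (PiM UNIV ?C)"
    using assms by (auto simp: sin_tree_law_def sin_tree_space_def)
  interpret L: prob_space L using assms by (simp add: sin_tree_law_def)
  interpret L': prob_space L' using assms by (simp add: sin_tree_law_def)
  show "finite_measure L" by (rule L.finite_measure_axioms)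
  fix A :: "nat \<Rightarrow> rtree set" and J :: "nat set" assume "finite J"
  then obtain n where n: "J \<subseteq> {..n}" using finite_nat_iff_bounded_le by blast
  let ?r = "\<lambda>t :: nat \<Rightarrow> rtree. map t [0..<Suc n]"
  have "distr L (count_space UNIV) ?r = distr L' (count_space UNIV) ?r"
  proof (rule measure_eqI_countable)
    fix xs :: "rtree list"
    have "?r -` {xs} = (if length xs = Suc n then {t. \<forall>m\<le>n. t m = xs ! m} else {})"
      by (auto simp: map_upt_eq_iff less_Suc_eq_le simp del: upt_Suc)
    then have "emeasure L (?r -` {xs}) = emeasure L' (?r -` {xs})"
      using sin_law_prefix[OF assms(1)] sin_law_prefix[OF assms(2)]
      by (simp add: L.emeasure_eq_measure L'.emeasure_eq_measure)
    then show "emeasure (distr L (count_space UNIV) ?r) {xs} =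
        emeasure (distr L' (count_space UNIV) ?r) {xs}"
      using assms space_sin_law[OF assms(1)] space_sin_law[OF assms(2)]
      by (simp add: emeasure_distr measurable_prefix del: upt_Suc)
  qed auto
  then have "emeasure (distr L (count_space UNIV) ?r) {xs. \<forall>j\<in>J. xs ! j \<in> A j} =
      emeasure (distr L' (count_space UNIV) ?r) {xs. \<forall>j\<in>J. xs ! j \<in> A j}" by simp
  moreover have "?r -` {xs. \<forall>j\<in>J. xs ! j \<in> A j} = prod_emb UNIV ?C J (Pi\<^sub>E J A)"
    using n by (auto simp: prod_emb_def less_Suc_eq_le subset_iff PiE_iff simp del: upt_Suc)
  ultimately show "emeasure L (prod_emb UNIV ?C J (Pi\<^sub>E J A)) = emeasure L' (prod_emb UNIV ?C J (Pi\<^sub>E J A))"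
    using assms space_sin_law[OF assms(1)] space_sin_law[OF assms(2)]
    by (simp add: emeasure_distr measurable_prefix del: upt_Suc)
qed

section \<open>Concentration for locally determined events\<close>

lemma (in prob_space) variance_sum_indicators:
  assumes R: "finite R" and ev: "\<And>v. v \<in> R \<Longrightarrow> A v \<in> events"
  shows "variance (\<lambda>\<omega>. \<Sum>v\<in>R. indicator (A v) \<omega>) =
    (\<Sum>v\<in>R. \<Sum>u\<in>R. prob (A v \<inter> A u) - prob (A v) * prob (A u))"
proof -
  let ?Y = "\<lambda>\<omega>. \<Sum>v\<in>R. indicator (A v) \<omega> :: real"
  have i1: "integrable M (indicator (A v) :: _ \<Rightarrow> real)" if "v \<in> R" for v
    using ev[OF that] by (simp add: emeasure_eq_measure)
  have i2: "integrable M (indicator (A v \<inter> A u) :: _ \<Rightarrow> real)" if "v \<in> R" "u \<in> R" for v u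
    using ev that by (auto simp: emeasure_eq_measure)
  have sq: "(?Y \<omega>)\<^sup>2 = (\<Sum>v\<in>R. \<Sum>u\<in>R. indicator (A v \<inter> A u) \<omega>)" for \<omega>
    by (simp add: power2_eq_square sum_product indicator_inter_arith)
  have E: "expectation ?Y = (\<Sum>v\<in>R. prob (A v))"
    using ev sets.sets_into_space by (subst Bochner_Integration.integral_sum) (auto simp: i1 Int_absorb1 intro!: sum.cong arg_cong[where f=prob])
  have "variance ?Y = expectation (\<lambda>\<omega>. (?Y \<omega>)\<^sup>2) - (expectation ?Y)\<^sup>2"
    by (rule variance_eq) (auto simp: sq intro!: Bochner_Integration.integrable_sum i1 i2)
  also have "expectation (\<lambda>\<omega>. (?Y \<omega>)\<^sup>2) = (\<Sum>v\<in>R. \<Sum>u\<in>R. prob (A v \<inter> A u))"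
  proof -
    have "expectation (\<lambda>\<omega>. (?Y \<omega>)\<^sup>2) = (\<Sum>v\<in>R. \<Sum>u\<in>R. expectation (indicator (A v \<inter> A u)))"
      unfolding sq by (subst Bochner_Integration.integral_sum;
          (intro Bochner_Integration.integrable_sum i2 sum.cong refl Bochner_Integration.integral_sum)?)
    also have "\<dots> = (\<Sum>v\<in>R. \<Sum>u\<in>R. prob (A v \<inter> A u))"
      using ev by (intro sum.cong refl) (auto simp: emeasure_eq_measure Int_absorb1 sets.sets_into_space intro!: arg_cong[where f=prob])
    finally show ?thesis .
  qed
  also have "(expectation ?Y)\<^sup>2 = (\<Sum>v\<in>R. \<Sum>u\<in>R. prob (A v) * prob (A u))"
    unfolding E by (simp add: power2_eq_square sum_product)
  finally show ?thesis by (simp add: sum_subtractf)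
qed

text \<open>
  Only the pairs at distance at most \<open>L n\<close> contribute, and each contributes at most \<open>1\<close>.
\<close>
lemma (in prob_space) variance_local_events:
  assumes ev: "\<And>v. A v \<in> events"
    and indep: "\<And>v u. n\<^sub>0 \<le> v \<Longrightarrow> v + L v \<le> u \<Longrightarrow> prob (A v \<inter> A u) = prob (A v) * prob (A u)"
    and L: "mono L"
  shows "variance (\<lambda>\<omega>. \<Sum>v\<in>{n\<^sub>0..n}. indicator (A v) \<omega>) \<le> real (Suc n) * (2 * real (L n) + 1)"
proof -
  have cov: "prob (A v \<inter> A u) - prob (A v) * prob (A u) \<le> indicator {v - L n..v + L n} u"
    if vu: "v \<in> {n\<^sub>0..n}" "u \<in> {n\<^sub>0..n}" for v u
  proof (cases "u \<in> {v - L n..v + L n}")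
    case True
    have "0 \<le> prob (A v) * prob (A u)" by simp
    then have "prob (A v \<inter> A u) - prob (A v) * prob (A u) \<le> 1"
      using prob_le_1[of "A v \<inter> A u"] by linarith
    then show ?thesis using True by simp
  next
    case False
    then consider "v + L n \<le> u" | "u + L n \<le> v" by force
    then have "prob (A v \<inter> A u) = prob (A v) * prob (A u)"
    proof cases
      case 1
      moreover have "L v \<le> L n" using L vu by (auto simp: mono_def)
      ultimately show ?thesis using vu by (intro indep) auto
    next
      case 2
      moreover have "L u \<le> L n" using L vu by (auto simp: mono_def)
      ultimately show ?thesis using vu indep[of u v] by (simp add: Int_commute mult.commute)
    qed
    then show ?thesis by simp
  qed
  have "variance (\<lambda>\<omega>. \<Sum>v\<in>{n\<^sub>0..n}. indicator (A v) \<omega>) =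
      (\<Sum>v\<in>{n\<^sub>0..n}. \<Sum>u\<in>{n\<^sub>0..n}. prob (A v \<inter> A u) - prob (A v) * prob (A u))"
    using ev by (intro variance_sum_indicators) auto
  also have "\<dots> \<le> (\<Sum>v\<in>{n\<^sub>0..n}. \<Sum>u\<in>{n\<^sub>0..n}. indicator {v - L n..v + L n} u)"
    by (intro sum_mono cov)
  also have "\<dots> \<le> (\<Sum>v\<in>{n\<^sub>0..n}. 2 * real (L n) + 1)"
  proof (rule sum_mono)
    fix v
    have "(\<Sum>u\<in>{n\<^sub>0..n}. indicator {v - L n..v + L n} u :: real) = card ({n\<^sub>0..n} \<inter> {v - L n..v + L n})"
      by (simp add: indicator_def sum.If_cases Int_def conj_commute del: Int_atLeastAtMost)
    also have "\<dots> \<le> card {v - L n..v + L n}" by (intro of_nat_mono card_mono) auto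
    also have "\<dots> \<le> 2 * real (L n) + 1" by simp
    finally show "(\<Sum>u\<in>{n\<^sub>0..n}. indicator {v - L n..v + L n} u :: real) \<le> 2 * real (L n) + 1" .
  qed
  also have "\<dots> \<le> real (Suc n) * (2 * real (L n) + 1)"
    unfolding sum_constant by (intro mult_right_mono of_nat_mono) auto
  finally show ?thesis .
qed

text \<open>
  Chebyshev's inequality; by the variance bound the deviation probability is of order \<open>L n / n\<close>.
  The first vertices, for which the bound on the probability may fail, are too few to matter.
\<close>
lemma (in prob_space) local_events_lower_bound:
  fixes p e :: real
  assumes ev: "\<And>v. A v \<in> events"
    and indep: "\<And>v u. n\<^sub>0 \<le> v \<Longrightarrow> v + L v \<le> u \<Longrightarrow> prob (A v \<inter> A u) = prob (A v) * prob (A u)"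
    and L: "mono L" "(\<lambda>n. real (L n) / real n) \<longlonglongrightarrow> 0"
    and lower: "\<And>e. e > 0 \<Longrightarrow> \<forall>\<^sub>F v in sequentially. prob (A v) \<ge> p - e"
    and "e > 0"
  shows "(\<lambda>n. prob {\<omega> \<in> space M. real (card {v \<in> {1..n}. \<omega> \<in> A v}) < (p - e) * real n}) \<longlonglongrightarrow> 0"
proof -
  obtain n1 where n1: "\<And>v. v \<ge> n1 \<Longrightarrow> prob (A v) \<ge> p - e / 2"
    using lower[of "e / 2"] \<open>e > 0\<close> by (auto simp: eventually_sequentially)
  \<comment> \<open>From \<open>m\<close> on, both the independence and the bound with \<open>e/2\<close> hold; the rest of \<open>e\<close> covers the
    vertices below \<open>m\<close> and the deviation, with \<open>e/4\<close> each.\<close>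
  define m where "m = Suc (max n\<^sub>0 n1)"
  define Y where "Y n \<omega> = (\<Sum>v\<in>{m..n}. indicator (A v) \<omega> :: real)" for n \<omega>
  have i1: "integrable M (indicator (A v) :: _ \<Rightarrow> real)" for v
    using ev[of v] by (simp add: emeasure_eq_measure)
  have Ysq: "(Y n \<omega>)\<^sup>2 = (\<Sum>v\<in>{m..n}. \<Sum>u\<in>{m..n}. indicator (A v \<inter> A u) \<omega>)" for n \<omega>
    by (simp add: Y_def power2_eq_square sum_product indicator_inter_arith)
  have i2: "integrable M (indicator (A v \<inter> A u) :: _ \<Rightarrow> real)" for v u
    using ev[of v] ev[of u] by (simp add: emeasure_eq_measure)
  have EY: "expectation (Y n) = (\<Sum>v\<in>{m..n}. prob (A v))" for n
    unfolding Y_def using ev sets.sets_into_space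
    by (subst Bochner_Integration.integral_sum) (auto simp: i1 Int_absorb1 intro!: sum.cong arg_cong[where f=prob])
  have bound: "prob {\<omega> \<in> space M. real (card {v \<in> {1..n}. \<omega> \<in> A v}) < (p - e) * real n} \<le>
      real (Suc n) * (2 * real (L n) + 1) / (e / 4 * real n)\<^sup>2"
    if n: "n \<ge> m" "real m * \<bar>p - e / 2\<bar> \<le> e / 4 * real n" for n
  proof -
    have "real n > 0" using n(1) by (simp add: m_def)
    have "(\<Sum>v\<in>{m..n}. p - e / 2) \<le> expectation (Y n)"
      unfolding EY by (intro sum_mono n1) (auto simp: m_def)
    moreover have "(\<Sum>v\<in>{m..n}. p - e / 2) = (real n + 1 - real m) * (p - e / 2)"
      using n(1) by (simp add: of_nat_diff)
    moreover have "(real n + 1 - real m) * (p - e / 2) = real n * (p - e / 2) - (real m - 1) * (p - e / 2)"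
      by algebra
    moreover have "(real m - 1) * (p - e / 2) \<le> real m * \<bar>p - e / 2\<bar>"
    proof -
      have "(real m - 1) * (p - e / 2) \<le> (real m - 1) * \<bar>p - e / 2\<bar>"
        by (intro mult_left_mono) (auto simp: m_def)
      also have "\<dots> \<le> real m * \<bar>p - e / 2\<bar>" by (intro mult_right_mono) auto
      finally show ?thesis .
    qed
    ultimately have E: "expectation (Y n) \<ge> real n * (p - e / 2) - e / 4 * real n"
      using n(2) by linarith
    have "{\<omega> \<in> space M. real (card {v \<in> {1..n}. \<omega> \<in> A v}) < (p - e) * real n} \<subseteq>
        {\<omega> \<in> space M. e / 4 * real n \<le> \<bar>Y n \<omega> - expectation (Y n)\<bar>}"
    proof safe
      fix \<omega> assume w: "\<omega> \<in> space M" "real (card {v \<in> {1..n}. \<omega> \<in> A v}) < (p - e) * real n"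
      have "Y n \<omega> = card {v \<in> {m..n}. \<omega> \<in> A v}"
        unfolding Y_def by (simp add: indicator_def sum.If_cases Int_def)
      also have "\<dots> \<le> card {v \<in> {1..n}. \<omega> \<in> A v}"
        by (intro of_nat_mono card_mono) (auto simp: m_def)
      finally have "Y n \<omega> < (p - e) * real n" using w(2) by linarith
      then have "Y n \<omega> - expectation (Y n) < - (e / 4 * real n)"
        using E by (simp add: algebra_simps)
      then show "e / 4 * real n \<le> \<bar>Y n \<omega> - expectation (Y n)\<bar>" by linarith
    qed
    moreover have rv: "random_variable borel (Y n)"
      unfolding Y_def using ev by measurable
    ultimately have "prob {\<omega> \<in> space M. real (card {v \<in> {1..n}. \<omega> \<in> A v}) < (p - e) * real n} \<le>
        prob {\<omega> \<in> space M. e / 4 * real n \<le> \<bar>Y n \<omega> - expectation (Y n)\<bar>}"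
      by (intro finite_measure_mono) auto
    also have "\<dots> \<le> variance (Y n) / (e / 4 * real n)\<^sup>2"
      using \<open>e > 0\<close> \<open>real n > 0\<close> rv
      by (intro Chebyshev_inequality) (auto simp: Ysq intro!: Bochner_Integration.integrable_sum i2)
    also have "variance (Y n) \<le> real (Suc n) * (2 * real (L n) + 1)"
      unfolding Y_def using ev indep L by (intro variance_local_events) (auto simp: m_def)
    finally show ?thesis by (simp add: divide_right_mono)
  qed
  have "(\<lambda>n. (1 + 1 / real n) * (2 * (real (L n) / real n) + 1 / real n) * (16 / e\<^sup>2)) \<longlonglongrightarrow>
      (1 + 0) * (2 * 0 + 0) * (16 / e\<^sup>2)"
    by (intro tendsto_intros L lim_1_over_n)
  then have "(\<lambda>n. (1 + 1 / real n) * (2 * (real (L n) / real n) + 1 / real n) * (16 / e\<^sup>2)) \<longlonglongrightarrow> 0"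
    by simp
  then have lim: "(\<lambda>n. real (Suc n) * (2 * real (L n) + 1) / (e / 4 * real n)\<^sup>2) \<longlonglongrightarrow> 0"
  proof (rule Lim_transform_eventually)
    show "\<forall>\<^sub>F n in sequentially. (1 + 1 / real n) * (2 * (real (L n) / real n) + 1 / real n) * (16 / e\<^sup>2) =
      real (Suc n) * (2 * real (L n) + 1) / (e / 4 * real n)\<^sup>2"
      using eventually_gt_at_top[of 0]
    proof eventually_elim
      case (elim n)
      then show ?case using \<open>e > 0\<close> by (simp add: field_simps power2_eq_square)
    qed
  qed 
  have "filterlim (\<lambda>n. e / 4 * real n) at_top sequentially"
    using \<open>e > 0\<close> by real_asymp
  then have "\<forall>\<^sub>F n in sequentially. real m * \<bar>p - e / 2\<bar> \<le> e / 4 * real n"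
    by (simp add: filterlim_at_top)
  then have "\<forall>\<^sub>F n in sequentially. prob {\<omega> \<in> space M. real (card {v \<in> {1..n}. \<omega> \<in> A v}) < (p - e) * real n} \<le>
      real (Suc n) * (2 * real (L n) + 1) / (e / 4 * real n)\<^sup>2"
    using eventually_ge_at_top[of m] by eventually_elim (rule bound)
  then show ?thesis
    by (rule tendsto_sandwich[OF _ _ tendsto_const lim, rotated]) auto
qed

section \<open>Depth-first exploration in a sliding window\<close>

text \<open>
  Depth-first exploration from a stack of vertices: \<open>ks\<close> must list the numbers of children met.
\<close>
fun explore :: "('a \<Rightarrow> 'a list) \<Rightarrow> 'a list \<Rightarrow> nat list \<Rightarrow> bool" where
  "explore ch [] [] = True"
| "explore ch (u # q) (k # ks) = (length (ch u) = k \<and> explore ch (ch u @ q) ks)"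
| "explore ch _ _ = False"

lemma explore_code: "explore ch (u # q) (code \<tau> @ ks) \<longleftrightarrow> shape ch u \<tau> \<and> explore ch q ks"
proof (induction \<tau> arbitrary: u q ks)
  case (PNode ts)
  have *: "explore ch (us @ q) (concat (map code ss) @ ks) \<longleftrightarrow>
      list_all2 (shape ch) us ss \<and> explore ch q ks"
    if "set ss \<subseteq> set ts" "length us = length ss" for us ss
    using that
  proof (induction ss arbitrary: us)
    case (Cons s ss)
    then obtain x xs where us: "us = x # xs" by (cases us) auto
    have "s \<in> set ts" using Cons.prems by simp
    then show ?case using Cons PNode.IH[of s x "xs @ q"] by (simp add: us)
  qed simp
  show ?case
    using *[of ts "ch u"] by (auto simp: list_all2_lengthD)
qed

text \<open>
  The possible courses of an exploration, recorded as the explored vertices with their child sets.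
  Children lie within distance \<open>w\<close> after their parent and outside the set \<open>U\<close> of vertices that are already
  discovered.  As the windows grow slowly, actual children may also be a little further
  away; a lower bound may omit such courses.
\<close>
fun traj :: "nat \<Rightarrow> nat set \<Rightarrow> nat list \<Rightarrow> nat list \<Rightarrow> (nat \<times> nat set) list set" where
  "traj w U [] [] = {[]}"
| "traj w U (u # q) (k # ks) =
     (\<Union>C\<in>{C. C \<subseteq> {u<..u + w} - U \<and> card C = k}.
        (#) (u, C) ` traj w (U \<union> C) (sorted_list_of_set C @ q) ks)"
| "traj w U _ _ = {}"

lemma finite_traj: "finite (traj w U q ks)"
  by (induction w U q ks rule: traj.induct)
    (auto intro!: finite_subset[of _ "Pow {_<.._}"])

text \<open>
  The courses of different explorations are mutually exclusive, because the child sets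
  determine the exploration.
\<close>
lemma traj_unique:
  assumes "\<rho> \<in> traj w U q ks" "\<rho>' \<in> traj w U q ks"
    and "\<And>u C. (u, C) \<in> set \<rho> \<Longrightarrow> ch u = C" "\<And>u C. (u, C) \<in> set \<rho>' \<Longrightarrow> ch u = C"
  shows "\<rho> = \<rho>'"
  using assms
proof (induction w U q ks arbitrary: \<rho> \<rho>' rule: traj.induct)
  case (2 w U u q k ks)
  obtain C \<sigma> where 1: "\<rho> = (u, C) # \<sigma>" "C \<subseteq> {u<..u + w} - U" "card C = k"
      "\<sigma> \<in> traj w (U \<union> C) (sorted_list_of_set C @ q) ks"
    using "2.prems"(1) by auto
  obtain C' \<sigma>' where 2: "\<rho>' = (u, C') # \<sigma>'"
      "\<sigma>' \<in> traj w (U \<union> C') (sorted_list_of_set C' @ q) ks"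
    using "2.prems"(2) by auto
  have "ch u = C" by (rule "2.prems"(3)) (simp add: 1)
  moreover have "ch u = C'" by (rule "2.prems"(4)) (simp add: 2)
  ultimately have C: "C' = C" by simp
  have "\<sigma> = \<sigma>'"
  proof (rule "2.IH")
    show "C \<in> {C. C \<subseteq> {u<..u + w} - U \<and> card C = k}" using 1 by simp
    show "\<sigma>' \<in> traj w (U \<union> C) (sorted_list_of_set C @ q) ks" using 2(2) C by simp
    show "ch v = D" if "(v, D) \<in> set \<sigma>" for v D
      by (rule "2.prems"(3)) (use that 1(1) in simp)
    show "ch v = D" if "(v, D) \<in> set \<sigma>'" for v D
      by (rule "2.prems"(4)) (use that 2(1) in simp)
  qed (rule 1(4))
  then show ?case using 1(1) 2(1) C by simp
qed auto

lemma traj_explore: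
  assumes "\<rho> \<in> traj w U q ks" "\<And>u C. (u, C) \<in> set \<rho> \<Longrightarrow> ch u = C"
  shows "explore (\<lambda>u. sorted_list_of_set (ch u)) q ks"
  using assms
proof (induction w U q ks arbitrary: \<rho> rule: traj.induct)
  case (2 w U u q k ks)
  obtain C \<sigma> where 1: "\<rho> = (u, C) # \<sigma>" "C \<subseteq> {u<..u + w} - U" "card C = k"
      "\<sigma> \<in> traj w (U \<union> C) (sorted_list_of_set C @ q) ks"
    using "2.prems"(1) by auto
  have "ch u = C" using "2.prems"(2) 1(1) by simp
  have "explore (\<lambda>u. sorted_list_of_set (ch u)) (sorted_list_of_set C @ q) ks"
  proof (rule "2.IH"[OF _ 1(4)])
    show "C \<in> {C. C \<subseteq> {u<..u + w} - U \<and> card C = k}" using 1 by simp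
    show "ch v = D" if "(v, D) \<in> set \<sigma>" for v D
      by (rule "2.prems"(2)) (use that 1(1) in simp)
  qed
  then show ?case using \<open>ch u = C\<close> 1(3) by simp
qed auto

lemma traj_props:
  assumes "\<rho> \<in> traj w U q ks" "set q \<subseteq> U" "distinct q"
  shows "length \<rho> = length ks \<and> map (\<lambda>(u, C). card C) \<rho> = ks \<and>
    distinct (map fst \<rho>) \<and> fst ` set \<rho> = set q \<union> \<Union>(snd ` set \<rho>) \<and>
    \<Union>(snd ` set \<rho>) \<inter> U = {} \<and>
    (\<forall>(u, C)\<in>set \<rho>. C \<subseteq> {u<..u + w}) \<and>
    (\<forall>(u, C)\<in>set \<rho>. \<forall>(u', C')\<in>set \<rho>. u \<noteq> u' \<longrightarrow> C \<inter> C' = {}) \<and>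
    (\<forall>lo hi. (\<forall>x\<in>set q. lo \<le> x \<and> x \<le> hi) \<longrightarrow>
       (\<forall>x\<in>fst ` set \<rho>. lo \<le> x \<and> x \<le> hi + w * length ks))"
  using assms
proof (induction w U q ks arbitrary: \<rho> rule: traj.induct)
  case (2 w U u q k ks)
  obtain C \<sigma> where 1: "\<rho> = (u, C) # \<sigma>" "C \<subseteq> {u<..u + w} - U" "card C = k"
      "\<sigma> \<in> traj w (U \<union> C) (sorted_list_of_set C @ q) ks"
    using "2.prems"(1) by auto
  have fin: "finite C" using 1(2) finite_subset by blast
  have sd: "set (sorted_list_of_set C @ q) \<subseteq> U \<union> C" "distinct (sorted_list_of_set C @ q)"
    using fin "2.prems" 1(2) by auto
  have "C \<in> {C. C \<subseteq> {u<..u + w} - U \<and> card C = k}" using 1 by simp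
  note I = "2.IH"[OF this 1(4) sd]
  have IH: "length \<sigma> = length ks" "map (\<lambda>(u, C). card C) \<sigma> = ks" "distinct (map fst \<sigma>)"
    "fst ` set \<sigma> = set (sorted_list_of_set C @ q) \<union> \<Union>(snd ` set \<sigma>)"
    "\<Union>(snd ` set \<sigma>) \<inter> (U \<union> C) = {}"
    "\<forall>(u, C)\<in>set \<sigma>. C \<subseteq> {u<..u + w}"
    "\<forall>(u, C)\<in>set \<sigma>. \<forall>(u', C')\<in>set \<sigma>. u \<noteq> u' \<longrightarrow> C \<inter> C' = {}"
    and IHb: "\<forall>lo hi. (\<forall>x\<in>set (sorted_list_of_set C @ q). lo \<le> x \<and> x \<le> hi) \<longrightarrow>
       (\<forall>x\<in>fst ` set \<sigma>. lo \<le> x \<and> x \<le> hi + w * length ks)"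
    using I by - (elim conjE, assumption)+
  have b: "\<forall>x\<in>fst ` set \<rho>. lo \<le> x \<and> x \<le> hi + w * length (k # ks)"
    if q: "\<forall>x\<in>set (u # q). lo \<le> x \<and> x \<le> hi" for lo hi
  proof -
    have "lo \<le> x \<and> x \<le> hi + w" if "x \<in> set (sorted_list_of_set C @ q)" for x
    proof (cases "x \<in> set q")
      case True
      then show ?thesis using q by (auto intro: trans_le_add1)
    next
      case False
      then have "x \<in> {u<..u + w}" using that fin 1(2) by auto
      moreover have "lo \<le> u" "u \<le> hi" using q by auto
      ultimately show ?thesis by auto
    qed
    then have "\<forall>x\<in>fst ` set \<sigma>. lo \<le> x \<and> x \<le> hi + w + w * length ks" using IHb by blast
    moreover have "lo \<le> u \<and> u \<le> hi" using q by auto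
    ultimately show ?thesis unfolding 1(1) by (auto simp: add.assoc intro: trans_le_add1)
  qed
  have fst\<sigma>: "fst ` set \<sigma> = C \<union> set q \<union> \<Union>(snd ` set \<sigma>)" using IH(4) fin by auto
  have "u \<in> U" using "2.prems"(2) by simp
  have "u \<notin> fst ` set \<sigma>"
    unfolding fst\<sigma> using IH(5) \<open>u \<in> U\<close> 1(2) "2.prems"(3) by auto
  have disj: "C' \<inter> C = {}" if "(u', C') \<in> set \<sigma>" for u' C'
    using IH(5) that by fastforce
  have "distinct (map fst \<rho>)" using IH(3) \<open>u \<notin> fst ` set \<sigma>\<close> by (simp add: 1(1))
  moreover have "fst ` set \<rho> = set (u # q) \<union> \<Union>(snd ` set \<rho>)"
    using fst\<sigma> by (auto simp: 1(1))
  moreover have "\<Union>(snd ` set \<rho>) \<inter> U = {}" using IH(5) 1(2) by (auto simp: 1(1))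
  moreover have "\<forall>(u, C)\<in>set \<rho>. C \<subseteq> {u<..u + w}" using IH(6) 1(1,2) by auto
  moreover have "\<forall>(u, C)\<in>set \<rho>. \<forall>(u', C')\<in>set \<rho>. u \<noteq> u' \<longrightarrow> C \<inter> C' = {}"
  proof safe
    fix a A b B x
    assume "(a, A) \<in> set \<rho>" "(b, B) \<in> set \<rho>" "a \<noteq> b" and x: "x \<in> A" "x \<in> B"
    then consider "(a, A) \<in> set \<sigma>" "(b, B) \<in> set \<sigma>" | "A = C" "(b, B) \<in> set \<sigma>"
      | "B = C" "(a, A) \<in> set \<sigma>" by (auto simp: 1(1))
    then have "A \<inter> B = {}"
    proof cases
      case 1
      then show ?thesis using IH(7) \<open>a \<noteq> b\<close> by blast
    qed (use disj in blast)+
    then show "x \<in> {}" using x by blast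
  qed
  moreover have "length \<rho> = length (k # ks)" "map (\<lambda>(u, C). card C) \<rho> = k # ks"
    using IH(1,2) 1 by simp_all
  ultimately show ?case using b by (intro conjI allI impI)
qed auto

text \<open>
  The list \<open>ks\<close> empties a stack of the given height exactly at its end.
\<close>
fun balanced :: "nat \<Rightarrow> nat list \<Rightarrow> bool" where
  "balanced 0 [] = True"
| "balanced (Suc l) (k # ks) = balanced (k + l) ks"
| "balanced _ _ = False"

lemma balanced_code: "balanced (Suc l) (code \<tau> @ ks) \<longleftrightarrow> balanced l ks"
proof (induction \<tau> arbitrary: l ks)
  case (PNode ts)
  have "balanced (length ss + l) (concat (map code ss) @ ks) \<longleftrightarrow> balanced l ks"
    if "set ss \<subseteq> set ts" for ss
    using that by (induction ss) (auto simp: PNode.IH)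
  then show ?case by simp
qed

lemma balanced_sum: "balanced l ks \<Longrightarrow> l + sum_list ks = length ks"
  by (induction l ks rule: balanced.induct) auto

text \<open>
  Of the \<open>w\<close> positions for children, at most \<open>K\<close> are occupied by vertices discovered before.
\<close>
lemma card_traj:
  assumes "balanced (length q) ks" "finite U" "card U + sum_list ks \<le> K"
  shows "(\<Prod>k\<leftarrow>ks. (w - K) choose k) \<le> card (traj w U q ks)"
  using assms
proof (induction w U q ks rule: traj.induct)
  case (2 w U u q k ks)
  let ?Cs = "{C. C \<subseteq> {u<..u + w} - U \<and> card C = k}"
  let ?T = "\<lambda>C. traj w (U \<union> C) (sorted_list_of_set C @ q) ks"
  have finC: "finite C" if "C \<in> ?Cs" for C using that finite_subset[of C "{u<..u + w}"] by auto
  have "(w - K) choose k \<le> card ({u<..u + w} - U) choose k"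
  proof (rule binomial_right_mono)
    have "w - card U \<le> card ({u<..u + w} - U)" using diff_card_le_card_Diff[of U "{u<..u + w}"] "2.prems" by simp
    then show "w - K \<le> card ({u<..u + w} - U)" using "2.prems" by auto
  qed
  also have "\<dots> = card ?Cs" by (rule n_subsets[symmetric]) simp
  finally have c: "(w - K) choose k \<le> card ?Cs" .
  have IH: "(\<Prod>k\<leftarrow>ks. (w - K) choose k) \<le> card (?T C)" if C: "C \<in> ?Cs" for C
  proof (rule "2.IH"[OF C])
    show "balanced (length (sorted_list_of_set C @ q)) ks" using C "2.prems" by simp
    show "finite (U \<union> C)" using finC[OF C] "2.prems" by simp
    show "card (U \<union> C) + sum_list ks \<le> K"
      using card_Un_le[of U C] C "2.prems" by simp
  qed
  have "(\<Prod>k\<leftarrow>k # ks. (w - K) choose k) \<le> (\<Sum>C\<in>?Cs. \<Prod>k\<leftarrow>ks. (w - K) choose k)"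
    using c by simp
  also have "\<dots> \<le> (\<Sum>C\<in>?Cs. card (?T C))" by (intro sum_mono IH)
  also have "\<dots> = (\<Sum>C\<in>?Cs. card ((#) (u, C) ` ?T C))"
    by (intro sum.cong refl card_image[symmetric]) (auto simp: inj_on_def)
  also have "\<dots> = card (\<Union>C\<in>?Cs. (#) (u, C) ` ?T C)"
    by (intro card_UN_disjoint[symmetric]) (auto simp: finite_traj intro!: finite_subset[of _ "Pow {u<..u + w}"])
  finally show ?case by simp
qed auto

text \<open>
  The choices of vertex \<open>m + 1\<close> that agree with the child sets recorded in \<open>\<rho>\<close>: only its parent if \<open>m + 1\<close>
  is a recorded child, and any unexplored vertex otherwise.
\<close>
definition allowed :: "(nat \<times> nat set) list \<Rightarrow> nat \<Rightarrow> nat set" where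
  "allowed \<rho> m = {x. \<forall>(u, C)\<in>set \<rho>. x = u \<longleftrightarrow> Suc m \<in> C}"

text \<open>
  It bounds the probability to miss \<open>a\<close> given vertices of a window below by the product of \<open>a\<close>
  equal factors, so that the factors of a vertex can be collected over its whole time in the window.
\<close>
lemma one_minus_power_le:
  fixes a N w :: nat
  assumes "a \<le> N" "N < w"
  shows "(1 - 1 / real (w - N)) ^ a \<le> 1 - real a / real w"
  using assms(1)
proof (induction a)
  case (Suc a)
  have "(1 - 1 / real (w - N)) ^ Suc a = (1 - 1 / real (w - N)) ^ a * (1 - 1 / real (w - N))"
    by simp
  also have "\<dots> \<le> (1 - real a / real w) * (1 - 1 / real (w - a))"
  proof (rule mult_mono)
    show "(1 - 1 / real (w - N)) ^ a \<le> 1 - real a / real w" using Suc by simp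
    show "1 - 1 / real (w - N) \<le> 1 - 1 / real (w - a)"
      using Suc assms by (intro diff_left_mono divide_left_mono) auto
    show "0 \<le> 1 - real a / real w" using Suc assms by simp
    show "0 \<le> 1 - 1 / real (w - N)" using assms by simp
  qed
  also have "\<dots> = 1 - real (Suc a) / real w"
    using Suc.prems assms by (simp add: field_simps of_nat_diff)
  finally show ?case .
qed simp

text \<open>
  Vertex \<open>m + 1\<close> chooses its parent \<open>V m\<close> uniformly among the last \<open>w m\<close> vertices.  The argument
  uses of the width that neither it nor the start of the window decreases, that it tends to infinity
  with order \<open>o(m)\<close>, and (\<open>w_slow\<close>) that it is asymptotically constant over the time in which a
  tree of fixed size grows.
\<close>
locale window_process = prob_space M for M :: "'w measure" +
  fixes V :: "nat \<Rightarrow> 'w \<Rightarrow> nat" and w :: "nat \<Rightarrow> nat"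
  assumes indep: "indep_vars (\<lambda>_. count_space UNIV) V {1..}"
    and dist: "m \<ge> 1 \<Longrightarrow> distr M (count_space UNIV) (V m) = measure_pmf (pmf_of_set {m + 1 - w m..m})"
    and w_pos: "m \<ge> 1 \<Longrightarrow> 1 \<le> w m" and w_le: "w m \<le> m"
    and mono_w: "mono w" and w_Suc: "w (Suc m) \<le> Suc (w m)"
    and w_top: "filterlim w at_top sequentially"
    and w_small: "(\<lambda>m. real (w m) / real m) \<longlonglongrightarrow> 0"
    and w_slow: "(\<lambda>m. real (w (m + c * w m)) / real (w m)) \<longlonglongrightarrow> 1"
begin

abbreviation win :: "nat \<Rightarrow> nat set" where "win m \<equiv> {m + 1 - w m..m}"

text \<open>The probability that the choice \<open>V m\<close> falls into \<open>B\<close>.\<close>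
definition \<kappa> :: "nat \<Rightarrow> nat set \<Rightarrow> real" where
  "\<kappa> m B = real (card (win m \<inter> B)) / real (w m)"

lemma V_measurable [measurable]: "m \<ge> 1 \<Longrightarrow> V m \<in> M \<rightarrow>\<^sub>M count_space UNIV"
  using indep by (auto simp: indep_vars_def)

lemma card_win: "card (win m) = w m"
  using w_le[of m] by simp

lemma prob_V: "m \<ge> 1 \<Longrightarrow> prob (V m -` B \<inter> space M) = \<kappa> m B"
proof -
  assume m: "m \<ge> 1"
  have "prob (V m -` B \<inter> space M) = measure (distr M (count_space UNIV) (V m)) B"
    using m by (simp add: measure_distr)
  also have "\<dots> = \<kappa> m B"
    using w_pos[OF m] card_win[of m] by (simp add: dist[OF m] \<kappa>_def measure_pmf_of_set)
  finally show ?thesis .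
qed

definition cyl :: "nat set \<Rightarrow> (nat \<Rightarrow> nat set) \<Rightarrow> 'w set" where
  "cyl J B = {\<omega> \<in> space M. \<forall>m\<in>J. V m \<omega> \<in> B m}"

lemma cyl_INT: "J \<noteq> {} \<Longrightarrow> cyl J B = (\<Inter>m\<in>J. V m -` B m \<inter> space M)"
  by (auto simp: cyl_def)

lemma cyl_event: "finite J \<Longrightarrow> J \<subseteq> {1..} \<Longrightarrow> cyl J B \<in> events"
  unfolding cyl_def by (intro sets.sets_Collect_finite_All) auto

lemma prob_cyl: "finite J \<Longrightarrow> J \<subseteq> {1..} \<Longrightarrow> prob (cyl J B) = (\<Prod>m\<in>J. \<kappa> m (B m))"
proof (cases "J = {}")
  case True
  then show ?thesis by (simp add: cyl_def prob_space)
next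
  case False
  assume J: "finite J" "J \<subseteq> {1..}"
  have "prob (cyl J B) = (\<Prod>m\<in>J. prob (V m -` B m \<inter> space M))"
    unfolding cyl_INT[OF False] using indep False J by (intro indep_varsD) auto
  also have "\<dots> = (\<Prod>m\<in>J. \<kappa> m (B m))" using J by (intro prod.cong refl prob_V) auto
  finally show ?thesis .
qed

definition block_event :: "nat set \<Rightarrow> 'b set \<Rightarrow> ('b \<Rightarrow> nat \<Rightarrow> nat set) \<Rightarrow> 'w set" where
  "block_event J R B = (\<Union>\<rho>\<in>R. cyl J (B \<rho>))"

lemma block_event_event: "finite R \<Longrightarrow> finite J \<Longrightarrow> J \<subseteq> {1..} \<Longrightarrow> block_event J R B \<in> events"
  unfolding block_event_def by (intro sets.finite_UN cyl_event)

lemma prob_block_event: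
  assumes "finite R" "finite J" "J \<subseteq> {1..}" "disjoint_family_on (\<lambda>\<rho>. cyl J (B \<rho>)) R"
  shows "prob (block_event J R B) = (\<Sum>\<rho>\<in>R. \<Prod>m\<in>J. \<kappa> m (B \<rho> m))"
  unfolding block_event_def using assms
  by (subst finite_measure_finite_Union) (auto simp: prob_cyl cyl_event)

text \<open>
  Expanding both unions reduces the claim to two cylinders, whose joint probability is a product over
  the steps of both blocks.
\<close>
lemma prob_block_event_Int:
  assumes "finite R" "finite J" "J \<subseteq> {1..}" "disjoint_family_on (\<lambda>\<rho>. cyl J (B \<rho>)) R"
    and "finite R'" "finite J'" "J' \<subseteq> {1..}" "disjoint_family_on (\<lambda>\<rho>. cyl J' (B' \<rho>)) R'"
    and "J \<inter> J' = {}"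
  shows "prob (block_event J R B \<inter> block_event J' R' B') =
    prob (block_event J R B) * prob (block_event J' R' B')"
proof -
  define D where "D = (\<lambda>(\<rho>, \<rho>') m. if m \<in> J then B \<rho> m else B' \<rho>' m)"
  have cyl: "cyl (J \<union> J') (D (\<rho>, \<rho>')) = cyl J (B \<rho>) \<inter> cyl J' (B' \<rho>')" for \<rho> \<rho>'
    using assms(9) by (auto simp: cyl_def D_def)
  have "block_event J R B \<inter> block_event J' R' B' = block_event (J \<union> J') (R \<times> R') D"
    unfolding block_event_def by (auto simp: cyl split: prod.splits)
  moreover have "disjoint_family_on (\<lambda>\<rho>. cyl (J \<union> J') (D \<rho>)) (R \<times> R')"
    using assms(4,8) unfolding disjoint_family_on_def by (auto simp: cyl) blast+
  ultimately have "prob (block_event J R B \<inter> block_event J' R' B') =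
      (\<Sum>(\<rho>, \<rho>')\<in>R \<times> R'. \<Prod>m\<in>J \<union> J'. \<kappa> m (D (\<rho>, \<rho>') m))"
    using assms by (simp add: prob_block_event split_def)
  also have "\<dots> = (\<Sum>(\<rho>, \<rho>')\<in>R \<times> R'. (\<Prod>m\<in>J. \<kappa> m (B \<rho> m)) * (\<Prod>m\<in>J'. \<kappa> m (B' \<rho>' m)))"
  proof (rule sum.cong, simp, clarify)
    fix \<rho> \<rho>'
    have "(\<Prod>m\<in>J'. \<kappa> m (D (\<rho>, \<rho>') m)) = (\<Prod>m\<in>J'. \<kappa> m (B' \<rho>' m))"
      using assms(9) by (intro prod.cong) (auto simp: D_def)
    moreover have "(\<Prod>m\<in>J. \<kappa> m (D (\<rho>, \<rho>') m)) = (\<Prod>m\<in>J. \<kappa> m (B \<rho> m))"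
      by (intro prod.cong) (auto simp: D_def)
    ultimately show "(\<Prod>m\<in>J \<union> J'. \<kappa> m (D (\<rho>, \<rho>') m)) =
        (\<Prod>m\<in>J. \<kappa> m (B \<rho> m)) * (\<Prod>m\<in>J'. \<kappa> m (B' \<rho>' m))"
      using assms by (simp add: prod.union_disjoint)
  qed
  also have "\<dots> = prob (block_event J R B) * prob (block_event J' R' B')"
    using assms by (simp add: prob_block_event sum_product sum.cartesian_product)
  finally show ?thesis .
qed

text \<open>
  Long enough that all vertices of the tree, whose labels are at most \<open>v + w v * length (code \<tau>)\<close>,
  have left the window at its end, even if the width doubles meanwhile.
\<close>
definition block_length :: "ptree \<Rightarrow> nat \<Rightarrow> nat" where
  "block_length \<tau> v = 2 * (length (code \<tau>) + 1) * w v"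

abbreviation block :: "ptree \<Rightarrow> nat \<Rightarrow> nat set" where
  "block \<tau> v \<equiv> {v..<v + block_length \<tau> v}"

definition tree_trajs :: "ptree \<Rightarrow> nat \<Rightarrow> (nat \<times> nat set) list set" where
  "tree_trajs \<tau> v = traj (w v) {v} [v] (code \<tau>)"

definition tree_event :: "ptree \<Rightarrow> nat \<Rightarrow> 'w set" where
  "tree_event \<tau> v = block_event (block \<tau> v) (tree_trajs \<tau> v) allowed"

lemma tree_trajs_bounds:
  assumes "\<rho> \<in> tree_trajs \<tau> v" "(u, C) \<in> set \<rho>"
  shows "v \<le> u" "u \<le> v + w v * length (code \<tau>)" "C \<subseteq> {u<..u + w v}"
proof -
  have "\<forall>lo hi. (\<forall>x\<in>set [v]. lo \<le> x \<and> x \<le> hi) \<longrightarrow>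
       (\<forall>x\<in>fst ` set \<rho>. lo \<le> x \<and> x \<le> hi + w v * length (code \<tau>))"
    "\<forall>(u, C)\<in>set \<rho>. C \<subseteq> {u<..u + w v}"
  proof -
    have "set [v] \<subseteq> {v}" "distinct [v]" by auto
    note P = traj_props[OF assms(1)[unfolded tree_trajs_def] this]
    show "\<forall>lo hi. (\<forall>x\<in>set [v]. lo \<le> x \<and> x \<le> hi) \<longrightarrow>
       (\<forall>x\<in>fst ` set \<rho>. lo \<le> x \<and> x \<le> hi + w v * length (code \<tau>))"
      "\<forall>(u, C)\<in>set \<rho>. C \<subseteq> {u<..u + w v}"
      using P by - (elim conjE, assumption)+
  qed
  then show "v \<le> u" "u \<le> v + w v * length (code \<tau>)" "C \<subseteq> {u<..u + w v}"
    using assms(2) by force+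
qed

lemma cyl_children:
  assumes "\<rho> \<in> tree_trajs \<tau> v" "(u, C) \<in> set \<rho>"
    and \<omega>: "\<omega> \<in> cyl (block \<tau> v) (allowed \<rho>)"
  shows "Suc ` {m \<in> block \<tau> v. V m \<omega> = u} = C"
proof -
  have iff: "V m \<omega> = u \<longleftrightarrow> Suc m \<in> C" if "m \<in> block \<tau> v" for m
    using \<omega> that assms(2) by (auto simp: cyl_def allowed_def)
  have "\<exists>m. x = Suc m \<and> m \<in> block \<tau> v" if "x \<in> C" for x
  proof -
    have x: "u < x" "x \<le> u + w v" using that tree_trajs_bounds(3)[OF assms(1,2)] by auto
    moreover have "u + w v \<le> v + block_length \<tau> v"
      using tree_trajs_bounds(2)[OF assms(1,2)] by (simp add: block_length_def algebra_simps)
    ultimately show ?thesis using tree_trajs_bounds(1)[OF assms(1,2)]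
      by (intro exI[of _ "x - 1"]) auto
  qed
  then show ?thesis using iff by fastforce
qed

lemma disjoint_tree_trajs:
  "disjoint_family_on (\<lambda>\<rho>. cyl (block \<tau> v) (allowed \<rho>)) (tree_trajs \<tau> v)"
  unfolding disjoint_family_on_def
proof (intro ballI impI, rule ccontr)
  fix \<rho> \<rho>'
  let ?J = "block \<tau> v"
  assume r: "\<rho> \<in> tree_trajs \<tau> v" "\<rho>' \<in> tree_trajs \<tau> v" "\<rho> \<noteq> \<rho>'"
    and "cyl ?J (allowed \<rho>) \<inter> cyl ?J (allowed \<rho>') \<noteq> {}"
  then obtain \<omega> where w: "\<omega> \<in> cyl ?J (allowed \<rho>)" "\<omega> \<in> cyl ?J (allowed \<rho>')" by blast
  have "\<rho> = \<rho>'"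
    by (rule traj_unique[OF r(1,2)[unfolded tree_trajs_def], of "\<lambda>u. Suc ` {m \<in> ?J. V m \<omega> = u}"])
       (use cyl_children[OF r(1) _ w(1)] cyl_children[OF r(2) _ w(2)] in blast)+
  with r(3) show False by contradiction
qed

lemma tree_event_event: "v \<ge> 1 \<Longrightarrow> tree_event \<tau> v \<in> events"
  unfolding tree_event_def by (rule block_event_event) (auto simp: tree_trajs_def finite_traj)

lemma prob_tree_event_Int:
  assumes "v \<ge> 1" "v + block_length \<tau> v \<le> u"
  shows "prob (tree_event \<tau> v \<inter> tree_event \<tau> u) = prob (tree_event \<tau> v) * prob (tree_event \<tau> u)"
  unfolding tree_event_def using assms
  by (intro prob_block_event_Int disjoint_tree_trajs) (auto simp: tree_trajs_def finite_traj)

text \<open>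
  The choices of the recorded children cost a factor of at least \<open>1 / w'\<close> each.  Each of the
  \<open>N\<close> explored vertices must be missed by the other choices during its time in the
  window, which is at most \<open>w'\<close> steps;
  this costs at most a factor \<open>(1 - 1/(w - N))\<^sup>w\<^sup>'\<close>, which tends to \<open>e\<^sup>-\<^sup>1\<close>.
\<close>
lemma prob_traj_ge:
  fixes \<tau> v
  defines "N \<equiv> length (code \<tau>)" and "w' \<equiv> w (v + block_length \<tau> v)"
  assumes v: "v \<ge> 1" and N: "N < w v" and \<rho>: "\<rho> \<in> tree_trajs \<tau> v"
  shows "(1 / real w') ^ sum_list (code \<tau>) * (1 - 1 / real (w v - N)) ^ (N * w') \<le>
    (\<Prod>m\<in>block \<tau> v. \<kappa> m (allowed \<rho> m))"
proof -
  let ?J = "block \<tau> v"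
  define S where "S = fst ` set \<rho>"
  define U where "U = \<Union>(snd ` set \<rho>)"
  define D where "D = {m \<in> ?J. Suc m \<in> U}"
  define q where "q = 1 - 1 / real (w v - N)"
  define a where "a m = card (win m \<inter> S)" for m
  have q: "0 \<le> q" "q \<le> 1" using N by (auto simp: q_def)
  have props: "length \<rho> = N" "map (\<lambda>(u, C). card C) \<rho> = code \<tau>" "distinct (map fst \<rho>)"
      "\<forall>(u, C)\<in>set \<rho>. \<forall>(u', C')\<in>set \<rho>. u \<noteq> u' \<longrightarrow> C \<inter> C' = {}"
    using traj_props[of \<rho> "w v" "{v}" "[v]" "code \<tau>"] \<rho> by (auto simp: tree_trajs_def N_def)
  have cS: "card S \<le> N" unfolding S_def using props(1) card_image_le[of "set \<rho>" fst] card_length[of \<rho>] by simp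
  have finS: "finite S" by (simp add: S_def)
  have wm: "w v \<le> w m" "w m \<le> w'" if "m \<in> ?J" for m
    using that mono_w by (auto simp: w'_def mono_def)
  have w'1: "1 \<le> w'" using w_pos[of v] v mono_w by (auto simp: w'_def mono_def intro: le_trans)
  have each: "(if m \<in> D then 1 / real w' else 1) * q ^ a m \<le> \<kappa> m (allowed \<rho> m)" if m: "m \<in> ?J" for m
  proof (cases "m \<in> D")
    case True
    then obtain u C where uC: "(u, C) \<in> set \<rho>" "Suc m \<in> C" by (auto simp: D_def U_def)
    have "allowed \<rho> m = {u}"
    proof -
      have "Suc m \<notin> C'" if "(u', C') \<in> set \<rho>" "u' \<noteq> u" for u' C'
        using props(4) uC that by fastforce
      moreover have "C' = C" if "(u, C') \<in> set \<rho>" for C'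
        using props(3) uC(1) that by (metis eq_key_imp_eq_value)
      ultimately have "u = u' \<longleftrightarrow> Suc m \<in> C'" if "(u', C') \<in> set \<rho>" for u' C'
        using that uC(2) by metis
      then have "u \<in> allowed \<rho> m" unfolding allowed_def by blast
      moreover have "x = u" if "x \<in> allowed \<rho> m" for x
        using that uC unfolding allowed_def by blast
      ultimately show ?thesis by blast
    qed
    moreover have "u < Suc m" "Suc m \<le> u + w v"
      using tree_trajs_bounds(3)[OF \<rho> uC(1)] uC(2) by auto
    then have "u \<in> win m" using wm(1)[OF m] by auto
    ultimately have "\<kappa> m (allowed \<rho> m) = 1 / real (w m)" by (simp add: \<kappa>_def)
    moreover have "1 / real w' \<le> 1 / real (w m)"
      using wm[OF m] N by (intro divide_left_mono) auto
    moreover have "1 / real w' * q ^ a m \<le> 1 / real w'"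
      using q by (intro mult_left_le power_le_one) auto
    ultimately show ?thesis using True by simp
  next
    case False
    then have "allowed \<rho> m = - S"
      using m by (force simp: allowed_def D_def U_def S_def)
    then have "card (win m \<inter> allowed \<rho> m) = w m - a m"
      using card_Diff_subset_Int[of "win m" S] finS card_win[of m]
      by (simp add: a_def Diff_eq del: card_atLeastAtMost)
    moreover have aw: "a m \<le> w m" unfolding a_def using card_mono[of "win m" "win m \<inter> S"] card_win[of m] by auto
    ultimately have "\<kappa> m (allowed \<rho> m) = 1 - real (a m) / real (w m)"
      using wm[OF m] N by (simp add: \<kappa>_def of_nat_diff diff_divide_distrib)
    moreover have "a m \<le> N" unfolding a_def using card_mono[OF finS, of "win m \<inter> S"] cS by auto
    then have "q ^ a m \<le> 1 - real (a m) / real (w v)"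
      unfolding q_def using N by (rule one_minus_power_le)
    moreover have "real (a m) / real (w m) \<le> real (a m) / real (w v)"
      using wm[OF m] N by (intro divide_left_mono) auto
    ultimately show ?thesis using False by simp
  qed
  have "card D \<le> sum_list (code \<tau>)"
  proof -
    have "card D = card (Suc ` D)" by (simp add: card_image)
    also have "\<dots> \<le> card (\<Union>p\<in>set \<rho>. snd p)"
    proof (rule card_mono)
      show "finite (\<Union>p\<in>set \<rho>. snd p)"
      proof (intro finite_UN_I)
        fix p assume "p \<in> set \<rho>"
        then have "snd p \<subseteq> {fst p<..fst p + w v}" using tree_trajs_bounds(3)[OF \<rho>] by simp
        then show "finite (snd p)" by (rule finite_subset) simp
      qed simp
    qed (auto simp: D_def U_def)
    also have "\<dots> \<le> (\<Sum>p\<in>set \<rho>. card (snd p))" by (rule card_UN_le) simp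
    also have "\<dots> = sum_list (map (\<lambda>p. card (snd p)) \<rho>)"
      using props(3) by (simp add: sum_list_distinct_conv_sum_set distinct_map)
    also have "\<dots> = sum_list (code \<tau>)" using props(2) by (simp add: split_def)
    finally show ?thesis .
  qed
  then have D: "(1 / real w') ^ sum_list (code \<tau>) \<le> (1 / real w') ^ card D"
    using w'1 by (intro power_decreasing) auto
  \<comment> \<open>Double counting of the pairs of a step and an explored vertex in its window.\<close>
  have "(\<Sum>m\<in>?J. a m) = (\<Sum>m\<in>?J. \<Sum>u\<in>S. if u \<in> win m then 1 else 0)"
    unfolding a_def using finS by (simp add: sum.If_cases Int_commute Int_def del: atLeastAtMost_iff)
  also have "\<dots> = (\<Sum>u\<in>S. card {m \<in> ?J. u \<in> win m})"
    by (subst sum.swap) (simp add: sum.If_cases Int_def del: atLeastAtMost_iff)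
  also have "\<dots> \<le> (\<Sum>u\<in>S. w')"
  proof (rule sum_mono)
    fix u
    have "{m \<in> ?J. u \<in> win m} \<subseteq> {u..<u + w'}"
      using wm(2) by fastforce
    then have "card {m \<in> ?J. u \<in> win m} \<le> card {u..<u + w'}" by (rule card_mono[rotated]) simp
    then show "card {m \<in> ?J. u \<in> win m} \<le> w'" by simp
  qed
  also have "\<dots> \<le> N * w'" using cS by simp
  finally have A: "q ^ (N * w') \<le> q ^ (\<Sum>m\<in>?J. a m)" using q by (intro power_decreasing)
  have "(1 / real w') ^ sum_list (code \<tau>) * q ^ (N * w') \<le> (1 / real w') ^ card D * q ^ (\<Sum>m\<in>?J. a m)"
    using D A q by (intro mult_mono) auto
  also have "\<dots> = (\<Prod>m\<in>?J. (if m \<in> D then 1 / real w' else 1) * q ^ a m)"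
  proof -
    have "(\<Prod>m\<in>?J. if m \<in> D then 1 / real w' else 1) = (1 / real w') ^ card D"
    proof -
      have "?J \<inter> {m. m \<in> D} = D" by (auto simp: D_def)
      then show ?thesis by (simp add: prod.If_cases)
    qed
    then show ?thesis by (simp add: prod.distrib power_sum)
  qed
  also have "\<dots> \<le> (\<Prod>m\<in>?J. \<kappa> m (allowed \<rho> m))"
    using each q by (intro prod_mono) auto
  finally show ?thesis by (simp add: q_def)
qed

lemma prob_tree_event_ge:
  fixes \<tau> v
  defines "N \<equiv> length (code \<tau>)" and "w' \<equiv> w (v + block_length \<tau> v)"
  assumes v: "v \<ge> 1" and N: "N < w v"
  shows "(\<Prod>k\<leftarrow>code \<tau>. real ((w v - N) choose k) / real w' ^ k) * ((1 - 1 / real (w v - N)) ^ w') ^ N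
    \<le> prob (tree_event \<tau> v)"
proof -
  let ?J = "block \<tau> v"
  let ?b = "(1 / real w') ^ sum_list (code \<tau>) * (1 - 1 / real (w v - N)) ^ (N * w')"
  have b: "balanced 1 (code \<tau>)" using balanced_code[of 0 \<tau> "[]"] by simp
  have "(\<Prod>k\<leftarrow>ks. real ((w v - N) choose k) / real w' ^ k) =
      real (\<Prod>k\<leftarrow>ks. (w v - N) choose k) * (1 / real w') ^ sum_list ks" for ks
    by (induction ks) (auto simp: power_add field_simps)
  then have "(\<Prod>k\<leftarrow>code \<tau>. real ((w v - N) choose k) / real w' ^ k) * ((1 - 1 / real (w v - N)) ^ w') ^ N =
      real (\<Prod>k\<leftarrow>code \<tau>. (w v - N) choose k) * ?b"
    by (simp add: power_mult mult.commute[of N])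
  also have "\<dots> \<le> real (card (tree_trajs \<tau> v)) * ?b"
  proof (intro mult_right_mono of_nat_mono)
    show "(\<Prod>k\<leftarrow>code \<tau>. (w v - N) choose k) \<le> card (tree_trajs \<tau> v)"
      unfolding tree_trajs_def using b balanced_sum[OF b]
      by (intro card_traj) (auto simp: N_def)
    show "0 \<le> ?b" using N by (intro mult_nonneg_nonneg zero_le_power) auto
  qed
  also have "\<dots> = (\<Sum>\<rho>\<in>tree_trajs \<tau> v. ?b)" by simp
  also have "\<dots> \<le> (\<Sum>\<rho>\<in>tree_trajs \<tau> v. \<Prod>m\<in>?J. \<kappa> m (allowed \<rho> m))"
    using v N unfolding N_def w'_def by (intro sum_mono prob_traj_ge) auto
  also have "\<dots> = prob (tree_event \<tau> v)"
    unfolding tree_event_def using v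
    by (intro prob_block_event[symmetric] disjoint_tree_trajs) (auto simp: tree_trajs_def finite_traj)
  finally show ?thesis .
qed

lemma tendsto_prod_list:
  fixes f :: "'b \<Rightarrow> 'c \<Rightarrow> real"
  assumes "\<And>k. k \<in> set ks \<Longrightarrow> ((\<lambda>v. f k v) \<longlongrightarrow> g k) F"
  shows "((\<lambda>v. \<Prod>k\<leftarrow>ks. f k v) \<longlongrightarrow> (\<Prod>k\<leftarrow>ks. g k)) F"
  using assms by (induction ks) (auto intro!: tendsto_intros)

text \<open>
  Up to factors tending to \<open>1\<close>, the number \<open>\<Prod>\<^sub>k w\<^sup>k / k!\<close> of courses times the probability
  \<open>w\<^sup>1\<^sup>-\<^sup>N e\<^sup>-\<^sup>N\<close> of each is the weight of the plane tree, since the \<open>k\<close> have sum \<open>N - 1\<close>.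
\<close>
lemma prob_tree_event_limit:
  assumes "e > 0"
  shows "\<forall>\<^sub>F v in sequentially. prob (tree_event \<tau> v) \<ge> pweight \<tau> - e"
proof -
  define N where "N = length (code \<tau>)"
  define w' where "w' v = w (v + block_length \<tau> v)" for v
  have ww: "(\<lambda>v. real (w' v) / real (w v)) \<longlonglongrightarrow> 1"
    unfolding w'_def block_length_def by (rule w_slow)
  have wtop: "filterlim (\<lambda>v. real (w v)) at_top sequentially"
    by (rule filterlim_compose[OF filterlim_real_sequentially w_top])
  have large: "\<forall>\<^sub>F v in sequentially. c < w v" for c
    using w_top[unfolded filterlim_at_top, rule_format, of "Suc c"] by (simp add: Suc_le_eq)
  have ww': "(\<lambda>v. real (w v) / real (w' v)) \<longlonglongrightarrow> 1"
    using tendsto_inverse[OF ww] by (simp add: inverse_eq_divide)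
  have w'0: "(\<lambda>v. c / real (w' v)) \<longlonglongrightarrow> 0" for c
  proof -
    have "(\<lambda>v. c / real (w v) * (real (w v) / real (w' v))) \<longlonglongrightarrow> 0 * 1"
      by (intro tendsto_mult ww' tendsto_divide_0[OF tendsto_const] filterlim_at_top_imp_at_infinity wtop)
    moreover have "\<forall>\<^sub>F v in sequentially. c / real (w v) * (real (w v) / real (w' v)) = c / real (w' v)"
      using large[of 0] by eventually_elim simp
    ultimately show ?thesis by (auto intro: Lim_transform_eventually)
  qed
  have 1: "(\<lambda>v. real ((w v - N) choose k) / real (w' v) ^ k) \<longlonglongrightarrow> 1 / fact k" for k
  proof -
    have "(\<lambda>v. (\<Prod>i=0..<k. real (w v) / real (w' v) - (real N + real i) / real (w' v)) / fact k) \<longlonglongrightarrow>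
        (\<Prod>i=0..<k. 1 - 0) / fact k"
      by (intro tendsto_intros ww' w'0) auto
    moreover have "\<forall>\<^sub>F v in sequentially.
        (\<Prod>i=0..<k. real (w v) / real (w' v) - (real N + real i) / real (w' v)) / fact k =
        real ((w v - N) choose k) / real (w' v) ^ k"
      using large[of N]
    proof eventually_elim
      case (elim v)
      have "real ((w v - N) choose k) = (\<Prod>i=0..<k. real (w v) - (real N + real i)) / fact k"
        using elim by (simp add: binomial_gbinomial gbinomial_prod_rev of_nat_diff algebra_simps)
      moreover have "(\<Prod>i=0..<k. real (w v) / real (w' v) - (real N + real i) / real (w' v)) =
          (\<Prod>i=0..<k. (real (w v) - (real N + real i)) / real (w' v))"
        by (simp add: diff_divide_distrib)
      ultimately show ?case by (simp add: prod_dividef)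
    qed
    ultimately show ?thesis by (simp add: tendsto_cong)
  qed
  have 2: "(\<lambda>v. (1 - 1 / real (w v - N)) ^ w' v) \<longlonglongrightarrow> exp (-1)"
  proof -
    define x where "x v = real (w v) - real N" for v
    have xtop: "filterlim x at_top sequentially"
      unfolding x_def using filterlim_tendsto_add_at_top[OF tendsto_const[of "- real N"] wtop]
      by simp
    have "((\<lambda>x::real. x * ln (1 - 1 / x)) \<longlongrightarrow> -1) at_top" by real_asymp
    then have l: "(\<lambda>v. x v * ln (1 - 1 / x v)) \<longlonglongrightarrow> -1"
      by (rule filterlim_compose) (rule xtop)
    have "(\<lambda>v. real N / real (w v)) \<longlonglongrightarrow> 0"
      by (intro tendsto_divide_0[OF tendsto_const] filterlim_at_top_imp_at_infinity wtop)
    then have "(\<lambda>v. real (w' v) / real (w v) / (1 - real N / real (w v))) \<longlonglongrightarrow> 1 / (1 - 0)"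
      by (intro tendsto_intros ww) auto
    then have "(\<lambda>v. real (w' v) / real (w v) / (1 - real N / real (w v))) \<longlonglongrightarrow> 1"
      unfolding diff_zero div_by_1 .
    moreover have "\<forall>\<^sub>F v in sequentially.
        real (w' v) / real (w v) / (1 - real N / real (w v)) = real (w' v) / x v"
      using large[of N]
    proof eventually_elim
      case (elim v)
      then have "1 - real N / real (w v) = x v / real (w v)" by (simp add: x_def field_simps)
      then show ?case using elim by simp
    qed
    ultimately have "(\<lambda>v. real (w' v) / x v) \<longlonglongrightarrow> 1" by (rule Lim_transform_eventually)
    then have "(\<lambda>v. exp (real (w' v) / x v * (x v * ln (1 - 1 / x v)))) \<longlonglongrightarrow> exp (1 * -1)"
      by (intro tendsto_intros l)
    moreover have "\<forall>\<^sub>F v in sequentially. exp (real (w' v) / x v * (x v * ln (1 - 1 / x v))) =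
        (1 - 1 / real (w v - N)) ^ w' v"
      using large[of "Suc N"]
    proof eventually_elim
      case (elim v)
      then have "x v = real (w v - N)" "x v > 1" by (auto simp: x_def of_nat_diff)
      then show ?case by (simp add: exp_of_nat_mult)
    qed
    ultimately show ?thesis by (simp add: tendsto_cong)
  qed
  have "(\<lambda>v. (\<Prod>k\<leftarrow>code \<tau>. real ((w v - N) choose k) / real (w' v) ^ k) *
      ((1 - 1 / real (w v - N)) ^ w' v) ^ N) \<longlonglongrightarrow> (\<Prod>k\<leftarrow>code \<tau>. 1 / fact k) * exp (-1) ^ N"
    by (intro tendsto_intros tendsto_prod_list 1 2)
  also have "(\<Prod>k\<leftarrow>code \<tau>. 1 / fact k) * exp (-1) ^ N = pweight \<tau>"
  proof -
    have "(\<Prod>k\<leftarrow>ks. 1 / fact k) * exp (-1) ^ length ks = (\<Prod>k\<leftarrow>ks. exp (-1) / fact k :: real)" for ks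
      by (induction ks) (simp_all add: field_simps)
    then show ?thesis by (simp add: N_def pweight_def)
  qed
  finally have "\<forall>\<^sub>F v in sequentially. pweight \<tau> - e <
      (\<Prod>k\<leftarrow>code \<tau>. real ((w v - N) choose k) / real (w' v) ^ k) * ((1 - 1 / real (w v - N)) ^ w' v) ^ N"
    using \<open>e > 0\<close> by (intro order_tendstoD(1)) auto
  then show ?thesis
    using large[of N] eventually_ge_at_top[of 1]
  proof eventually_elim
    case (elim v)
    then show ?case using prob_tree_event_ge[of v \<tau>] by (simp add: N_def w'_def)
  qed
qed

lemma block_length_small: "(\<lambda>n. real (block_length \<tau> n) / real n) \<longlonglongrightarrow> 0"
proof -
  have "(\<lambda>n. real (2 * (length (code \<tau>) + 1)) * (real (w n) / real n)) \<longlonglongrightarrow>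
      real (2 * (length (code \<tau>) + 1)) * 0" by (intro tendsto_intros w_small)
  then show ?thesis unfolding block_length_def of_nat_mult times_divide_eq_right mult_zero_right .
qed

lemma tree_event_frequency:
  assumes "e > 0"
  shows "(\<lambda>n. prob {\<omega> \<in> space M. real (card {v \<in> {1..n}. \<omega> \<in> tree_event \<tau> v}) <
    (pweight \<tau> - e) * real n}) \<longlonglongrightarrow> 0"
proof -
  define A where "A v = (if v = 0 then {} else tree_event \<tau> v)" for v
  have "(\<lambda>n. prob {\<omega> \<in> space M. real (card {v \<in> {1..n}. \<omega> \<in> A v}) < (pweight \<tau> - e) * real n}) \<longlonglongrightarrow> 0"
  proof (rule local_events_lower_bound[where n\<^sub>0 = 1 and L = "block_length \<tau>"])
    show "A v \<in> events" for v by (simp add: A_def tree_event_event)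
    show "prob (A v \<inter> A u) = prob (A v) * prob (A u)" if "1 \<le> v" "v + block_length \<tau> v \<le> u" for v u
      using that prob_tree_event_Int by (simp add: A_def)
    show "mono (block_length \<tau>)" using mono_w unfolding block_length_def mono_def by (blast intro: mult_le_mono2)
    show "(\<lambda>n. real (block_length \<tau> n) / real n) \<longlonglongrightarrow> 0" by (rule block_length_small)
    show "\<forall>\<^sub>F v in sequentially. pweight \<tau> - e \<le> prob (A v)" if "e > 0" for e
      using prob_tree_event_limit[OF that, of \<tau>] eventually_ge_at_top[of 1]
      by eventually_elim (simp add: A_def)
  qed (rule assms)
  moreover have "{v \<in> {1..n}. \<omega> \<in> A v} = {v \<in> {1..n}. \<omega> \<in> tree_event \<tau> v}" for n \<omega>
    by (auto simp: A_def)
  ultimately show ?thesis by simp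
qed

end

section \<open>Events with probability tending to one\<close>

text \<open>
  The inner events \<open>B n\<close> make the notion closed under implication without regard to measurability,
  which enters only when a probability is read off (\<open>whpD\<close>).
\<close>
definition (in prob_space) whp :: "(nat \<Rightarrow> 'a \<Rightarrow> bool) \<Rightarrow> bool" where
  "whp P \<longleftrightarrow> (\<exists>B. (\<forall>n. B n \<in> events) \<and> (\<lambda>n. prob (B n)) \<longlonglongrightarrow> 1 \<and> (\<forall>n. \<forall>\<omega>\<in>B n. P n \<omega>))"

context prob_space
begin

lemma whp_mono:
  assumes "whp P" and "\<forall>\<^sub>F n in sequentially. \<forall>\<omega>\<in>space M. P n \<omega> \<longrightarrow> Q n \<omega>"
  shows "whp Q"
proof -
  obtain B where B: "\<And>n. B n \<in> events" "(\<lambda>n. prob (B n)) \<longlonglongrightarrow> 1" "\<And>n \<omega>. \<omega> \<in> B n \<Longrightarrow> P n \<omega>"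
    using assms(1) by (auto simp: whp_def)
  obtain n0 where n0: "\<And>n \<omega>. n \<ge> n0 \<Longrightarrow> \<omega> \<in> space M \<Longrightarrow> P n \<omega> \<Longrightarrow> Q n \<omega>"
    using assms(2) by (auto simp: eventually_sequentially)
  let ?B = "\<lambda>n. if n \<ge> n0 then B n else {}"
  have "\<forall>\<^sub>F n in sequentially. prob (B n) = prob (?B n)"
    using eventually_ge_at_top[of n0] by eventually_elim simp
  then have "(\<lambda>n. prob (?B n)) \<longlonglongrightarrow> 1" by (rule Lim_transform_eventually[OF B(2)])
  moreover have "Q n \<omega>" if "\<omega> \<in> ?B n" for n \<omega>
    using that n0 B(1,3) sets.sets_into_space by (fastforce split: if_splits)
  ultimately show ?thesis using B(1) unfolding whp_def by (intro exI[of _ ?B]) auto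
qed

lemma whp_conj:
  assumes "whp P" "whp Q"
  shows "whp (\<lambda>n \<omega>. P n \<omega> \<and> Q n \<omega>)"
proof -
  obtain A where A: "\<And>n. A n \<in> events" "(\<lambda>n. prob (A n)) \<longlonglongrightarrow> 1" "\<And>n \<omega>. \<omega> \<in> A n \<Longrightarrow> P n \<omega>"
    using assms(1) by (auto simp: whp_def)
  obtain B where B: "\<And>n. B n \<in> events" "(\<lambda>n. prob (B n)) \<longlonglongrightarrow> 1" "\<And>n \<omega>. \<omega> \<in> B n \<Longrightarrow> Q n \<omega>"
    using assms(2) by (auto simp: whp_def)
  have "(\<lambda>n. prob (A n) + prob (B n) - 1) \<longlonglongrightarrow> 1 + 1 - 1" by (intro tendsto_intros A B)
  then have lim: "(\<lambda>n. prob (A n) + prob (B n) - 1) \<longlonglongrightarrow> 1" by simp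
  have "(\<lambda>n. prob (A n \<inter> B n)) \<longlonglongrightarrow> 1"
  proof (rule tendsto_sandwich[OF _ _ lim tendsto_const])
    have "prob (A n) + prob (B n) - 1 \<le> prob (A n \<inter> B n)" for n
    proof -
      have "prob (A n \<union> B n) = prob (A n) + prob (B n) - prob (A n \<inter> B n)"
        using A(1) B(1) by (intro measure_Un3) (auto simp: fmeasurable_eq_sets)
      then show ?thesis using prob_le_1[of "A n \<union> B n"] by linarith
    qed
    then show "\<forall>\<^sub>F n in sequentially. prob (A n) + prob (B n) - 1 \<le> prob (A n \<inter> B n)" by simp
  qed simp
  then show ?thesis unfolding whp_def using A B by (intro exI[of _ "\<lambda>n. A n \<inter> B n"]) auto
qed

lemma whp_AE: "AE \<omega> in M. P \<omega> \<Longrightarrow> whp (\<lambda>n. P)"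
proof -
  assume "AE \<omega> in M. P \<omega>"
  then obtain N where N: "{\<omega> \<in> space M. \<not> P \<omega>} \<subseteq> N" "N \<in> events" "prob N = 0"
    by (auto elim!: AE_E simp: emeasure_eq_measure)
  have "prob (space M - N) = 1" using N by (simp add: prob_compl)
  then show ?thesis unfolding whp_def using N by (intro exI[of _ "\<lambda>_. space M - N"]) auto
qed

lemma whp_ball:
  assumes "finite F" "\<And>x. x \<in> F \<Longrightarrow> whp (P x)"
  shows "whp (\<lambda>n \<omega>. \<forall>x\<in>F. P x n \<omega>)"
  using assms
proof (induction F rule: finite_induct)
  case empty
  show ?case using whp_AE[of "\<lambda>_. True"] by simp
next
  case (insert x F)
  then show ?case using whp_conj[of "P x" "\<lambda>n \<omega>. \<forall>x\<in>F. P x n \<omega>"] by simp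
qed

lemma whpI:
  assumes "(\<lambda>n. prob {\<omega> \<in> space M. \<not> P n \<omega>}) \<longlonglongrightarrow> 0" "\<And>n. {\<omega> \<in> space M. \<not> P n \<omega>} \<in> events"
  shows "whp P"
proof -
  let ?B = "\<lambda>n. space M - {\<omega> \<in> space M. \<not> P n \<omega>}"
  have "(\<lambda>n. 1 - prob {\<omega> \<in> space M. \<not> P n \<omega>}) \<longlonglongrightarrow> 1 - 0"
    by (intro tendsto_intros assms)
  then have "(\<lambda>n. prob (?B n)) \<longlonglongrightarrow> 1" using assms(2) by (simp add: prob_compl)
  then show ?thesis unfolding whp_def using assms(2) by (intro exI[of _ ?B]) auto
qed

lemma whpD:
  assumes "whp P" and "\<forall>\<^sub>F n in sequentially. {\<omega> \<in> space M. P n \<omega>} \<in> events"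
  shows "(\<lambda>n. prob {\<omega> \<in> space M. P n \<omega>}) \<longlonglongrightarrow> 1"
proof -
  obtain B where B: "\<And>n. B n \<in> events" "(\<lambda>n. prob (B n)) \<longlonglongrightarrow> 1" "\<And>n \<omega>. \<omega> \<in> B n \<Longrightarrow> P n \<omega>"
    using assms(1) by (auto simp: whp_def)
  show ?thesis
  proof (rule tendsto_sandwich[OF _ _ B(2) tendsto_const])
    show "\<forall>\<^sub>F n in sequentially. prob (B n) \<le> prob {\<omega> \<in> space M. P n \<omega>}"
      using assms(2)
    proof eventually_elim
      case (elim n)
      then show ?case using B(1,3) sets.sets_into_space
        by (intro finite_measure_mono) blast+
    qed
  qed simp
qed

end

section \<open>The topology on tuples of trees is discrete\<close>

lemma trunc_trunc: "trunc r (trunc r t) = trunc r t"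
  by (induction r arbitrary: t) (auto simp: multiset.map_comp intro!: image_mset_cong)

text \<open>
  Every branch of \<open>s\<close> is itself a truncation, hence fixed by truncation, and the induction hypothesis\napplies to the branches of \<open>t\<close>.  The radius \<open>r + 1\<close> shows that \<open>t\<close> is not higher than \<open>s\<close>; radius \<open>r\<close>\nwould not.
\<close>
lemma trunc_isolated: "trunc r s = s \<Longrightarrow> trunc (Suc r) t = s \<Longrightarrow> t = s"
proof (induction r arbitrary: s t)
  case 0
  then show ?case by (cases t) auto
next
  case (Suc r)
  obtain M where M: "s = Node M" by (cases s)
  have M1: "image_mset (trunc r) M = M" using Suc.prems(1) M by simp
  have M2: "image_mset (trunc (Suc r)) (children t) = M" using Suc.prems(2) M by simp
  have "trunc (Suc r) c = c" if c: "c \<in># children t" for c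
  proof -
    have "trunc (Suc r) c \<in># M" using M2 c by (metis image_eqI set_image_mset)
    then obtain x where "trunc (Suc r) c = trunc r x" using M1 by (metis imageE set_image_mset)
    then have "trunc r (trunc (Suc r) c) = trunc (Suc r) c" using trunc_trunc by metis
    then show ?thesis using Suc.IH by metis
  qed
  then have "image_mset (trunc (Suc r)) (children t) = image_mset (\<lambda>c. c) (children t)"
    by (intro image_mset_cong) auto
  then show ?case using M M2 by (cases t) simp
qed

lemma tball_isolated: "tball s r = s \<Longrightarrow> tball t (Suc r) = s \<Longrightarrow> t = s"
  by (cases s; cases t) (auto simp: tball_def simp del: trunc.simps dest: trunc_isolated)

lemma tuple_topology_discrete: "openin (tuple_topology k) U \<longleftrightarrow> U \<subseteq> tuples k"
proof -
  interpret Metric_space "tuples k" "tuple_dist k" by (rule Metric_space_tuple_dist)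
  have "\<exists>r>0. mball xs r \<subseteq> {xs}" if xs: "xs \<in> tuples k" for xs
  proof -
    obtain N where N: "\<And>t r. r \<ge> N t \<Longrightarrow> tball t r = t" using tball_large by metis
    define R where "R = Suc (\<Sum>i\<le>k. N (xs ! i))"
    have R: "tball (xs ! i) r = xs ! i" if "i \<le> k" "r \<ge> R - 1" for i r
    proof (rule N)
      have "N (xs ! i) \<le> (\<Sum>i\<le>k. N (xs ! i))" using that(1) by (intro member_le_sum) auto
      then show "N (xs ! i) \<le> r" using that(2) by (simp add: R_def)
    qed
    let ?r = "(1/2) ^ k / (1 + real R)"
    have "ys = xs" if ys: "ys \<in> mball xs ?r" for ys
    proof -
      have y: "ys \<in> tuples k" "tuple_dist k xs ys < ?r" using ys by auto
      have "ys ! i = xs ! i" if i: "i \<le> k" for i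
      proof -
        have "(1/2) ^ i * tree_dist (xs ! i) (ys ! i) \<le> tuple_dist k xs ys"
          unfolding tuple_dist_def using i by (intro member_le_sum) auto
        also have "\<dots> \<le> ?r" using y by simp
        also have "\<dots> \<le> (1/2) ^ i * (1 / (1 + real R))"
          using i by (simp add: divide_right_mono power_decreasing)
        finally have "tree_dist (xs ! i) (ys ! i) \<le> 1 / (1 + real R)"
          by (rule mult_left_le_imp_le) simp
        then have "tball (xs ! i) R = tball (ys ! i) R"
          unfolding tree_dist_le_iff by (auto simp: R_def)
        then show ?thesis using R[OF i, of R] R[OF i, of "R - 1"] tball_isolated[of "xs ! i" "R - 1" "ys ! i"]
          by (simp add: R_def)
      qed
      then show ?thesis using y(1) xs by (intro nth_equalityI) (auto simp: tuples_def less_Suc_eq_le)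
    qed
    then show ?thesis by (intro exI[of _ ?r]) auto
  qed
  then show ?thesis unfolding tuple_topology_def openin_mtopology by blast
qed

lemma topspace_tuple_topology [simp]: "topspace (tuple_topology k) = tuples k"
  unfolding tuple_topology_def
  by (rule Metric_space.topspace_mtopology[OF Metric_space_tuple_dist])

lemma sets_borel_tuple [simp]: "sets (borel_sigma (tuple_topology k)) = Pow (tuples k)"
  unfolding borel_sigma_def tuple_topology_discrete topspace_tuple_topology Pow_def[symmetric]
  by (rule sigma_algebra.sets_measure_of_eq[OF sigma_algebra_Pow])

lemma space_borel_tuple [simp]: "space (borel_sigma (tuple_topology k)) = tuples k"
  by (simp add: borel_sigma_def space_measure_of_conv)

section \<open>Integrals against laws on a countable set\<close>

lemma space_eq_if_sets_Pow: "sets N = Pow \<Omega> \<Longrightarrow> space N = \<Omega>"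
  by (metis PowD Pow_top sets.sets_into_space sets.top subset_antisym)

text \<open>
  For \<open>g = f + B \<ge> 0\<close>, the integral over \<open>F\<close> under \<open>P\<close> is almost as large as under \<open>Q\<close>, and
  outside \<open>F\<close> the measure \<open>Q\<close> has almost no mass.
\<close>
lemma integral_discrete_lower:
  fixes f :: "'a \<Rightarrow> real"
  assumes P: "prob_space P" "sets P = Pow \<Omega>" and Q: "prob_space Q" "sets Q = Pow \<Omega>"
    and B: "\<And>x. x \<in> \<Omega> \<Longrightarrow> \<bar>f x\<bar> \<le> B"
    and F: "finite F" "F \<subseteq> \<Omega>" "measure Q F \<ge> 1 - d"
    and PQ: "\<And>x. x \<in> F \<Longrightarrow> measure P {x} \<ge> measure Q {x} - d / real (Suc (card F))"
    and "d \<ge> 0"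
  shows "(\<integral>x. f x \<partial>P) \<ge> (\<integral>x. f x \<partial>Q) - 4 * B * d"
proof -
  interpret P: prob_space P by fact
  interpret Q: prob_space Q by fact
  have sp: "space P = \<Omega>" "space Q = \<Omega>"
    using P(2) Q(2) by (simp_all add: space_eq_if_sets_Pow)
  have meas: "g \<in> borel_measurable P" "g \<in> borel_measurable Q" for g :: "'a \<Rightarrow> real"
    using P(2) Q(2) sp by (auto simp: measurable_def)
  define g where "g x = f x + B" for x
  have g: "0 \<le> g x" "g x \<le> 2 * B" if "x \<in> \<Omega>" for x using B[OF that] by (auto simp: g_def)
  have "\<Omega> \<noteq> {}" using P.not_empty sp by simp
  then have "B \<ge> 0" using B by (meson abs_ge_zero all_not_in_conv order_trans)
  have int: "integrable P h" "integrable Q h" if "\<And>x. x \<in> \<Omega> \<Longrightarrow> \<bar>h x\<bar> \<le> 2 * B" for h :: "'a \<Rightarrow> real"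
    using that meas sp by (auto intro!: P.integrable_const_bound[where B="2 * B"] Q.integrable_const_bound[where B="2 * B"])
  have fin: "(\<integral>x. g x * indicator F x \<partial>P) = (\<Sum>x\<in>F. g x * measure P {x})"
    "(\<integral>x. g x * indicator F x \<partial>Q) = (\<Sum>x\<in>F. g x * measure Q {x})"
    using F P(2) Q(2) by (auto intro!: integral_indicator_finite_real simp: P.emeasure_eq_measure Q.emeasure_eq_measure)
  have "(\<integral>x. g x \<partial>Q) \<le> (\<integral>x. g x * indicator F x + 2 * B * indicator (\<Omega> - F) x \<partial>Q)"
    using g \<open>B \<ge> 0\<close> by (intro integral_mono int Bochner_Integration.integrable_add)
      (auto simp: indicator_def sp)
  also have "\<dots> = (\<integral>x. g x * indicator F x \<partial>Q) + 2 * B * measure Q (\<Omega> - F)"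
  proof -
    have i: "integrable Q (\<lambda>x. g x * indicator F x)" "integrable Q (\<lambda>x. 2 * B * indicator (\<Omega> - F) x)"
      using g \<open>B \<ge> 0\<close> by (intro int; auto simp: indicator_def)+
    have "(\<integral>x. 2 * B * indicator (\<Omega> - F) x \<partial>Q) = 2 * B * measure Q ((\<Omega> - F) \<inter> space Q)"
      by (subst integral_mult_right_zero) simp
    moreover have "(\<Omega> - F) \<inter> space Q = \<Omega> - F" using sp by auto
    ultimately show ?thesis using Bochner_Integration.integral_add[OF i] by simp
  qed
  also have "measure Q (\<Omega> - F) = 1 - measure Q F"
    using Q.prob_compl[of F] F Q(2) sp by simp
  also have "(\<integral>x. g x * indicator F x \<partial>Q) + 2 * B * (1 - measure Q F) \<le> (\<integral>x. g x * indicator F x \<partial>Q) + 2 * B * d"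
    using F(3) \<open>B \<ge> 0\<close> by (intro add_left_mono mult_left_mono) auto
  also have "(\<integral>x. g x * indicator F x \<partial>Q) \<le> (\<Sum>x\<in>F. g x * measure P {x} + 2 * B * (d / real (Suc (card F))))"
    unfolding fin
  proof (rule sum_mono)
    fix x assume x: "x \<in> F"
    then have gx: "0 \<le> g x" "g x \<le> 2 * B" using F g by auto
    have "g x * measure Q {x} \<le> g x * (measure P {x} + d / real (Suc (card F)))"
      using PQ[OF x] gx by (intro mult_left_mono) auto
    also have "\<dots> \<le> g x * measure P {x} + 2 * B * (d / real (Suc (card F)))"
      unfolding distrib_left using gx \<open>d \<ge> 0\<close> by (intro add_left_mono mult_right_mono) auto
    finally show "g x * measure Q {x} \<le> g x * measure P {x} + 2 * B * (d / real (Suc (card F)))" .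
  qed
  also have "\<dots> = (\<integral>x. g x * indicator F x \<partial>P) + real (card F) * (2 * B * (d / real (Suc (card F))))"
    by (simp add: sum.distrib fin)
  also have "real (card F) * (2 * B * (d / real (Suc (card F)))) \<le> 2 * B * d"
  proof -
    have "real (card F) / real (Suc (card F)) * (2 * B * d) \<le> 1 * (2 * B * d)"
      using \<open>B \<ge> 0\<close> \<open>d \<ge> 0\<close> by (intro mult_right_mono) (auto simp: divide_le_eq_1)
    then show ?thesis by (simp add: mult_ac)
  qed
  also have "(\<integral>x. g x * indicator F x \<partial>P) \<le> (\<integral>x. g x \<partial>P)"
    using g \<open>B \<ge> 0\<close> by (intro integral_mono int) (auto simp: indicator_def sp)
  finally have "(\<integral>x. g x \<partial>Q) \<le> (\<integral>x. g x \<partial>P) + 2 * B * d + 2 * B * d" by simp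
  moreover have "\<bar>f x\<bar> \<le> 2 * B" if "x \<in> \<Omega>" for x using B[OF that] \<open>B \<ge> 0\<close> by simp
  then have "(\<integral>x. g x \<partial>P) = (\<integral>x. f x \<partial>P) + B" "(\<integral>x. g x \<partial>Q) = (\<integral>x. f x \<partial>Q) + B"
    unfolding g_def by (simp_all add: int P.prob_space Q.prob_space)
  ultimately show ?thesis by simp
qed

text \<open>The upper bound is the lower bound for \<open>- f\<close>.\<close>
lemma integral_discrete_close:
  fixes f :: "'a \<Rightarrow> real"
  assumes "prob_space P" "sets P = Pow \<Omega>" "prob_space Q" "sets Q = Pow \<Omega>"
    and B: "\<And>x. x \<in> \<Omega> \<Longrightarrow> \<bar>f x\<bar> \<le> B"
    and "finite F" "F \<subseteq> \<Omega>" "measure Q F \<ge> 1 - d"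
    and "\<And>x. x \<in> F \<Longrightarrow> measure P {x} \<ge> measure Q {x} - d / real (Suc (card F))"
    and "d \<ge> 0"
  shows "\<bar>(\<integral>x. f x \<partial>P) - (\<integral>x. f x \<partial>Q)\<bar> \<le> 4 * B * d"
proof -
  have "(\<integral>x. f x \<partial>P) \<ge> (\<integral>x. f x \<partial>Q) - 4 * B * d"
    by (rule integral_discrete_lower) fact+
  moreover have "(\<integral>x. - f x \<partial>P) \<ge> (\<integral>x. - f x \<partial>Q) - 4 * B * d"
    by (rule integral_discrete_lower[where \<Omega>=\<Omega> and F=F]) (use assms in auto)
  ultimately show ?thesis by simp
qed

lemma tight_countable:
  assumes "prob_space Q" "sets Q = Pow \<Omega>" and "d > 0"
  obtains F :: "'a::countable set" where "finite F" "F \<subseteq> \<Omega>" "measure Q F \<ge> 1 - d"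
proof -
  interpret Q: prob_space Q by fact
  have sp: "space Q = \<Omega>"
    using assms(2) by (rule space_eq_if_sets_Pow)
  let ?A = "\<lambda>n. {x \<in> \<Omega>. to_nat x < n}"
  have "(\<lambda>n. measure Q (?A n)) \<longlonglongrightarrow> measure Q (\<Union>n. ?A n)"
    using assms(2) by (intro Q.finite_Lim_measure_incseq) (auto simp: incseq_def)
  also have "(\<Union>n. ?A n) = \<Omega>" by auto
  also have "measure Q \<Omega> = 1" using Q.prob_space sp by simp
  finally have "\<forall>\<^sub>F n in sequentially. 1 - d < measure Q (?A n)"
    using \<open>d > 0\<close> by (intro order_tendstoD(1)) auto
  then obtain n where "1 - d < measure Q (?A n)" by (auto simp: eventually_sequentially)
  moreover have "finite (?A n)" by (rule finite_imageD[of to_nat]) (auto intro: finite_subset[of _ "{..<n}"] inj_on_subset[OF inj_to_nat])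
  ultimately show ?thesis by (intro that[of "?A n"]) auto
qed

section \<open>Frequencies in the recursive tree\<close>

locale window_trees = window_process M V w for M :: "'w measure" and V w +
  fixes T :: "nat \<Rightarrow> 'w \<Rightarrow> nat rgraph"
  assumes T_1: "\<omega> \<in> space M \<Longrightarrow> T 1 \<omega> = \<lparr>vertices = {1}, edges = {}, rt = 1\<rparr>"
    and T_Suc: "n \<ge> 1 \<Longrightarrow> \<omega> \<in> space M \<Longrightarrow> T (Suc n) \<omega> = attach (T n \<omega>) (Suc n) (V n \<omega>)"
begin

abbreviation par :: "'w \<Rightarrow> nat \<Rightarrow> nat" where
  "par \<omega> u \<equiv> V (u - 1) \<omega>"

abbreviation kidlist :: "nat \<Rightarrow> 'w \<Rightarrow> nat \<Rightarrow> nat list" where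
  "kidlist n \<omega> u \<equiv> sorted_list_of_set (childset {1..n} 1 (par \<omega>) u)"

abbreviation with_shape :: "nat \<Rightarrow> 'w \<Rightarrow> ptree \<Rightarrow> nat set" where
  "with_shape n \<omega> \<tau> \<equiv> {v \<in> {1..n}. shape (kidlist n \<omega>) v \<tau>}"

abbreviation with_fringe :: "nat \<Rightarrow> 'w \<Rightarrow> rtree \<Rightarrow> nat set" where
  "with_fringe n \<omega> t \<equiv> {u \<in> {1..n}. tree_class (kidlist n \<omega>) u = t}"

text \<open>
  Outside a null event, the values of all \<open>V m\<close> lie in the support of their law, and the parent map
  is well-founded.
\<close>
definition in_windows :: "'w \<Rightarrow> bool" where
  "in_windows \<omega> \<longleftrightarrow> \<omega> \<in> space M \<and> (\<forall>m\<ge>1. V m \<omega> \<in> win m)"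

lemma AE_in_windows: "AE \<omega> in M. in_windows \<omega>"
proof -
  have "AE \<omega> in M. V m \<omega> \<in> win m" if m: "m \<ge> 1" for m
  proof (rule AE_I_eq_1)
    have eq: "{\<omega> \<in> space M. V m \<omega> \<in> win m} = V m -` win m \<inter> space M" by auto
    show "{\<omega> \<in> space M. V m \<omega> \<in> win m} \<in> events"
      unfolding eq using m by (intro measurable_sets[OF V_measurable]) auto
    show "emeasure M {\<omega> \<in> space M. V m \<omega> \<in> win m} = 1"
      unfolding eq emeasure_eq_measure using prob_V[OF m, of "win m"] card_win[of m] w_pos[OF m]
      by (simp add: \<kappa>_def del: card_atLeastAtMost)
  qed
  then have "AE \<omega> in M. \<forall>m\<in>{1..}. V m \<omega> \<in> win m" by (intro AE_ball_countable') auto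
  then show ?thesis unfolding in_windows_def using AE_space by eventually_elim auto
qed

lemma T_eq: "n \<ge> 1 \<Longrightarrow> \<omega> \<in> space M \<Longrightarrow> T n \<omega> = parent_graph {1..n} 1 (par \<omega>)"
proof (induction n rule: nat_induct_at_least)
  case base
  then have "T 1 \<omega> = \<lparr>vertices = {1}, edges = {}, rt = 1\<rparr>" by (rule T_1)
  moreover have "{{w, par \<omega> w} | w. w \<in> {1..1} \<and> w \<noteq> 1} = {}" by auto
  ultimately show ?case by (simp add: parent_graph_def)
next
  case (Suc n)
  have "{1..Suc n} = insert (Suc n) {1..n}" by auto
  moreover have "{{u, par \<omega> u} | u. u \<in> {1..Suc n} \<and> u \<noteq> 1} =
      insert {Suc n, V n \<omega>} {{u, par \<omega> u} | u. u \<in> {1..n} \<and> u \<noteq> 1}"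
    using Suc.hyps by (auto simp: le_Suc_eq)
  ultimately show ?case using Suc by (simp add: T_Suc attach_def parent_graph_def)
qed

lemma vertices_T: "n \<ge> 1 \<Longrightarrow> \<omega> \<in> space M \<Longrightarrow> vertices (T n \<omega>) = {1..n}"
  by (simp add: T_eq parent_graph_def)

lemma V_range: "in_windows \<omega> \<Longrightarrow> m \<ge> 1 \<Longrightarrow> 1 \<le> V m \<omega> \<and> V m \<omega> \<le> m"
  using w_le[of m] unfolding in_windows_def by (fastforce dest!: spec[of _ m])

lemma tree_T: "in_windows \<omega> \<Longrightarrow> n \<ge> 1 \<Longrightarrow> finite_ordered_tree {1..n} 1 (par \<omega>) id (kidlist n \<omega>)"
proof
  assume g: "in_windows \<omega>" "n \<ge> 1"
  show "1 \<in> {1..n}" using g by simp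
  fix u :: nat
  show "par \<omega> u \<in> {1..n}" if "u \<in> {1..n}" "u \<noteq> 1"
    using that V_range[OF g(1), of "u - 1"] unfolding atLeastAtMost_iff by linarith
  show "id (par \<omega> u) < id u" if "u \<in> {1..n}" "u \<noteq> 1"
    using that V_range[OF g(1), of "u - 1"] unfolding atLeastAtMost_iff id_apply by linarith
qed (auto simp: childset_def)

lemma window_start_mono: "m \<le> m' \<Longrightarrow> m + 1 - w m \<le> m' + 1 - w m'"
proof (induction m' rule: dec_induct)
  case (step i)
  then show ?case using w_Suc[of i] by linarith
qed simp

text \<open>
  The tree event speaks of the choices in a block only.  Earlier choices are of smaller vertices, and
  after the block the explored vertices have left the window, so the recorded child sets are the
  final ones.
\<close>
lemma tree_event_shape:
  assumes g: "in_windows \<omega>" and e: "\<omega> \<in> tree_event \<tau> v" and v: "v \<ge> 1"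
    and n: "v + block_length \<tau> v \<le> n" and w2: "w (v + block_length \<tau> v) \<le> 2 * w v"
  shows "shape (kidlist n \<omega>) v \<tau>"
proof -
  let ?J = "block \<tau> v"
  obtain \<rho> where \<rho>: "\<rho> \<in> tree_trajs \<tau> v" "\<omega> \<in> cyl ?J (allowed \<rho>)"
    using e by (auto simp: tree_event_def block_event_def)
  have kids: "childset {1..n} 1 (par \<omega>) u = C" if uC: "(u, C) \<in> set \<rho>" for u C
  proof -
    note b = tree_trajs_bounds[OF \<rho>(1) uC]
    have "m \<in> ?J" if m: "V m \<omega> = u" "m \<ge> 1" for m
    proof -
      have "u \<le> m" "m + 1 - w m \<le> u" using m g by (auto simp: in_windows_def)
      moreover have "m < v + block_length \<tau> v"
      proof (rule ccontr)
        assume "\<not> m < v + block_length \<tau> v"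
        then have "v + block_length \<tau> v + 1 - w (v + block_length \<tau> v) \<le> m + 1 - w m"
          by (intro window_start_mono) simp
        then have "v + block_length \<tau> v + 1 \<le> v + w v * length (code \<tau>) + 2 * w v"
          using b(2) w2 \<open>m + 1 - w m \<le> u\<close> by linarith
        then show False by (simp add: block_length_def algebra_simps)
      qed
      ultimately show ?thesis using b(1) by simp
    qed
    then have "childset {1..n} 1 (par \<omega>) u = Suc ` {m \<in> ?J. V m \<omega> = u}"
    proof (intro equalityI subsetI)
      fix c assume c: "c \<in> childset {1..n} 1 (par \<omega>) u"
      assume *: "\<And>m. V m \<omega> = u \<Longrightarrow> m \<ge> 1 \<Longrightarrow> m \<in> ?J"
      have "c = Suc (c - 1)" "V (c - 1) \<omega> = u" "c - 1 \<ge> 1" using c by (auto simp: childset_def)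
      then show "c \<in> Suc ` {m \<in> ?J. V m \<omega> = u}" using *[of "c - 1"] by (intro image_eqI[of _ _ "c - 1"]) auto
    next
      fix c assume "c \<in> Suc ` {m \<in> ?J. V m \<omega> = u}"
      then show "c \<in> childset {1..n} 1 (par \<omega>) u" using v n by (auto simp: childset_def)
    qed
    then show ?thesis using cyl_children[OF \<rho>(1) uC \<rho>(2)] by simp
  qed
  have "explore (kidlist n \<omega>) [v] (code \<tau>)"
    by (rule traj_explore[OF \<rho>(1)[unfolded tree_trajs_def] kids])
  then show ?thesis using explore_code[of "kidlist n \<omega>" v "[]" \<tau> "[]"] by simp
qed

lemma whp_tree_event:
  "e > 0 \<Longrightarrow> whp (\<lambda>n \<omega>. (pweight \<tau> - e) * real n \<le> real (card {v \<in> {1..n}. \<omega> \<in> tree_event \<tau> v}))"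
proof (rule whpI)
  assume "e > 0"
  then show "(\<lambda>n. prob {\<omega> \<in> space M. \<not> (pweight \<tau> - e) * real n \<le>
      real (card {v \<in> {1..n}. \<omega> \<in> tree_event \<tau> v})}) \<longlonglongrightarrow> 0"
    using tree_event_frequency[of e \<tau>] by (simp add: not_le)
  fix n
  have "real (card {v \<in> {1..n}. \<omega> \<in> tree_event \<tau> v}) = (\<Sum>v\<in>{1..n}. indicator (tree_event \<tau> v) \<omega>)" for \<omega>
    by (simp add: indicator_def sum.If_cases Int_def)
  moreover have "(\<lambda>\<omega>. \<Sum>v\<in>{1..n}. indicator (tree_event \<tau> v) \<omega> :: real) \<in> borel_measurable M"
    by (intro borel_measurable_sum borel_measurable_indicator tree_event_event) auto
  ultimately show "{\<omega> \<in> space M. \<not> (pweight \<tau> - e) * real n \<le>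
      real (card {v \<in> {1..n}. \<omega> \<in> tree_event \<tau> v})} \<in> events"
    by simp
qed

text \<open>
  The event of \<open>v\<close> fixes the shape at \<open>v\<close> in \<open>T n\<close> unless \<open>v\<close> is bounded or its block reaches beyond
  \<open>n\<close>; these exceptions are \<open>o(n)\<close> in number.
\<close>
lemma whp_shape:
  assumes "e > 0"
  shows "whp (\<lambda>n \<omega>. in_windows \<omega> \<and>
    (pweight \<tau> - e) * real n \<le> real (card (with_shape n \<omega> \<tau>)))"
proof (rule whp_mono)
  show "whp (\<lambda>n \<omega>. in_windows \<omega> \<and> (pweight \<tau> - e / 2) * real n \<le> real (card {v \<in> {1..n}. \<omega> \<in> tree_event \<tau> v}))"
    using assms by (intro whp_conj whp_AE AE_in_windows whp_tree_event) auto
  have "\<forall>\<^sub>F v in sequentially. w (v + block_length \<tau> v) \<le> 2 * w v"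
  proof -
    have "\<forall>\<^sub>F v in sequentially. real (w (v + block_length \<tau> v)) / real (w v) < 2"
      unfolding block_length_def by (intro order_tendstoD(2)[OF w_slow]) simp
    then show ?thesis using eventually_ge_at_top[of 1]
    proof eventually_elim
      case (elim v)
      then show ?case using w_pos[of v] by (simp add: field_simps)
    qed
  qed
  then obtain v0 where v0: "\<And>v. v \<ge> v0 \<Longrightarrow> w (v + block_length \<tau> v) \<le> 2 * w v"
    by (auto simp: eventually_sequentially)
  have "(\<lambda>n. real (v0 + 1) / real n + real (block_length \<tau> n) / real n) \<longlonglongrightarrow> 0 + 0"
    by (intro tendsto_add block_length_small lim_const_over_n)
  then have "\<forall>\<^sub>F n in sequentially. real (v0 + 1) / real n + real (block_length \<tau> n) / real n < e / 2"
    using assms by (intro order_tendstoD(2)[of _ "0 + 0"]) auto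
  then show "\<forall>\<^sub>F n in sequentially. \<forall>\<omega>\<in>space M.
      in_windows \<omega> \<and> (pweight \<tau> - e / 2) * real n \<le> real (card {v \<in> {1..n}. \<omega> \<in> tree_event \<tau> v}) \<longrightarrow>
      in_windows \<omega> \<and> (pweight \<tau> - e) * real n \<le> real (card (with_shape n \<omega> \<tau>))"
    using eventually_ge_at_top[of 1]
  proof (eventually_elim, intro ballI impI conjI; (elim conjE)?)
    fix n \<omega>
    assume n: "real (v0 + 1) / real n + real (block_length \<tau> n) / real n < e / 2" "1 \<le> n"
      and g: "in_windows \<omega>" and c: "(pweight \<tau> - e / 2) * real n \<le> real (card {v \<in> {1..n}. \<omega> \<in> tree_event \<tau> v})"
    let ?A = "{v \<in> {1..n}. \<omega> \<in> tree_event \<tau> v}" and ?S = "with_shape n \<omega> \<tau>"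
    have "?A \<subseteq> ?S \<union> {..v0} \<union> {n - block_length \<tau> n<..n}"
    proof
      fix v assume v: "v \<in> ?A"
      have "block_length \<tau> v \<le> block_length \<tau> n"
      proof -
        have "w v \<le> w n" using v mono_w by (simp add: mono_def)
        then show ?thesis unfolding block_length_def by (rule mult_le_mono2)
      qed
      then show "v \<in> ?S \<union> {..v0} \<union> {n - block_length \<tau> n<..n}"
        using tree_event_shape[OF g, of \<tau> v n] v0[of v] v by (cases "v \<le> v0"; cases "v + block_length \<tau> v \<le> n") auto
    qed
    then have "card ?A \<le> card (?S \<union> {..v0} \<union> {n - block_length \<tau> n<..n})"
      by (rule card_mono[rotated]) auto
    also have "\<dots> \<le> card ?S + card {..v0} + card {n - block_length \<tau> n<..n}"
      by (intro card_Un_le[THEN order_trans] add_mono order_refl)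
    also have "\<dots> \<le> card ?S + (v0 + 1) + block_length \<tau> n" by simp
    finally have "real (card ?A) \<le> real (card ?S) + (real (v0 + 1) + real (block_length \<tau> n))" by linarith
    moreover have "real (v0 + 1) + real (block_length \<tau> n) < e / 2 * real n"
      using n unfolding add_divide_distrib[symmetric] by (subst (asm) pos_divide_less_eq) auto
    ultimately show "(pweight \<tau> - e) * real n \<le> real (card ?S)"
      using c by (simp add: algebra_simps)
  qed
qed

lemma has_sum_pweight_forget: "(pweight has_sum pmf gw_pmf t) {\<tau>. forget \<tau> = t}"
proof -
  have "pmf gw_pmf t = measure plane_gw {\<tau>. forget \<tau> = t}"
    by (simp add: gw_pmf_def pmf_map vimage_def)
  moreover have "pmf plane_gw = pweight" by (rule ext) simp
  ultimately show ?thesis using has_sum_pmf[of plane_gw "{\<tau>. forget \<tau> = t}"] by simp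
qed

text \<open>
  Finitely many plane trees \<open>\<tau>\<close> carry almost all of the probability of \<open>t\<close>.
\<close>
lemma whp_fringe:
  assumes "e > 0"
  shows "whp (\<lambda>n \<omega>. (pmf gw_pmf t - e) * real n \<le>
     real (card (with_fringe n \<omega> t)))"
proof -
  have "\<forall>\<^sub>F F in finite_subsets_at_top {\<tau>. forget \<tau> = t}. pmf gw_pmf t - e / 2 < sum pweight F"
    using has_sum_pweight_forget[of t] \<open>e > 0\<close> unfolding has_sum_def by (intro order_tendstoD(1)) auto
  then obtain F where F: "finite F" "F \<subseteq> {\<tau>. forget \<tau> = t}" "pmf gw_pmf t - e / 2 < sum pweight F"
    unfolding eventually_finite_subsets_at_top by blast
  define d where "d = e / (2 * real (Suc (card F)))"
  have d: "d > 0" "real (card F) * d \<le> e / 2"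
    using \<open>e > 0\<close> by (auto simp: d_def field_simps)
  have "whp (\<lambda>n \<omega>. \<forall>\<tau>\<in>F. in_windows \<omega> \<and>
      (pweight \<tau> - d) * real n \<le> real (card (with_shape n \<omega> \<tau>)))"
    using F(1) d(1) by (intro whp_ball whp_shape)
  then show ?thesis
  proof (rule whp_mono, intro always_eventually allI ballI impI)
    fix n \<omega> assume h: "\<forall>\<tau>\<in>F. in_windows \<omega> \<and>
      (pweight \<tau> - d) * real n \<le> real (card (with_shape n \<omega> \<tau>))"
    have "(pmf gw_pmf t - e) * real n \<le> (sum pweight F - real (card F) * d) * real n"
      using F(3) d(2) by (intro mult_right_mono) auto
    also have "\<dots> = (\<Sum>\<tau>\<in>F. (pweight \<tau> - d) * real n)"
      by (simp add: sum_subtractf sum_distrib_right left_diff_distrib)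
    also have "\<dots> \<le> (\<Sum>\<tau>\<in>F. real (card (with_shape n \<omega> \<tau>)))" using h by (intro sum_mono) auto
    also have "\<dots> = real (card (\<Union>\<tau>\<in>F. with_shape n \<omega> \<tau>))"
      using F(1) by (subst card_UN_disjoint) (auto dest: shape_unique)
    also have "\<dots> \<le> real (card (with_fringe n \<omega> t))"
      using F(2) by (intro of_nat_mono card_mono) (auto simp: tree_class_shape)
    finally show "(pmf gw_pmf t - e) * real n \<le> real (card (with_fringe n \<omega> t))" .
  qed
qed

text \<open>
  Each choice has countably many values, so even the discrete \<open>\<sigma>\<close>-algebra on graphs is allowed.
\<close>
lemma measurable_T: "n \<ge> 1 \<Longrightarrow> T n \<in> M \<rightarrow>\<^sub>M count_space UNIV"
proof (induction n rule: nat_induct_at_least)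
  case base
  show ?case by (subst measurable_cong[OF T_1]) auto
next
  case (Suc n)
  have "(\<lambda>\<omega>. attach (T n \<omega>) (Suc n) (V n \<omega>)) \<in> M \<rightarrow>\<^sub>M count_space UNIV"
  proof (rule measurable_compose_countable[where g = "V n"])
    show "V n \<in> M \<rightarrow>\<^sub>M count_space UNIV" using Suc.hyps by simp
    show "(\<lambda>\<omega>. attach (T n \<omega>) (Suc n) i) \<in> M \<rightarrow>\<^sub>M count_space UNIV" for i
      by (rule measurable_compose[OF Suc.IH]) simp
  qed
  then show ?case using Suc.hyps by (subst measurable_cong[OF T_Suc]) auto
qed

lemma T_event: "n \<ge> 1 \<Longrightarrow> {\<omega> \<in> space M. P (T n \<omega>)} \<in> events"
  using measurable_sets[OF measurable_T, of n "{G. P G}"] by (simp add: vimage_def Int_def conj_commute)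

context
  fixes L assumes L: "sin_tree_law (gw_law (poisson_pmf 1)) L"
begin

interpretation L: prob_space L using L by (simp add: sin_tree_law_def)

lemma fringe_measurable:
  "(\<lambda>t. map (\<lambda>i. Some (t i)) [0..<Suc k]) \<in> L \<rightarrow>\<^sub>M borel_sigma (tuple_topology k)"
proof -
  have "(\<lambda>xs. map Some xs) \<in> count_space {xs. length xs = Suc k} \<rightarrow>\<^sub>M borel_sigma (tuple_topology k)"
    by (auto simp: tuples_def)
  moreover have "(\<lambda>t. map t [0..<Suc k]) \<in> L \<rightarrow>\<^sub>M count_space {xs. length xs = Suc k}"
    using measurable_prefix[OF L, of "Suc k"] by (auto simp: measurable_count_space_eq_countable simp del: upt_Suc)
  ultimately have "(\<lambda>t. map Some (map t [0..<Suc k])) \<in> L \<rightarrow>\<^sub>M borel_sigma (tuple_topology k)"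
    by (rule measurable_compose[rotated])
  then show ?thesis by (simp add: comp_def del: upt_Suc)
qed

lemma prob_space_sin_fringe: "prob_space (sin_tree_fringe k L)"
  unfolding sin_tree_fringe_def by (rule L.prob_space_distr[OF fringe_measurable])

lemma sets_sin_fringe [simp]: "sets (sin_tree_fringe k L) = Pow (tuples k)"
  by (simp add: sin_tree_fringe_def)

lemma measure_sin_fringe:
  "A \<subseteq> tuples k \<Longrightarrow> measure (sin_tree_fringe k L) A = measure L {t. map (\<lambda>i. Some (t i)) [0..<Suc k] \<in> A}"
  unfolding sin_tree_fringe_def using fringe_measurable
  by (subst measure_distr) (auto simp: vimage_def space_sin_law[OF L] simp del: upt_Suc)

lemma prob_space_empirical:
  assumes "n \<ge> 1" "\<omega> \<in> space M"
  shows "prob_space (empirical_fringe k (T n \<omega>))"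
  unfolding empirical_fringe_def
proof (rule prob_space.prob_space_distr)
  show "prob_space (uniform_count_measure (vertices (T n \<omega>)))"
    using assms by (intro prob_space_uniform_count_measure) (auto simp: vertices_T)
  show "(\<lambda>v. fringe_tuple k v (T n \<omega>)) \<in> uniform_count_measure (vertices (T n \<omega>)) \<rightarrow>\<^sub>M borel_sigma (tuple_topology k)"
    by (auto simp: measurable_def space_uniform_count_measure sets_uniform_count_measure
        fringe_tuple_def tuples_def)
qed

lemma whp_tuple:
  assumes "e > 0" "xs \<in> tuples k"
  shows "whp (\<lambda>n \<omega>. measure (sin_tree_fringe k L) {xs} - e \<le> measure (empirical_fringe k (T n \<omega>)) {xs})"
proof (cases "None \<in> set xs")
  case True
  then have "{t. map (\<lambda>i. Some (t i)) [0..<Suc k] \<in> {xs}} = {}" by (auto simp del: upt_Suc)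
  then have "measure (sin_tree_fringe k L) {xs} = 0" using assms(2)
    by (subst measure_sin_fringe) (simp_all del: upt_Suc)
  then show ?thesis using assms(1)
    by (intro whp_mono[OF whp_AE[of "\<lambda>_. True"]]) (auto intro!: always_eventually order_trans[OF _ measure_nonneg])
next
  case False
  define u where "u i = the (xs ! i)" for i
  have len: "length xs = Suc k" using assms(2) by (simp add: tuples_def)
  have xs: "xs = map (\<lambda>i. Some (u i)) [0..<Suc k]"
  proof (rule nth_equalityI)
    fix i assume i: "i < length xs"
    then have "xs ! i \<noteq> None" using False by (metis nth_mem)
    then show "xs ! i = map (\<lambda>i. Some (u i)) [0..<Suc k] ! i"
      using i len by (simp add: u_def del: upt_Suc)
  qed (simp add: len)
  let ?s = "monotone_rep u"
  define Q where "Q = (\<Prod>m=1..k. count (children (?s m)) (?s (m - 1)))"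
  have "{t. map (\<lambda>i. Some (t i)) [0..<Suc k] \<in> {xs}} = {t. \<forall>m\<le>k. t m = u m}"
    unfolding xs by (auto simp: less_Suc_eq_le simp del: upt_Suc)
  then have "measure (sin_tree_fringe k L) {xs} = measure L {t. \<forall>m\<le>k. t m = u m}"
    using assms(2) by (subst measure_sin_fringe) (simp_all del: upt_Suc)
  also have "\<dots> = pmf gw_pmf (?s k) * real Q"
    unfolding sin_law_prefix[OF L] measure_gw_Some by (simp add: Q_def)
  finally have lim: "measure (sin_tree_fringe k L) {xs} = pmf gw_pmf (?s k) * real Q" .
  define d where "d = e / real (Suc Q)"
  have d: "d > 0" "d * real Q \<le> e" using assms(1) by (auto simp: d_def field_simps)
  have "whp (\<lambda>n \<omega>. in_windows \<omega> \<and> (pmf gw_pmf (?s k) - d) * real n \<le>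
      real (card (with_fringe n \<omega> (?s k))))"
    using d by (intro whp_conj whp_AE AE_in_windows whp_fringe)
  then show ?thesis
  proof (rule whp_mono)
    show "\<forall>\<^sub>F n in sequentially. \<forall>\<omega>\<in>space M. in_windows \<omega> \<and> (pmf gw_pmf (?s k) - d) * real n \<le>
      real (card (with_fringe n \<omega> (?s k))) \<longrightarrow>
      measure (sin_tree_fringe k L) {xs} - e \<le> measure (empirical_fringe k (T n \<omega>)) {xs}"
      using eventually_ge_at_top[of 1]
    proof (eventually_elim, intro ballI impI, elim conjE)
      fix n \<omega> assume n: "1 \<le> n" and w: "\<omega> \<in> space M" and g: "in_windows \<omega>"
        and c: "(pmf gw_pmf (?s k) - d) * real n \<le> real (card (with_fringe n \<omega> (?s k)))"
      interpret finite_ordered_tree "{1..n}" 1 "par \<omega>" id "kidlist n \<omega>" by (rule tree_T[OF g n])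
      have "measure (empirical_fringe k (T n \<omega>)) {xs} =
          real (card {v \<in> {1..n}. fringe_tuple k v (T n \<omega>) = xs}) / real n"
        using n w assms(2) by (subst measure_empirical_fringe) (auto simp: vertices_T)
      also have "card {v \<in> {1..n}. fringe_tuple k v (T n \<omega>) = xs} =
          card (with_fringe n \<omega> (?s k)) * Q"
        unfolding xs T_eq[OF n w] card_fringe_tuple Q_def ..
      finally have *: "measure (empirical_fringe k (T n \<omega>)) {xs} * real n =
          real (card (with_fringe n \<omega> (?s k))) * real Q" using n by simp
      have "(measure (sin_tree_fringe k L) {xs} - e) * real n \<le>
          ((pmf gw_pmf (?s k) - d) * real Q) * real n"
        unfolding lim using d(2) by (intro mult_right_mono) (auto simp: algebra_simps)
      also have "\<dots> = ((pmf gw_pmf (?s k) - d) * real n) * real Q" by simp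
      also have "\<dots> \<le> measure (empirical_fringe k (T n \<omega>)) {xs} * real n"
        unfolding * using c by (intro mult_right_mono) auto
      finally show "measure (sin_tree_fringe k L) {xs} - e \<le> measure (empirical_fringe k (T n \<omega>)) {xs}"
        using n by simp
    qed
  qed
qed

lemma whp_integral:
  fixes f :: "rtree option list \<Rightarrow> real"
  assumes "e > 0" and B: "\<And>xs. xs \<in> tuples k \<Longrightarrow> \<bar>f xs\<bar> \<le> B"
  shows "whp (\<lambda>n \<omega>. \<bar>(\<integral>xs. f xs \<partial>empirical_fringe k (T n \<omega>)) - (\<integral>xs. f xs \<partial>sin_tree_fringe k L)\<bar> < e)"
proof -
  let ?Q = "sin_tree_fringe k L"
  define d where "d = e / (8 * (\<bar>B\<bar> + 1))"
  have d: "d > 0" "4 * \<bar>B\<bar> * d < e"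
    using assms(1) by (auto simp: d_def field_simps intro!: add_pos_nonneg)
  obtain F where F: "finite F" "F \<subseteq> tuples k" "measure ?Q F \<ge> 1 - d"
    using tight_countable[OF prob_space_sin_fringe sets_sin_fringe d(1)] by blast
  have "whp (\<lambda>n \<omega>. \<forall>xs\<in>F. measure ?Q {xs} - d / real (Suc (card F)) \<le> measure (empirical_fringe k (T n \<omega>)) {xs})"
    using F d(1) by (intro whp_ball whp_tuple) auto
  then show ?thesis
  proof (rule whp_mono)
    show "\<forall>\<^sub>F n in sequentially. \<forall>\<omega>\<in>space M.
      (\<forall>xs\<in>F. measure ?Q {xs} - d / real (Suc (card F)) \<le> measure (empirical_fringe k (T n \<omega>)) {xs}) \<longrightarrow>
      \<bar>(\<integral>xs. f xs \<partial>empirical_fringe k (T n \<omega>)) - (\<integral>xs. f xs \<partial>?Q)\<bar> < e"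
      using eventually_ge_at_top[of 1]
    proof (eventually_elim, intro ballI impI)
      fix n \<omega> assume n: "1 \<le> n" "\<omega> \<in> space M"
        and c: "\<forall>xs\<in>F. measure ?Q {xs} - d / real (Suc (card F)) \<le> measure (empirical_fringe k (T n \<omega>)) {xs}"
      have "\<bar>(\<integral>xs. f xs \<partial>empirical_fringe k (T n \<omega>)) - (\<integral>xs. f xs \<partial>?Q)\<bar> \<le> 4 * \<bar>B\<bar> * d"
      proof (rule integral_discrete_close)
        show "prob_space (empirical_fringe k (T n \<omega>))" using n by (rule prob_space_empirical)
        show "sets (empirical_fringe k (T n \<omega>)) = Pow (tuples k)" by (simp add: empirical_fringe_def)
        show "\<bar>f xs\<bar> \<le> \<bar>B\<bar>" if "xs \<in> tuples k" for xs using B[OF that] by simp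
      qed (use F d c prob_space_sin_fringe in auto)
      then show "\<bar>(\<integral>xs. f xs \<partial>empirical_fringe k (T n \<omega>)) - (\<integral>xs. f xs \<partial>?Q)\<bar> < e" using d(2) by linarith
    qed
  qed
qed

text \<open>
  It suffices to treat a subbasis; a subbasic neighbourhood concerns the integral of one bounded
  function.
\<close>
lemma whp_weak_nbhd:
  assumes "openin (weak_topology (tuple_topology k)) U" "sin_tree_fringe k L \<in> U"
  shows "whp (\<lambda>n \<omega>. empirical_fringe k (T n \<omega>) \<in> U)"
proof -
  let ?X = "tuple_topology k"
  have "generate_topology_on {{\<mu> \<in> borel_probs ?X. (\<integral>x. f x \<partial>\<mu>) \<in> U} | (f :: _ \<Rightarrow> real) U.
        continuous_map ?X euclideanreal f \<and> bounded (f ` topspace ?X) \<and> open U} U"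
    using assms(1) by (simp only: weak_topology_def openin_topology_generated_by_iff)
  then show ?thesis using assms(2)
  proof (induction rule: generate_topology_on.induct)
    case (Int a b)
    then show ?case using whp_conj[of "\<lambda>n \<omega>. empirical_fringe k (T n \<omega>) \<in> a" "\<lambda>n \<omega>. empirical_fringe k (T n \<omega>) \<in> b"] by simp
  next
    case (UN K)
    then obtain k' where "k' \<in> K" "sin_tree_fringe k L \<in> k'" by blast
    then have "whp (\<lambda>n \<omega>. empirical_fringe k (T n \<omega>) \<in> k')" using UN.IH by blast
    then show ?case by (rule whp_mono) (use \<open>k' \<in> K\<close> in \<open>auto intro!: always_eventually\<close>)
  next
    case (Basis s)
    then obtain f :: "rtree option list \<Rightarrow> real" and O' where s: "s = {\<mu> \<in> borel_probs ?X. (\<integral>x. f x \<partial>\<mu>) \<in> O'}"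
      "bounded (f ` tuples k)" "open O'" by auto
    obtain B where B: "\<And>xs. xs \<in> tuples k \<Longrightarrow> \<bar>f xs\<bar> \<le> B"
      using s(2) by (auto simp: bounded_iff)
    obtain e where e: "e > 0" "\<And>y. \<bar>y - (\<integral>x. f x \<partial>sin_tree_fringe k L)\<bar> < e \<Longrightarrow> y \<in> O'"
      using s(1,3) Basis.prems unfolding open_dist dist_real_def by blast
    have "whp (\<lambda>n \<omega>. \<bar>(\<integral>xs. f xs \<partial>empirical_fringe k (T n \<omega>)) - (\<integral>xs. f xs \<partial>sin_tree_fringe k L)\<bar> < e)"
      using e(1) B by (rule whp_integral)
    then show ?case
    proof (rule whp_mono)
      show "\<forall>\<^sub>F n in sequentially. \<forall>\<omega>\<in>space M.
        \<bar>(\<integral>xs. f xs \<partial>empirical_fringe k (T n \<omega>)) - (\<integral>xs. f xs \<partial>sin_tree_fringe k L)\<bar> < e \<longrightarrow>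
        empirical_fringe k (T n \<omega>) \<in> s"
        using eventually_ge_at_top[of 1]
      proof (eventually_elim, intro ballI impI)
        fix n \<omega> assume n: "1 \<le> n" "\<omega> \<in> space M"
          and "\<bar>(\<integral>xs. f xs \<partial>empirical_fringe k (T n \<omega>)) - (\<integral>xs. f xs \<partial>sin_tree_fringe k L)\<bar> < e"
        then have "(\<integral>xs. f xs \<partial>empirical_fringe k (T n \<omega>)) \<in> O'" by (intro e(2))
        moreover have "empirical_fringe k (T n \<omega>) \<in> borel_probs ?X"
          using prob_space_empirical[OF n] by (simp add: borel_probs_def empirical_fringe_def)
        ultimately show "empirical_fringe k (T n \<omega>) \<in> s" by (simp add: s(1))
      qed
    qed
  qed auto
qed

lemma extended_fringe_convergence: "extended_fringe_converges M T L"
  unfolding extended_fringe_converges_def converges_in_prob_def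
proof (intro allI conjI impI; (elim conjE)?)
  fix k
  let ?X = "tuple_topology k"
  have "{\<mu> \<in> borel_probs ?X. (\<integral>x. (0::real) \<partial>\<mu>) \<in> UNIV} \<in>
      {{\<mu> \<in> borel_probs ?X. (\<integral>x. f x \<partial>\<mu>) \<in> U} | (f :: _ \<Rightarrow> real) U.
        continuous_map ?X euclideanreal f \<and> bounded (f ` topspace ?X) \<and> open U}"
    by (rule CollectI, intro exI[of _ "\<lambda>_. 0::real"] exI[of _ UNIV]) (auto simp: bounded_iff)
  moreover have "sin_tree_fringe k L \<in> borel_probs ?X"
    by (simp add: borel_probs_def prob_space_sin_fringe)
  ultimately show "sin_tree_fringe k L \<in> topspace (weak_topology ?X)"
    unfolding weak_topology_def topology_generated_by_topspace by blast
  fix U assume U: "openin (weak_topology ?X) U" "sin_tree_fringe k L \<in> U"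
  show "(\<lambda>n. prob {\<omega> \<in> space M. empirical_fringe k (T n \<omega>) \<in> U}) \<longlonglongrightarrow> 1"
  proof (rule whpD[OF whp_weak_nbhd[OF U]])
    show "\<forall>\<^sub>F n in sequentially. {\<omega> \<in> space M. empirical_fringe k (T n \<omega>) \<in> U} \<in> events"
      using eventually_ge_at_top[of 1] by eventually_elim (rule T_event)
  qed
qed

lemma sin_law_root: "measure L {t. P (t 0)} = measure gw_pmf {s. P s}"
proof -
  have m: "(\<lambda>t. t 0) \<in> L \<rightarrow>\<^sub>M count_space UNIV"
    using measurable_compose[OF measurable_prefix[OF L, of 1], of hd "count_space UNIV"] by simp
  have "distr L (count_space UNIV) (\<lambda>t. t 0) = measure_pmf gw_pmf"
  proof (rule measure_eqI_countable)
    fix s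
    have "measure L {t. \<forall>m\<le>0. t m = s} = pmf gw_pmf s"
      unfolding sin_law_prefix[OF L, of 0 "\<lambda>_. s"] by (simp add: measure_gw_Some)
    then show "emeasure (distr L (count_space UNIV) (\<lambda>t. t 0)) {s} = emeasure gw_pmf {s}"
      using m by (simp add: emeasure_distr space_sin_law[OF L] vimage_def L.emeasure_eq_measure emeasure_pmf_single)
  qed auto
  then have "measure gw_pmf {s. P s} = measure (distr L (count_space UNIV) (\<lambda>t. t 0)) {s. P s}" by simp
  also have "\<dots> = measure L {t. P (t 0)}"
    using m by (simp add: measure_distr space_sin_law[OF L] vimage_def)
  finally show ?thesis by simp
qed

text \<open>
  Except at the root, the degree is one more than the number of children, which is read off from the
  \<open>0\<close>-th part of the fringe decomposition.
\<close>
lemma degree_convergence: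
  assumes "k \<ge> 1" "\<epsilon> > 0"
  shows "(\<lambda>n. prob {\<omega> \<in> space M.
    \<bar>real (num_degree (T n \<omega>) k) / real n - exp (-1) / fact (k - 1)\<bar> > \<epsilon>}) \<longlonglongrightarrow> 0"
proof -
  define A where "A = {xs \<in> tuples 0. \<exists>t. xs ! 0 = Some t \<and> size (children t) = k - 1}"
  let ?Q = "sin_tree_fringe 0 L"
  let ?p = "exp (-1) / fact (k - 1) :: real"
  let ?dev = "\<lambda>n \<omega>. \<bar>real (num_degree (T n \<omega>) k) / real n - ?p\<bar>"
  have AT: "A \<subseteq> tuples 0" by (auto simp: A_def)
  have Q: "measure ?Q A = ?p"
  proof -
    have "{t. map (\<lambda>i. Some (t i)) [0..<Suc 0] \<in> A} = {t. size (children (t 0)) = k - 1}"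
      by (auto simp: A_def tuples_def)
    then show ?thesis using measure_sin_fringe[OF AT] sin_law_root[of "\<lambda>s. size (children s) = k - 1"]
      by (simp add: gw_root_degree)
  qed
  have spQ: "space ?Q = tuples 0" by (simp add: sin_tree_fringe_def)
  have "whp (\<lambda>n \<omega>. \<bar>(\<integral>xs. indicator A xs \<partial>empirical_fringe 0 (T n \<omega>)) - (\<integral>xs. indicator A xs \<partial>?Q)\<bar> < \<epsilon> / 2)"
    using assms(2) by (intro whp_integral[where B = 1]) (auto simp: indicator_def)
  then have w: "whp (\<lambda>n \<omega>. in_windows \<omega> \<and> \<bar>measure (empirical_fringe 0 (T n \<omega>)) A - ?p\<bar> < \<epsilon> / 2)"
    using AT Q spQ by (intro whp_conj whp_AE AE_in_windows)
      (simp add: Int_absorb2 empirical_fringe_def)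
  have "whp (\<lambda>n \<omega>. ?dev n \<omega> \<le> \<epsilon>)"
    using w
  proof (rule whp_mono)
    have "\<forall>\<^sub>F n in sequentially. 1 / real n < \<epsilon> / 2"
      using assms(2) by (intro order_tendstoD(2)[OF lim_1_over_n]) simp
    then show "\<forall>\<^sub>F n in sequentially. \<forall>\<omega>\<in>space M.
        in_windows \<omega> \<and> \<bar>measure (empirical_fringe 0 (T n \<omega>)) A - ?p\<bar> < \<epsilon> / 2 \<longrightarrow>
        ?dev n \<omega> \<le> \<epsilon>"
      using eventually_ge_at_top[of 1]
    proof (eventually_elim, intro ballI impI, elim conjE)
      fix n \<omega> assume n: "1 / real n < \<epsilon> / 2" "1 \<le> n" and w: "\<omega> \<in> space M" and g: "in_windows \<omega>"
        and c: "\<bar>measure (empirical_fringe 0 (T n \<omega>)) A - ?p\<bar> < \<epsilon> / 2"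
      interpret finite_ordered_tree "{1..n}" 1 "par \<omega>" id "kidlist n \<omega>" by (rule tree_T[OF g n(2)])
      let ?D = "{v \<in> {1..n}. degree (T n \<omega>) v = k}"
      let ?E = "{v \<in> {1..n}. fringe_tuple 0 v (T n \<omega>) \<in> A}"
      have deg: "degree (T n \<omega>) v = k \<longleftrightarrow> fringe_tuple 0 v (T n \<omega>) \<in> A" if "v \<in> {1..n}" "v \<noteq> 1" for v
      proof -
        have "fringe_tuple 0 v (T n \<omega>) = [Some (tree_class (kidlist n \<omega>) v)]"
          using fringe_0[OF that(1)] by (simp add: fringe_tuple_def T_eq[OF n(2) w])
        then show ?thesis using degree_G[OF that(1)] that(2) assms(1)
          by (auto simp: A_def tuples_def T_eq[OF n(2) w])
      qed
      have "?D \<subseteq> insert 1 ?E" "?E \<subseteq> insert 1 ?D" using deg by auto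
      then have "card ?D \<le> card (insert 1 ?E)" "card ?E \<le> card (insert 1 ?D)"
        by (auto intro!: card_mono)
      then have "\<bar>real (card ?D) - real (card ?E)\<bar> \<le> 1"
        using card_insert_le_m1[of "Suc (card ?E)" ?E 1] card_insert_le_m1[of "Suc (card ?D)" ?D 1] by linarith
      moreover have "measure (empirical_fringe 0 (T n \<omega>)) A = real (card ?E) / real n"
        using n w AT by (subst measure_empirical_fringe) (auto simp: vertices_T)
      moreover have "num_degree (T n \<omega>) k = card ?D"
        using n w by (simp add: num_degree_def vertices_T)
      ultimately have "\<bar>real (num_degree (T n \<omega>) k) / real n - measure (empirical_fringe 0 (T n \<omega>)) A\<bar> \<le> 1 / real n"
        by (simp add: divide_right_mono flip: diff_divide_distrib)
      then show "?dev n \<omega> \<le> \<epsilon>" using c n(1) by linarith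
    qed
  qed
  then have "(\<lambda>n. prob {\<omega> \<in> space M. ?dev n \<omega> \<le> \<epsilon>}) \<longlonglongrightarrow> 1"
  proof (rule whpD)
    show "\<forall>\<^sub>F n in sequentially. {\<omega> \<in> space M. ?dev n \<omega> \<le> \<epsilon>} \<in> events"
      using eventually_ge_at_top[of 1] by eventually_elim (rule T_event)
  qed
  then have "(\<lambda>n. 1 - prob {\<omega> \<in> space M. ?dev n \<omega> \<le> \<epsilon>}) \<longlonglongrightarrow> 1 - 1"
    by (intro tendsto_intros)
  then have "(\<lambda>n. 1 - prob {\<omega> \<in> space M. ?dev n \<omega> \<le> \<epsilon>}) \<longlonglongrightarrow> 0" by simp
  then show ?thesis
  proof (rule Lim_transform_eventually)
    show "\<forall>\<^sub>F n in sequentially. 1 - prob {\<omega> \<in> space M. ?dev n \<omega> \<le> \<epsilon>} =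
      prob {\<omega> \<in> space M. ?dev n \<omega> > \<epsilon>}"
      using eventually_ge_at_top[of 1]
    proof eventually_elim
      case (elim n)
      have "prob (space M - {\<omega> \<in> space M. ?dev n \<omega> \<le> \<epsilon>}) =
         1 - prob {\<omega> \<in> space M. ?dev n \<omega> \<le> \<epsilon>}"
        by (rule prob_compl) (rule T_event[OF elim])
      moreover have "space M - {\<omega> \<in> space M. ?dev n \<omega> \<le> \<epsilon>} =
          {\<omega> \<in> space M. ?dev n \<omega> > \<epsilon>}" by auto
      ultimately show ?case by simp
    qed
  qed
qed

end
end

section \<open>The mesoscopic window\<close>

text \<open>
  The minimum concerns only \<open>m \<le> 1\<close>, where \<open>m - \<lfloor>m\<^sup>\<beta>\<rfloor> = 0\<close> is not a vertex.
\<close>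
definition meso_width :: "real \<Rightarrow> nat \<Rightarrow> nat" where
  "meso_width \<beta> m = min m (nat \<lfloor>real m powr \<beta>\<rfloor> + 1)"

lemma mesoscopic_window:
  "{v \<in> {1..n}. mesoscopic \<beta> n \<le> v \<and> v \<le> n} = {n + 1 - meso_width \<beta> n..n}"
  by (auto simp: mesoscopic_def meso_width_def min_def)

context
  fixes \<beta> :: real assumes \<beta>: "0 < \<beta>" "\<beta> < 1"
begin

lemma meso_width_bounds:
  assumes "m \<ge> 1"
  shows "real m powr \<beta> \<le> real (meso_width \<beta> m)" "real (meso_width \<beta> m) \<le> real m powr \<beta> + 1"
proof -
  have "real m powr \<beta> \<le> real m powr 1" using assms \<beta> by (intro powr_mono) auto
  moreover have "real (nat \<lfloor>x\<rfloor>) \<le> x \<and> x \<le> real (nat \<lfloor>x\<rfloor>) + 1" if "0 \<le> x" for x :: real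
    using that by linarith
  from this[of "real m powr \<beta>"]
  have "real (nat \<lfloor>real m powr \<beta>\<rfloor>) \<le> real m powr \<beta>" "real m powr \<beta> \<le> real (nat \<lfloor>real m powr \<beta>\<rfloor>) + 1"
    by simp_all
  moreover have "meso_width \<beta> m = m \<and> m \<le> nat \<lfloor>real m powr \<beta>\<rfloor> + 1 \<or>
      meso_width \<beta> m = nat \<lfloor>real m powr \<beta>\<rfloor> + 1"
    by (simp add: meso_width_def min_def)
  moreover have "real m powr 1 = real m" by simp
  ultimately show "real m powr \<beta> \<le> real (meso_width \<beta> m)" "real (meso_width \<beta> m) \<le> real m powr \<beta> + 1"
    by linarith+
qed

lemma mono_meso_width: "mono (meso_width \<beta>)"
proof (rule monoI)
  fix x y :: nat assume "x \<le> y"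
  moreover from this have "real x powr \<beta> \<le> real y powr \<beta>" using \<beta> by (intro powr_mono2) auto
  ultimately show "meso_width \<beta> x \<le> meso_width \<beta> y"
    unfolding meso_width_def by (intro min.mono add_mono nat_mono floor_mono) auto
qed

lemma meso_width_Suc: "meso_width \<beta> (Suc m) \<le> Suc (meso_width \<beta> m)"
proof -
  have le: "nat \<lfloor>real n powr \<beta>\<rfloor> \<le> n" for n
  proof (cases "n = 0")
    case False
    then have "real n powr \<beta> \<le> real n powr 1" using \<beta> by (intro powr_mono) auto
    then show ?thesis using False by (simp add: nat_le_iff floor_le_iff)
  qed simp
  have "mesoscopic \<beta> m \<le> mesoscopic \<beta> (Suc m)"
    using mono_mesoscopic[OF \<beta>] by (simp add: mono_def)
  then show ?thesis using le[of m] le[of "Suc m"] unfolding mesoscopic_def meso_width_def by linarith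
qed

lemma meso_width_top: "filterlim (meso_width \<beta>) at_top sequentially"
proof -
  have "filterlim (\<lambda>m. real m powr \<beta>) at_top sequentially" using \<beta> by real_asymp
  then have "filterlim (\<lambda>m. real (meso_width \<beta> m)) at_top sequentially"
  proof (rule filterlim_at_top_mono)
    show "\<forall>\<^sub>F m in sequentially. real m powr \<beta> \<le> real (meso_width \<beta> m)"
      using eventually_ge_at_top[of 1] by eventually_elim (rule meso_width_bounds)
  qed
  then show ?thesis by (simp add: filterlim_sequentially_iff_filterlim_real)
qed

lemma meso_width_small: "(\<lambda>m. real (meso_width \<beta> m) / real m) \<longlonglongrightarrow> 0"
proof (rule tendsto_sandwich[where f = "\<lambda>_. 0" and h = "\<lambda>m. (real m powr \<beta> + 1) / real m"])
  show "(\<lambda>m. (real m powr \<beta> + 1) / real m) \<longlonglongrightarrow> 0" using \<beta> by real_asymp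
  show "\<forall>\<^sub>F m in sequentially. real (meso_width \<beta> m) / real m \<le> (real m powr \<beta> + 1) / real m"
    using eventually_ge_at_top[of 1] by eventually_elim (intro divide_right_mono meso_width_bounds, auto)
qed auto

lemma meso_width_slow:
  "(\<lambda>m. real (meso_width \<beta> (m + c * meso_width \<beta> m)) / real (meso_width \<beta> m)) \<longlonglongrightarrow> 1"
proof (rule tendsto_sandwich[where f = "\<lambda>_. 1"
      and h = "\<lambda>m. ((real m + real c * (real m powr \<beta> + 1)) powr \<beta> + 1) / real m powr \<beta>"])
  show "(\<lambda>m. ((real m + real c * (real m powr \<beta> + 1)) powr \<beta> + 1) / real m powr \<beta>) \<longlonglongrightarrow> 1"
    using \<beta> by real_asymp
  show "\<forall>\<^sub>F m in sequentially. real (meso_width \<beta> (m + c * meso_width \<beta> m)) / real (meso_width \<beta> m) \<le>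
      ((real m + real c * (real m powr \<beta> + 1)) powr \<beta> + 1) / real m powr \<beta>"
    using eventually_ge_at_top[of 1]
  proof eventually_elim
    case (elim m)
    have "real (meso_width \<beta> (m + c * meso_width \<beta> m)) \<le> real (m + c * meso_width \<beta> m) powr \<beta> + 1"
      using elim by (intro meso_width_bounds) auto
    also have "real (m + c * meso_width \<beta> m) powr \<beta> \<le> (real m + real c * (real m powr \<beta> + 1)) powr \<beta>"
      using \<beta> meso_width_bounds[OF elim] by (intro powr_mono2) (auto intro!: mult_left_mono)
    finally show ?case using elim meso_width_bounds[OF elim] by (intro frac_le) auto
  qed
  show "\<forall>\<^sub>F m in sequentially. 1 \<le> real (meso_width \<beta> (m + c * meso_width \<beta> m)) / real (meso_width \<beta> m)"
    using eventually_ge_at_top[of 1]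
  proof eventually_elim
    case (elim m)
    have "meso_width \<beta> m \<le> meso_width \<beta> (m + c * meso_width \<beta> m)"
      using mono_meso_width by (auto simp: mono_def)
    moreover have "meso_width \<beta> m \<ge> 1" using elim by (simp add: meso_width_def)
    ultimately show ?case by simp
  qed
qed simp

end

theorem theorem2p3:
  fixes \<beta> :: real
    and M :: "'w measure"
    and T :: "nat \<Rightarrow> 'w \<Rightarrow> nat rgraph"
  assumes "0 < \<beta>" and "\<beta> < 1"
    and "limited_memory_trees M (mesoscopic \<beta>) T"
  shows "(\<exists>!L. sin_tree_law (gw_law (poisson_pmf 1)) L)
    \<and> (\<forall>L. sin_tree_law (gw_law (poisson_pmf 1)) L \<longrightarrow> extended_fringe_converges M T L)
    \<and> (\<forall>k\<ge>1. \<forall>\<epsilon>>0.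
         (\<lambda>n. measure M {\<omega> \<in> space M.
            \<bar>real (num_degree (T n \<omega>) k) / real n - exp (-1) / fact (k - 1)\<bar> > \<epsilon>}) \<longlonglongrightarrow> 0)"
proof -
  obtain V :: "nat \<Rightarrow> 'w \<Rightarrow> nat" where V: "prob_space M"
    "prob_space.indep_vars M (\<lambda>_. count_space UNIV) V {1..}"
    "\<And>n. n \<ge> 1 \<Longrightarrow> distr M (count_space UNIV) (V n) =
       measure_pmf (pmf_of_set {v \<in> {1..n}. mesoscopic \<beta> n \<le> v \<and> v \<le> n})"
    "\<And>\<omega>. \<omega> \<in> space M \<Longrightarrow> T 1 \<omega> = \<lparr>vertices = {1}, edges = {}, rt = 1\<rparr>"
    "\<And>\<omega> n. \<omega> \<in> space M \<Longrightarrow> n \<ge> 1 \<Longrightarrow> T (Suc n) \<omega> = attach (T n \<omega>) (Suc n) (V n \<omega>)"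
    using assms(3) unfolding limited_memory_trees_def by blast
  interpret prob_space M by (rule V(1))
  interpret window_trees M V "meso_width \<beta>" T
  proof
    show "indep_vars (\<lambda>_. count_space UNIV) V {1..}" by (rule V(2))
    show "distr M (count_space UNIV) (V m) = measure_pmf (pmf_of_set {m + 1 - meso_width \<beta> m..m})"
      if "m \<ge> 1" for m using V(3)[OF that] by (simp only: mesoscopic_window)
    show "1 \<le> meso_width \<beta> m" if "m \<ge> 1" for m using that by (simp add: meso_width_def)
    show "meso_width \<beta> m \<le> m" for m by (simp add: meso_width_def)
  qed (use assms V mono_meso_width meso_width_Suc meso_width_top meso_width_small meso_width_slow in auto)
  have "\<exists>!L. sin_tree_law (gw_law (poisson_pmf 1)) L"
    using sin_tree_law_sin_measure sin_tree_law_unique by blast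
  then show ?thesis
    using extended_fringe_convergence degree_convergence[OF sin_tree_law_sin_measure] by blast
qed

end
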